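(* Let $1\le p<+\infty$ and let $\varphi\in W^{1,p}(\mathbb{R}_+)$ be non-negative. Then the tamping $\varphi^\natural$ of $\varphi$ has a weak derivative $\nabla\varphi^\natural\in L^p(\mathbb{R}_+)$ and $$\int_{\mathcal{H}_\infty(\varphi)}|\nabla\varphi|^p\;\leq\;\int_{\mathbb{R}_+}\Big(|\nabla\varphi|^p-|\nabla\varphi^\natural|^p\Big),$$ or equivalently $$\int_{\mathbb{R}_+}|\nabla\varphi^\natural|^p\;\leq\;\int_{\mathbb{R}_+\setminus\mathcal{H}_\infty(\varphi)}|\nabla\varphi|^p.$$
   Context: $\mathbb{R}_+=[0,+\infty)$, $\mathrm{meas}$ is Lebesgue measure, $\nabla$ denotes the (one-dimensional) weak derivative, $\mathfrak{M}_+(\mathbb{R}_+)$ is the set of non-negative measurable functions on $\mathbb{R}_+$ (identified when equal a.e.), and $\{\varphi\ge\nu\}=\{x\in\mathbb{R}_+:\varphi(x)\ge\nu\}$. Hollows. For $A\subseteq\mathbb{R}_+$ measurable, the essential convex hull is $\mathrm{conv\,ess}\,A:=\bigcap_{\mathrm{meas}(A\triangle B)=0}\mathrm{conv}\,B$. The hollows of $A$ are $\mathcal{H}(A):=(\mathrm{conv\,ess}\,A)\setminus A$ (understood up to null sets). For $\varphi\in\mathfrak{M}_+(\mathbb{R}_+)$ and $\nu\in(0,+\infty]$, $\mathcal{H}_\nu(\varphi):=\bigcup_{\lambda<\nu}\mathcal{H}(\{\varphi\ge\lambda\})$. Tamping. For $\nu>0$ let $x_\nu(\varphi):=\mathrm{inf\,ess}\{\varphi\ge\nu\}$,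 where $\mathrm{inf\,ess}\,A:=\sup\{a\ge0:\mathrm{meas}(A\cap[0,a])=0\}$, and, when $\mathrm{meas}\{\varphi\ge\nu\}>0$, $y_\nu(\varphi):=x_\nu(\varphi)-\mathrm{meas}(\mathcal{H}_\infty(\varphi)\cap[0,x_\nu(\varphi)])$. Put $S_\nu(\varphi):=[\,y_\nu(\varphi),\,y_\nu(\varphi)+\mathrm{meas}\{\varphi\ge\nu\}\,]$ (meaning $[y_\nu(\varphi),+\infty)$ if $\mathrm{meas}\{\varphi\ge\nu\}=+\infty$, and $\emptyset$ if $\mathrm{meas}\{\varphi\ge\nu\}=0$). These sets are non-increasing in $\nu$. The tamping $\varphi^\natural$ of $\varphi$ is the function whose superlevel sets $\{\varphi^\natural\ge\nu\}$ are the $S_\nu(\varphi)$; explicitly $\varphi^\natural(x):=\sup\{\nu>0: x\in S_\nu(\varphi)\}$ with $\sup\emptyset=0$ (for almost every $\nu$, $\{\varphi^\natural\ge\nu\}=S_\nu(\varphi)$ up to a null set). *)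

theory Defs
  imports "HOL-Analysis.Analysis"
begin

abbreviation half_line :: "real set" ("\<real>\<^sub>+") where
  "\<real>\<^sub>+ \<equiv> {0..}"

section \<open>Lebesgue and Sobolev spaces on the half-line\<close>

definition in_Lp :: "real \<Rightarrow> (real \<Rightarrow> real) \<Rightarrow> bool" where
  "in_Lp p f \<longleftrightarrow> f \<in> borel_measurable (lebesgue_on \<real>\<^sub>+) \<and>
     integrable (lebesgue_on \<real>\<^sub>+) (\<lambda>x. \<bar>f x\<bar> powr p)"

text \<open>Test functions and local integrability refer to the open half-line, the interior
  of \<open>\<real>\<^sub>+\<close>: nothing is prescribed at the boundary point 0.\<close>

definition test_function :: "(real \<Rightarrow> real) \<Rightarrow> bool" where
  "test_function \<eta> \<longleftrightarrow> (\<forall>n. ((deriv ^^ n) \<eta>) differentiable_on UNIV) \<and>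
     compact (closure {x. \<eta> x \<noteq> 0}) \<and> closure {x. \<eta> x \<noteq> 0} \<subseteq> {0<..}"

definition locally_integrable :: "(real \<Rightarrow> real) \<Rightarrow> bool" where
  "locally_integrable f \<longleftrightarrow> (\<forall>K. compact K \<and> K \<subseteq> {0<..} \<longrightarrow> integrable (lebesgue_on K) f)"

definition has_weak_derivative :: "(real \<Rightarrow> real) \<Rightarrow> (real \<Rightarrow> real) \<Rightarrow> bool" where
  "has_weak_derivative u g \<longleftrightarrow> locally_integrable u \<and> locally_integrable g \<and>
     (\<forall>\<eta>. test_function \<eta> \<longrightarrow>
        (LINT x|lebesgue_on \<real>\<^sub>+. u x * deriv \<eta> x) = - (LINT x|lebesgue_on \<real>\<^sub>+. g x * \<eta> x))"

definition in_W1p :: "real \<Rightarrow> (real \<Rightarrow> real) \<Rightarrow> bool" where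
  "in_W1p p u \<longleftrightarrow> in_Lp p u \<and> (\<exists>g. has_weak_derivative u g \<and> in_Lp p g)"

section \<open>Hollows\<close>

definition superlevel :: "(real \<Rightarrow> real) \<Rightarrow> real \<Rightarrow> real set" where
  "superlevel \<phi> \<nu> = {x \<in> \<real>\<^sub>+. \<phi> x \<ge> \<nu>}"

definition conv_ess :: "real set \<Rightarrow> real set" where
  "conv_ess A = \<Inter> {convex hull B |B. B \<subseteq> \<real>\<^sub>+ \<and> sym_diff A B \<in> null_sets lebesgue}"

definition hollows :: "real set \<Rightarrow> real set" where
  "hollows A = conv_ess A - A"

text \<open>The union is uncountable, but changing \<open>\<phi>\<close> on a null set changes it only by a null
  set: by monotonicity of \<open>conv_ess\<close> it is \<open>{x \<in> \<real>\<^sub>+. \<phi> x < m x}\<close> for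
  \<open>m x = Sup {l. l < \<nu> \<and> x \<in> conv_ess (superlevel \<phi> l)}\<close> (up to null sets), and \<open>m\<close> depends
  only on the class of \<open>\<phi>\<close>.  For \<open>\<phi> \<ge> 0\<close>, levels \<open>l \<le> 0\<close> contribute nothing.\<close>

definition hollows_below :: "ereal \<Rightarrow> (real \<Rightarrow> real) \<Rightarrow> real set" where
  "hollows_below \<nu> \<phi> = (\<Union>l\<in>{l. ereal l < \<nu>}. hollows (superlevel \<phi> l))"

section \<open>Tamping\<close>

text \<open>Only meaningful when \<open>A\<close> has positive measure; otherwise the essential infimum is
  \<open>+\<infinity>\<close> and this supremum is unspecified.  It is used below only in the former case.\<close>

definition inf_ess :: "real set \<Rightarrow> real" where
  "inf_ess A = Sup {a. a \<ge> 0 \<and> emeasure lebesgue (A \<inter> {0..a}) = 0}"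

definition tamp_x :: "(real \<Rightarrow> real) \<Rightarrow> real \<Rightarrow> real" where
  "tamp_x \<phi> \<nu> = inf_ess (superlevel \<phi> \<nu>)"

definition tamp_y :: "(real \<Rightarrow> real) \<Rightarrow> real \<Rightarrow> real" where
  "tamp_y \<phi> \<nu> = tamp_x \<phi> \<nu> - measure lebesgue (hollows_below \<infinity> \<phi> \<inter> {0..tamp_x \<phi> \<nu>})"

definition tamp_set :: "(real \<Rightarrow> real) \<Rightarrow> real \<Rightarrow> real set" where
  "tamp_set \<phi> \<nu> =
     (if emeasure lebesgue (superlevel \<phi> \<nu>) = 0 then {}
      else if emeasure lebesgue (superlevel \<phi> \<nu>) = \<infinity> then {tamp_y \<phi> \<nu>..}
      else {tamp_y \<phi> \<nu> .. tamp_y \<phi> \<nu> + measure lebesgue (superlevel \<phi> \<nu>)})"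

text \<open>In \<open>ennreal\<close> the supremum of the empty set is 0 and unbounded suprema are \<open>\<infinity>\<close>.\<close>

definition tamping :: "(real \<Rightarrow> real) \<Rightarrow> real \<Rightarrow> ennreal" where
  "tamping \<phi> x = (SUP \<nu>\<in>{\<nu>. 0 < \<nu> \<and> x \<in> tamp_set \<phi> \<nu>}. ennreal \<nu>)"

end

theory Submission
  imports Defs
begin

text \<open>
  Replace \<open>\<phi>\<close> by its continuous version \<open>u\<close> and \<open>\<nabla>\<phi>\<close> by a Borel function \<open>g\<close>. Up to null sets the hollows are
  the open set \<open>H\<close> of points with strictly higher values of \<open>u\<close> on both sides. The endpoints of each
  component of \<open>H\<close> carry the same value of \<open>u\<close>, so \<open>g\<close> has integral 0 over it and filling the hollows
  gives the primitive \<open>W\<close> of \<open>g\<close> restricted to the complement of \<open>H\<close>. The tamping is \<open>W \<circ> \<xi>\<close>, where \<open>\<xi>\<close> is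
  the generalized inverse of \<open>\<rho>\<close>, and \<open>\<rho> x\<close> is the measure of \<open>[0, x] - H\<close> plus that of the part of \<open>H\<close>
  on which \<open>u\<close> is at least its supremum over \<open>[x, \<infinity>)\<close>. As \<open>\<rho>\<close> grows at least as fast as
  \<open>T x = |[0, x] - H|\<close>, the function \<open>T \<circ> \<xi>\<close> is nondecreasing and 1-Lipschitz, hence has a density \<open>s\<close>
  with values in \<open>[0, 1]\<close>, and \<open>\<xi>\<close> transports \<open>s dy\<close> to the Lebesgue measure outside \<open>H\<close>. So the tamping has the
  weak derivative \<open>h = s (g \<circ> \<xi>)\<close>, and \<open>|h|\<^sup>p \<le> s |g \<circ> \<xi>|\<^sup>p\<close> gives the inequality.
\<close>

section \<open>Weak derivatives on the half-line\<close>


text \<open>The obstacle is that \<open>\<xi>\<close> has no chain rule: it jumps across hollows,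
  and it is constant where hollow mass at a single level widens the tamping. Both \<open>W\<close>
  and \<open>T\<close> see only what lies outside \<open>H\<close>, so \<open>W x\<close> depends on
  \<open>T x\<close> alone, and \<open>T \<circ> \<xi>\<close> is continuous although
  \<open>\<xi>\<close> need not be. Differentiation is therefore replaced by an identity of image
  measures, tested on half-lines. The form of \<open>\<rho>\<close> comes from the right end of a
  tamped level. Let \<open>a\<close> be the essential left end and \<open>b\<close> the last point
  of the superlevel set at \<open>\<nu>\<close>. Up to a null set this set consists of
  \<open>[a, b] - H\<close> and of the part of \<open>H\<close> with values at least
  \<open>\<nu>\<close>. Hence \<open>T a\<close> plus its measure is the measure of
  \<open>[0, b] - H\<close> plus that of the second part, and \<open>\<nu>\<close> is the supremum
  of \<open>u\<close> over \<open>[b, \<infinity>)\<close>. Left of \<open>a\<close> the second part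
  of \<open>\<rho>\<close> is empty, so that the same function also yields the left end
  \<open>T a\<close>.\<close>

definition smooth :: "(real \<Rightarrow> real) \<Rightarrow> bool" where
  "smooth f \<longleftrightarrow> (\<forall>n. ((deriv ^^ n) f) differentiable_on UNIV)"

text \<open>A coinduction principle: a class that contains a derivative of each of its members
  consists of smooth functions. Each closure property below then needs a suitable class and a single
  differentiation, never a formula for higher derivatives.\<close>

lemma smoothI:
  assumes "f \<in> S" and step: "\<And>f. f \<in> S \<Longrightarrow> \<exists>f'\<in>S. \<forall>x. (f has_real_derivative f' x) (at x)"
  shows "smooth f"
proof -
  have d: "deriv f \<in> S \<and> f differentiable_on UNIV" if "f \<in> S" for f
  proof -
    obtain f' where f': "f' \<in> S" "\<And>x. (f has_real_derivative f' x) (at x)"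
      using step[OF \<open>f \<in> S\<close>] by blast
    then have "deriv f = f'" by (intro ext DERIV_imp_deriv)
    then show ?thesis using f'
      by (auto simp: differentiable_on_def real_differentiable_def intro!: differentiable_at_withinI)
  qed
  have "(deriv ^^ n) f \<in> S" for n
    by (induction n) (use d \<open>f \<in> S\<close> in auto)
  then show ?thesis using d by (auto simp: smooth_def)
qed

lemma smooth_has_deriv: "smooth f \<Longrightarrow> (f has_real_derivative deriv f x) (at x)"
  unfolding smooth_def
  by (metis DERIV_deriv_iff_real_differentiable differentiable_on_def UNIV_I funpow_0)

lemma smooth_deriv: "smooth f \<Longrightarrow> smooth (deriv f)"
  unfolding smooth_def by (metis funpow_simps_right(2) comp_apply)

lemma smooth_primitive:
  assumes "smooth f" "\<And>x. (F has_real_derivative f x) (at x)"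
  shows "smooth F"
proof (rule smoothI[of _ "insert F (Collect smooth)"])
  fix h assume "h \<in> insert F (Collect smooth)"
  then show "\<exists>h'\<in>insert F (Collect smooth). \<forall>x. (h has_real_derivative h' x) (at x)"
    using assms smooth_has_deriv smooth_deriv by (elim insertE) blast+
qed simp

lemma smooth_affine:
  assumes "smooth f"
  shows "smooth (\<lambda>x. c * f (a * x + b))"
proof (rule smoothI[of _ "{(\<lambda>x. c * f (a * x + b)) |c f. smooth f}"])
  fix h assume "h \<in> {(\<lambda>x. c * f (a * x + b)) |c f. smooth f}"
  then obtain c f where h: "h = (\<lambda>x. c * f (a * x + b))" "smooth f" by blast
  have "(h has_real_derivative (c * a) * deriv f (a * x + b)) (at x)" for x
    unfolding h(1) by (auto intro!: derivative_eq_intros DERIV_chain2[OF smooth_has_deriv[OF h(2)]])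
  then show "\<exists>f'\<in>{(\<lambda>x. c * f (a * x + b)) |c f. smooth f}. \<forall>x. (h has_real_derivative f' x) (at x)"
    using smooth_deriv[OF h(2)]
    by (intro bexI[of _ "\<lambda>x. (c * a) * deriv f (a * x + b)"]) auto
qed (use assms in blast)

lemma smooth_add:
  assumes "smooth f" "smooth g"
  shows "smooth (\<lambda>x. f x + g x)"
proof (rule smoothI[of _ "{(\<lambda>x. f x + g x) |f g. smooth f \<and> smooth g}"])
  fix h assume "h \<in> {(\<lambda>x. f x + g x) |f g. smooth f \<and> smooth g}"
  then obtain f g where h: "h = (\<lambda>x. f x + g x)" "smooth f" "smooth g" by blast
  then show "\<exists>f'\<in>{(\<lambda>x. f x + g x) |f g. smooth f \<and> smooth g}. \<forall>x. (h has_real_derivative f' x) (at x)"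
    by (intro bexI[of _ "\<lambda>x. deriv f x + deriv g x"])
       (auto intro!: DERIV_add smooth_has_deriv intro: smooth_deriv)
qed (use assms in blast)

text \<open>The Leibniz rule leads from products to sums of products, so the class must also be
  closed under addition to be stable under differentiation.\<close>

inductive_set product_sums :: "(real \<Rightarrow> real) set" where
  prod: "smooth f \<Longrightarrow> smooth g \<Longrightarrow> (\<lambda>x. f x * g x) \<in> product_sums"
| add: "f \<in> product_sums \<Longrightarrow> g \<in> product_sums \<Longrightarrow> (\<lambda>x. f x + g x) \<in> product_sums"

lemma smooth_mult:
  assumes "smooth f" "smooth g"
  shows "smooth (\<lambda>x. f x * g x)"
proof (rule smoothI[of _ product_sums])
  fix h assume "h \<in> product_sums"
  then show "\<exists>f'\<in>product_sums. \<forall>x. (h has_real_derivative f' x) (at x)"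
  proof induction
    case (prod f g)
    have "((\<lambda>x. f x * g x) has_real_derivative (deriv f x * g x + deriv g x * f x)) (at x)" for x
      by (intro DERIV_mult smooth_has_deriv prod)
    moreover have "(\<lambda>x. deriv f x * g x + deriv g x * f x) \<in> product_sums"
      by (intro product_sums.intros smooth_deriv prod)
    ultimately show ?case by (intro bexI allI)
  next
    case (add f g)
    then obtain f' g' where "f' \<in> product_sums" "g' \<in> product_sums"
      "\<And>x. (f has_real_derivative f' x) (at x)" "\<And>x. (g has_real_derivative g' x) (at x)" by blast
    then show ?case
      by (intro bexI[of _ "\<lambda>x. f' x + g' x"]) (auto intro!: DERIV_add product_sums.add)
  qed
qed (use assms in \<open>auto intro: product_sums.prod\<close>)

text \<open>Closed under differentiation, because the derivative of \<open>P (1/x) exp (-1/x)\<close> is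
  \<open>Q (1/x) exp (-1/x)\<close> with \<open>Q t = t\<^sup>2 (P t - P' t)\<close>.\<close>

definition flat_exp :: "real poly \<Rightarrow> real \<Rightarrow> real" where
  "flat_exp P x = (if x > 0 then poly P (1 / x) * exp (- (1 / x)) else 0)"

lemma poly_times_exp_tendsto_0: "((\<lambda>t::real. poly P t * exp (- t)) \<longlongrightarrow> 0) at_top"
proof -
  have "((\<lambda>t. (\<Sum>i\<le>degree P. coeff P i * (t ^ i / exp t))) \<longlongrightarrow> (\<Sum>i\<le>degree P. coeff P i * 0)) at_top"
    by (intro tendsto_intros tendsto_power_div_exp_0)
  then show ?thesis
    by (simp add: poly_altdef sum_distrib_right exp_minus divide_inverse mult.assoc)
qed

lemma flat_exp_has_deriv:
  "(flat_exp P has_real_derivative flat_exp ([:0,0,1:] * (P - pderiv P)) x) (at x)"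
proof -
  consider "x > 0" | "x < 0" | "x = 0" by linarith
  then show ?thesis
  proof cases
    case 1
    have "((\<lambda>x. poly P (1 / x) * exp (- (1 / x))) has_real_derivative
        flat_exp ([:0,0,1:] * (P - pderiv P)) x) (at x)"
      using 1 by (auto intro!: derivative_eq_intros DERIV_chain2[OF poly_DERIV]
         simp: flat_exp_def field_simps power2_eq_square)
    then show ?thesis
      by (rule has_field_derivative_transform_within_open[of _ _ _ "{0<..}"])
         (use 1 in \<open>auto simp: flat_exp_def\<close>)
  next
    case 2
    have "((\<lambda>x. 0) has_real_derivative flat_exp ([:0,0,1:] * (P - pderiv P)) x) (at x)"
      using 2 by (simp add: flat_exp_def)
    then show ?thesis
      by (rule has_field_derivative_transform_within_open[of _ _ _ "{..<0}"])
         (use 2 in \<open>auto simp: flat_exp_def\<close>)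
  next
    case 3
    \<comment> \<open>With \<open>t = 1 / h\<close> the right difference quotient at 0 is
      \<open>t * poly P t * exp (- t)\<close>; \<open>pCons 0 P\<close> supplies the factor
      \<open>t\<close>.\<close>
    have "((\<lambda>h. poly (pCons 0 P) (1 / h) * exp (- (1 / h))) \<longlongrightarrow> 0) (at_right (0::real))"
      using filterlim_compose[OF poly_times_exp_tendsto_0 filterlim_inverse_at_top_right, of "pCons 0 P"]
      by (simp add: field_simps)
    then have r: "((\<lambda>h. flat_exp P h / h) \<longlongrightarrow> 0) (at_right 0)"
      by (rule Lim_transform_eventually)
         (auto simp: flat_exp_def eventually_at_right_field field_simps intro!: exI[of _ 1])
    have l: "((\<lambda>h. flat_exp P h / h) \<longlongrightarrow> 0) (at_left 0)"
      by (rule Lim_transform_eventually[OF tendsto_const])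
         (auto simp: flat_exp_def eventually_at_left_field intro!: exI[of _ "-1"])
    have "((\<lambda>h. (flat_exp P (0 + h) - flat_exp P 0) / h) \<longlongrightarrow> 0) (at 0)"
      using filterlim_split_at_real[OF l r] by (simp add: flat_exp_def)
    then show ?thesis using 3 by (simp add: DERIV_def flat_exp_def)
  qed
qed

lemma smooth_flat_exp: "smooth (flat_exp P)"
  by (rule smoothI[of _ "range flat_exp"]) (use flat_exp_has_deriv in blast)+

section \<open>Test functions supported in a given interval\<close>

definition bump :: "real \<Rightarrow> real \<Rightarrow> nat \<Rightarrow> real \<Rightarrow> real" where
  "bump a b n x = flat_exp 1 (real n * (x - a)) * flat_exp 1 (real n * (b - x))"

lemma smooth_bump: "smooth (bump a b n)"
proof -
  have "smooth (\<lambda>x. (1 * flat_exp 1 (real n * x + - real n * a)) * (1 * flat_exp 1 (- real n * x + real n * b)))"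
    by (intro smooth_mult smooth_affine smooth_flat_exp)
  moreover have "bump a b n = (\<lambda>x. (1 * flat_exp 1 (real n * x + - real n * a)) * (1 * flat_exp 1 (- real n * x + real n * b)))"
    by (simp add: bump_def algebra_simps fun_eq_iff)
  ultimately show ?thesis by simp
qed

lemma bump_bounds: "0 \<le> bump a b n x" "bump a b n x \<le> indicator {a<..<b} x"
  by (auto simp: bump_def flat_exp_def indicator_def zero_less_mult_iff mult_le_one)

lemma bump_eq_0: "x \<notin> {a<..<b} \<Longrightarrow> bump a b n x = 0"
  using bump_bounds[of a b n x] by (auto simp: indicator_def split: if_splits)

lemma bump_pos: "n > 0 \<Longrightarrow> x \<in> {a<..<b} \<Longrightarrow> bump a b n x > 0"
  by (auto simp: bump_def flat_exp_def zero_less_mult_iff)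

text \<open>Stretching the argument by \<open>n\<close> steepens both flanks and keeps the support,
  so indicators of open intervals are bounded limits of test functions.\<close>

lemma bump_tendsto: "(\<lambda>n. bump a b n x) \<longlonglongrightarrow> indicator {a<..<b} x"
proof (cases "x \<in> {a<..<b}")
  case True
  have *: "(\<lambda>n. exp (- (1 / (real n * c)))) \<longlonglongrightarrow> 1" if "c > 0" for c :: real
  proof -
    have "(\<lambda>n. (1 / c) * (1 / real n)) \<longlonglongrightarrow> (1/c) * 0"
      by (intro tendsto_mult tendsto_const lim_1_over_n)
    then have "(\<lambda>n. - (1 / (real n * c))) \<longlonglongrightarrow> - 0"
      by (intro tendsto_minus) (simp add: field_simps)
    from tendsto_exp[OF this] show ?thesis by simp
  qed
  have "(\<lambda>n. exp (- (1 / (real n * (x - a)))) * exp (- (1 / (real n * (b - x))))) \<longlonglongrightarrow> 1 * 1"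
    using True by (intro tendsto_mult *) auto
  moreover have "\<forall>\<^sub>F n in sequentially. exp (- (1 / (real n * (x - a)))) * exp (- (1 / (real n * (b - x)))) = bump a b n x"
    using eventually_gt_at_top[of 0] by eventually_elim (use True in \<open>auto simp: bump_def flat_exp_def\<close>)
  ultimately show ?thesis using True by (auto intro: Lim_transform_eventually)
next
  case False
  then show ?thesis by (simp add: bump_eq_0)
qed

lemma test_functionI:
  assumes "smooth f" "0 < a" "\<And>x. x \<notin> {a..b} \<Longrightarrow> f x = 0"
  shows "test_function f"
proof -
  have "closure {x. f x \<noteq> 0} \<subseteq> {a..b}"
    by (rule closure_minimal) (use assms(3) in blast, simp)
  moreover from this have "compact (closure {x. f x \<noteq> 0})"
    by (meson bounded_closed_interval bounded_subset closed_closure compact_eq_bounded_closed)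
  ultimately show ?thesis
    using assms(1,2) by (auto simp: test_function_def smooth_def)
qed

lemma test_function_bump: "0 < a \<Longrightarrow> test_function (bump a b n)"
  by (rule test_functionI[of _ a b]) (auto simp: smooth_bump bump_eq_0)

lemma test_functionE:
  assumes "test_function f"
  obtains a b where "0 < a" "a < b" "\<And>x. x \<notin> {a..b} \<Longrightarrow> f x = 0" "smooth f"
proof -
  let ?K = "closure {x. f x \<noteq> 0}"
  have K: "compact ?K" "?K \<subseteq> {0<..}" and s: "smooth f"
    using assms by (auto simp: test_function_def smooth_def)
  show ?thesis
  proof (cases "?K = {}")
    case True
    then have "f x = 0" for x using closure_subset[of "{x. f x \<noteq> 0}"] by auto
    then show ?thesis using that[of 1 2] s by auto
  next
    case False
    obtain a where a: "a \<in> ?K" "\<And>x. x \<in> ?K \<Longrightarrow> a \<le> x" using compact_attains_inf[OF K(1) False] by blast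
    obtain b where b: "b \<in> ?K" "\<And>x. x \<in> ?K \<Longrightarrow> x \<le> b" using compact_attains_sup[OF K(1) False] by blast
    \<comment> \<open>The added 1 makes the interval nondegenerate, whatever the support.\<close>
    have f0: "f x = 0" if "x \<notin> {a..b + 1}" for x
    proof (rule ccontr)
      assume "f x \<noteq> 0"
      then have "x \<in> ?K" using closure_subset[of "{x. f x \<noteq> 0}"] by blast
      then show False using that a(2) b(2) by fastforce
    qed
    have "0 < a" "a < b + 1" using a b(2)[OF a(1)] K(2) by auto
    then show ?thesis using that[of a "b + 1"] s f0 by blast
  qed
qed


section \<open>The fundamental lemma of the calculus of variations\<close>

lemma LINT_half_line:
  fixes f :: "real \<Rightarrow> real"
  shows "(LINT x|lebesgue_on \<real>\<^sub>+. f x) = (LINT x|lebesgue. indicator \<real>\<^sub>+ x * f x)"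
  by (simp add: integral_restrict_space)

lemma integrable_half_line:
  fixes f :: "real \<Rightarrow> real"
  shows "integrable (lebesgue_on \<real>\<^sub>+) f \<longleftrightarrow> integrable lebesgue (\<lambda>x. indicator \<real>\<^sub>+ x * f x)"
  by (simp add: integrable_restrict_space)

text \<open>Borel representatives are wanted because a Lebesgue measurable function composed with a
  Borel one need not be measurable, and because Fubini's theorem and image measures are applied to
  \<open>lborel\<close>.\<close>

lemma lborel_representative:
  fixes f :: "real \<Rightarrow> real"
  assumes "f \<in> borel_measurable lebesgue"
  obtains f' where "f' \<in> borel_measurable borel" "AE x in lebesgue. f x = f' x" "AE x in lborel. f x = f' x"
proof -
  obtain f' where f': "f' \<in> borel_measurable lborel" "AE x in lborel. f x = f' x"
    using completion_ex_borel_measurable_real[OF assms] by blast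
  show ?thesis using that[of f'] f' AE_completion[OF f'(2)] by simp
qed

lemma borel_imp_lebesgue: "f \<in> borel_measurable borel \<Longrightarrow> f \<in> borel_measurable lebesgue"
  by (rule measurable_completion) simp

lemma integrable_lborel_representative:
  fixes f :: "real \<Rightarrow> real"
  assumes "integrable lebesgue f"
  obtains F where "F \<in> borel_measurable borel" "integrable lborel F"
    "AE x in lebesgue. f x = F x" "AE x in lborel. f x = F x"
proof -
  obtain F where F: "F \<in> borel_measurable borel" "AE x in lebesgue. f x = F x" "AE x in lborel. f x = F x"
    using lborel_representative[OF borel_measurable_integrable[OF assms]] .
  have "integrable lebesgue F"
    by (rule integrable_cong_AE_imp[OF assms borel_imp_lebesgue[OF F(1)] F(2)])
  then have "integrable lborel F" using F(1) by (simp add: integrable_completion)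
  then show ?thesis using that F by blast
qed

text \<open>The positive part \<open>ennreal (F x)\<close> and the negative part
  \<open>ennreal (- F x)\<close> are densities of two finite measures that agree on all half-lines,
  hence everywhere. So the two parts coincide almost everywhere, and as one of them is always 0,
  both are.\<close>

lemma AE_eq_0_if_tail_integrals_0:
  fixes F :: "real \<Rightarrow> real"
  assumes int: "integrable lborel F" and tail: "\<And>x. (LINT t|lborel. indicator {x<..} t * F t) = 0"
  shows "AE x in lborel. F x = 0"
proof -
  have [measurable]: "F \<in> borel_measurable borel" using int by auto
  have fin: "(\<integral>\<^sup>+ t. ennreal (s * F t) * indicator A t \<partial>lborel) < \<infinity>"
    if "s \<in> {1, -1}" "A \<in> sets borel" for s A
  proof -
    have "(\<integral>\<^sup>+ t. ennreal (s * F t) * indicator A t \<partial>lborel) \<le> (\<integral>\<^sup>+ t. ennreal (norm (F t)) \<partial>lborel)"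
      using that by (intro nn_integral_mono) (auto simp: indicator_def intro!: ennreal_leI)
    also have "\<dots> < \<infinity>" using int by (simp add: integrable_iff_bounded)
    finally show ?thesis .
  qed
  have "density lborel (\<lambda>x. ennreal (F x)) = density lborel (\<lambda>x. ennreal (- F x))"
  proof (rule measure_eqI_lessThan)
    fix x :: real
    have int_x: "integrable lborel (\<lambda>t. indicator {x<..} t * F t)"
      using integrable_mult_indicator[OF _ int, of "{x<..}"] by simp
    have pm: "(\<integral>\<^sup>+ t. ennreal (s * (indicator {x<..} t * F t)) \<partial>lborel)
        = (\<integral>\<^sup>+ t. ennreal (s * F t) * indicator {x<..} t \<partial>lborel)" for s
      by (intro nn_integral_cong) (auto simp: indicator_def)
    have "enn2real (\<integral>\<^sup>+ t. ennreal (1 * F t) * indicator {x<..} t \<partial>lborel)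
        = enn2real (\<integral>\<^sup>+ t. ennreal (-1 * F t) * indicator {x<..} t \<partial>lborel)"
      using real_lebesgue_integral_def[OF int_x] tail[of x] unfolding pm[symmetric] by simp
    then have "(\<integral>\<^sup>+ t. ennreal (1 * F t) * indicator {x<..} t \<partial>lborel)
        = (\<integral>\<^sup>+ t. ennreal (-1 * F t) * indicator {x<..} t \<partial>lborel)"
      using fin[of 1 "{x<..}"] fin[of "-1" "{x<..}"]
      by (subst (1 2) ennreal_enn2real[symmetric]) (simp_all only: insert_iff greaterThan_borel infinity_ennreal_def simp_thms)
    then show "emeasure (density lborel (\<lambda>x. ennreal (F x))) {x<..} =
         emeasure (density lborel (\<lambda>x. ennreal (- F x))) {x<..}"
      by (simp add: emeasure_density)
    show "emeasure (density lborel (\<lambda>x. ennreal (F x))) {x<..} < \<infinity>"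
      using fin[of 1 "{x<..}"] by (simp add: emeasure_density)
  qed auto
  then have "AE x in lborel. ennreal (F x) = ennreal (- F x)"
    using fin[of 1 UNIV] by (subst (asm) finite_density_unique) auto
  then show ?thesis
  proof eventually_elim
    case (elim x)
    show ?case
    proof (cases "0 \<le> F x")
      case True
      then have "ennreal (F x) = 0" using elim by (simp add: ennreal_neg)
      then show ?thesis using True by simp
    next
      case False
      then have "ennreal (- F x) = 0" using elim by (simp add: ennreal_neg)
      then show ?thesis using False by simp
    qed
  qed
qed

lemma locally_integrable_Icc:
  assumes "locally_integrable f" "0 < a"
  shows "integrable lebesgue (\<lambda>x. indicator {a..b} x * f x)"
proof -
  have "{a..b} \<subseteq> {0<..}" using assms(2) by auto
  then have "integrable (lebesgue_on {a..b}) f"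
    using assms(1) by (auto simp: locally_integrable_def)
  then show ?thesis by (simp add: integrable_restrict_space)
qed

lemma LINT_half_line_supported:
  fixes f \<eta> :: "real \<Rightarrow> real"
  assumes "0 < a" "\<And>x. x \<notin> {a..b} \<Longrightarrow> \<eta> x = 0"
  shows "(LINT x|lebesgue_on \<real>\<^sub>+. f x * \<eta> x) = (LINT x|lebesgue. (indicator {a..b} x * f x) * \<eta> x)"
  unfolding LINT_half_line using assms
  by (intro Bochner_Integration.integral_cong) (auto simp: indicator_def)

text \<open>On \<open>[a, b]\<close> with \<open>0 < a\<close>, bump functions tend boundedly to
  indicators of subintervals, so by dominated convergence all tail integrals of the restricted
  function vanish.\<close>

theorem fundamental_lemma:
  assumes loc: "locally_integrable f"
    and zero: "\<And>\<eta>. test_function \<eta> \<Longrightarrow> (LINT x|lebesgue_on \<real>\<^sub>+. f x * \<eta> x) = 0"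
  shows "AE x in lebesgue. 0 < x \<longrightarrow> f x = 0"
proof -
  have ae: "AE x in lebesgue. indicator {a..b} x * f x = 0" if "0 < a" for a b
  proof -
    have int: "integrable lebesgue (\<lambda>x. indicator {a..b} x * f x)"
      using locally_integrable_Icc[OF loc that] .
    obtain F where F [measurable]: "F \<in> borel_measurable borel" and int_F: "integrable lborel F"
      and eq: "AE x in lebesgue. indicator {a..b} x * f x = F x"
      and eq': "AE x in lborel. indicator {a..b} x * f x = F x"
      using integrable_lborel_representative[OF int] .
    have "AE x in lborel. F x = 0"
    proof (rule AE_eq_0_if_tail_integrals_0[OF int_F])
      fix x :: real
      \<comment> \<open>The maximum keeps the support of the bump away from 0, also when the tail
        begins before \<open>a\<close>.\<close>
      let ?c = "max a x"
      have bm [measurable]: "bump ?c b n \<in> borel_measurable borel" for n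
        using smooth_has_deriv[OF smooth_bump, of ?c b n]
        by (intro borel_measurable_continuous_onI continuous_at_imp_continuous_on ballI DERIV_isCont) blast
      have "(LINT t|lborel. bump ?c b n t * F t) = 0" for n
      proof -
        have "(LINT t|lborel. bump ?c b n t * F t) = (LINT t|lebesgue. bump ?c b n t * F t)"
          by (intro integral_completion[symmetric]) simp
        also have "\<dots> = (LINT t|lebesgue. (indicator {a..b} t * f t) * bump ?c b n t)"
        proof (rule integral_cong_AE)
          show "(\<lambda>t. bump ?c b n t * F t) \<in> borel_measurable lebesgue"
            by (rule borel_imp_lebesgue) simp
          show "(\<lambda>t. (indicator {a..b} t * f t) * bump ?c b n t) \<in> borel_measurable lebesgue"
            by (intro borel_measurable_times[OF borel_measurable_integrable[OF int]] borel_imp_lebesgue bm)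
          show "AE t in lebesgue. bump ?c b n t * F t = (indicator {a..b} t * f t) * bump ?c b n t"
            using eq by eventually_elim simp
        qed
        also have "\<dots> = (LINT x|lebesgue_on \<real>\<^sub>+. f x * bump ?c b n x)"
          using that by (intro LINT_half_line_supported[symmetric]) (auto intro!: bump_eq_0)
        also have "\<dots> = 0" using that by (intro zero test_function_bump) auto
        finally show ?thesis .
      qed
      moreover have "(\<lambda>n. LINT t|lborel. bump ?c b n t * F t) \<longlonglongrightarrow> (LINT t|lborel. indicator {?c<..<b} t * F t)"
      proof (rule integral_dominated_convergence[of _ _ _ "\<lambda>t. norm (F t)"])
        show "AE t in lborel. norm (bump ?c b n t * F t) \<le> norm (F t)" for n
        proof (intro AE_I2)
          fix t
          have "\<bar>bump ?c b n t\<bar> \<le> 1"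
            using bump_bounds(1)[of ?c b n t] order_trans[OF bump_bounds(2)[of ?c b n t] indicator_le_1] by simp
          then show "norm (bump ?c b n t * F t) \<le> norm (F t)"
            by (simp add: abs_mult mult_left_le_one_le)
        qed
      qed (use int_F in \<open>auto intro!: tendsto_intros bump_tendsto\<close>)
      ultimately have "(LINT t|lborel. indicator {?c<..<b} t * F t) = 0"
        by (simp add: LIMSEQ_const_iff)
      moreover have "(LINT t|lborel. indicator {x<..} t * F t) = (LINT t|lborel. indicator {?c<..<b} t * F t)"
      proof (rule integral_cong_AE)
        have "AE t in lborel. t \<noteq> a" "AE t in lborel. t \<noteq> b"
          by (rule AE_lborel_singleton)+
        with eq' show "AE t in lborel. indicator {x<..} t * F t = indicator {?c<..<b} t * F t"
          by eventually_elim (auto simp: indicator_def split: if_splits)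
      qed auto
      ultimately show "(LINT t|lborel. indicator {x<..} t * F t) = 0" by simp
    qed
    then have "AE x in lebesgue. F x = 0" by (rule AE_completion)
    with eq show ?thesis by eventually_elim simp
  qed
  \<comment> \<open>The intervals \<open>[1 / (n + 1), n + 1]\<close> exhaust the open half-line at
    the cost of countably many null sets.\<close>
  have "AE x in lebesgue. \<forall>n::nat. indicator {1 / Suc n..Suc n} x * f x = 0"
    unfolding AE_all_countable by (intro allI ae) simp
  then show ?thesis
  proof eventually_elim
    case (elim x)
    show ?case
    proof
      assume "0 < x"
      obtain m where m: "1 / Suc m < x" using nat_approx_posE[OF \<open>0 < x\<close>] by blast
      obtain k where k: "x < of_nat k" using reals_Archimedean2 by blast
      have "1 / Suc (max m k) \<le> 1 / Suc m" by (simp add: frac_le)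
      then have "x \<in> {1 / Suc (max m k)..Suc (max m k)}" using m k by auto
      then show "f x = 0" using elim[rule_format, of "max m k"] by (simp add: indicator_def)
    qed
  qed
qed

lemma locally_integrable_diff:
  "locally_integrable f \<Longrightarrow> locally_integrable g \<Longrightarrow> locally_integrable (\<lambda>x. f x - g x)"
  unfolding locally_integrable_def by (blast intro: Bochner_Integration.integrable_diff)

lemma test_function_borel: "test_function \<eta> \<Longrightarrow> \<eta> \<in> borel_measurable borel"
  by (metis test_functionE smooth_has_deriv DERIV_isCont borel_measurable_continuous_onI
      continuous_at_imp_continuous_on)

lemma test_function_bounded:
  assumes "test_function \<eta>"
  obtains C where "\<And>x. \<bar>\<eta> x\<bar> \<le> C"
proof -
  obtain a b where ab: "a < b" "\<And>x. x \<notin> {a..b} \<Longrightarrow> \<eta> x = 0" "smooth \<eta>"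
    using test_functionE[OF assms] by metis
  have "continuous_on {a..b} \<eta>"
    using smooth_has_deriv[OF ab(3)] by (intro continuous_at_imp_continuous_on ballI DERIV_isCont) blast
  then have "bounded (\<eta> ` {a..b})" by (intro compact_imp_bounded compact_continuous_image) auto
  then obtain C where "\<And>x. x \<in> {a..b} \<Longrightarrow> \<bar>\<eta> x\<bar> \<le> C" unfolding bounded_iff by force
  then have "\<bar>\<eta> x\<bar> \<le> max C 0" for x using ab(2)[of x] by (cases "x \<in> {a..b}") (auto simp: le_max_iff_disj)
  then show ?thesis using that by blast
qed

lemma integrable_times_test_function:
  assumes "locally_integrable f" "test_function \<eta>"
  shows "integrable (lebesgue_on \<real>\<^sub>+) (\<lambda>x. f x * \<eta> x)"
proof -
  obtain a b where ab: "0 < a" "\<And>x. x \<notin> {a..b} \<Longrightarrow> \<eta> x = 0" using test_functionE[OF assms(2)] by metis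
  obtain C where C: "\<And>x. \<bar>\<eta> x\<bar> \<le> C" using test_function_bounded[OF assms(2)] by blast
  have int: "integrable lebesgue (\<lambda>x. indicator {a..b} x * f x)" using locally_integrable_Icc[OF assms(1) ab(1)] .
  have "integrable lebesgue (\<lambda>x. (indicator {a..b} x * f x) * \<eta> x)"
  proof (rule Bochner_Integration.integrable_bound)
    show "integrable lebesgue (\<lambda>x. C * (indicator {a..b} x * f x))" using int by simp
    show "(\<lambda>x. (indicator {a..b} x * f x) * \<eta> x) \<in> borel_measurable lebesgue"
      using test_function_borel[OF assms(2)]
      by (intro borel_measurable_times[OF borel_measurable_integrable[OF int]] measurable_completion) simp
    have "0 \<le> C" using C[of 0] by linarith
    show "AE x in lebesgue. norm ((indicator {a..b} x * f x) * \<eta> x) \<le> norm (C * (indicator {a..b} x * f x))"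
      using C \<open>0 \<le> C\<close> by (auto simp: abs_mult mult.commute intro!: mult_right_mono)
  qed
  also have "(\<lambda>x. (indicator {a..b} x * f x) * \<eta> x) = (\<lambda>x. indicator \<real>\<^sub>+ x * (f x * \<eta> x))"
    using ab by (force simp: indicator_def)
  finally show ?thesis by (simp add: integrable_half_line)
qed

text \<open>Carries the integrability of the weak derivative provided by \<open>in_W1p\<close> over
  to an arbitrary one.\<close>

lemma weak_derivative_unique:
  assumes "has_weak_derivative u g" "has_weak_derivative u h"
  shows "AE x in lebesgue. 0 < x \<longrightarrow> g x = h x"
proof -
  have l: "locally_integrable g" "locally_integrable h" using assms by (auto simp: has_weak_derivative_def)
  have "AE x in lebesgue. 0 < x \<longrightarrow> g x - h x = 0"
  proof (rule fundamental_lemma[OF locally_integrable_diff[OF l]])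
    fix \<eta> assume t: "test_function \<eta>"
    have "(LINT x|lebesgue_on \<real>\<^sub>+. g x * \<eta> x) = (LINT x|lebesgue_on \<real>\<^sub>+. h x * \<eta> x)"
      using assms t by (auto simp: has_weak_derivative_def)
    then show "(LINT x|lebesgue_on \<real>\<^sub>+. (g x - h x) * \<eta> x) = 0"
      using integrable_times_test_function[OF l(1) t] integrable_times_test_function[OF l(2) t]
      by (simp add: left_diff_distrib)
  qed
  then show ?thesis by simp
qed


section \<open>Primitives and integration by parts\<close>

lemma continuous_on_half_lineI:
  fixes F :: "real \<Rightarrow> real"
  assumes "\<And>b. continuous_on {0..b} F"
  shows "continuous_on {0..} F"
  unfolding continuous_on_iff
proof (intro ballI allI impI)
  fix x e :: real assume "x \<in> {0..}" "0 < e"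
  then obtain d where d: "d > 0" "\<And>y. y \<in> {0..x + 1} \<Longrightarrow> dist y x < d \<Longrightarrow> dist (F y) (F x) < e"
    using assms[of "x + 1"] by (fastforce simp: continuous_on_iff)
  show "\<exists>d>0. \<forall>x'\<in>{0..}. dist x' x < d \<longrightarrow> dist (F x') (F x) < e"
    using d by (intro exI[of _ "min d 1"]) (auto simp: dist_real_def)
qed

lemma continuous_on_primitive:
  fixes f :: "real \<Rightarrow> real"
  assumes "\<And>b. set_integrable lborel {0..b} f"
  shows "continuous_on {0..} (\<lambda>x. LINT t:{0..x}|lborel. f t)"
proof (rule continuous_on_half_lineI)
  fix b :: real
  have "continuous_on {0..b} (\<lambda>x. integral {0..x} f)"
    using set_borel_integral_eq_integral(1)[OF assms] by (rule indefinite_integral_continuous_1)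
  then show "continuous_on {0..b} (\<lambda>x. LINT t:{0..x}|lborel. f t)"
    by (simp add: set_borel_integral_eq_integral(2)[OF assms])
qed

lemma primitive_diff:
  fixes f :: "real \<Rightarrow> real"
  assumes "\<And>b. set_integrable lborel {0..b} f" "0 \<le> x" "x \<le> y"
  shows "(LINT t:{0..y}|lborel. f t) = (LINT t:{0..x}|lborel. f t) + (LINT t:{x<..y}|lborel. f t)"
proof -
  have "{0..y} = {0..x} \<union> {x<..y}" using assms(2,3) by auto
  moreover have "set_integrable lborel {x<..y} f"
    by (rule set_integrable_subset[OF assms(1)[of y]]) (use assms(2) in auto)
  moreover have "{0..x} \<inter> {x<..y} = {}" by auto
  ultimately show ?thesis using set_integral_Un[of "{0..x}" "{x<..y}" lborel f] assms(1) by simp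
qed

lemma test_function_deriv:
  assumes "test_function \<eta>"
  shows "test_function (deriv \<eta>)"
proof -
  obtain a b where ab: "0 < a" "a < b" "\<And>x. x \<notin> {a..b} \<Longrightarrow> \<eta> x = 0" "smooth \<eta>"
    using test_functionE[OF assms] by metis
  have "deriv \<eta> x = 0" if "x \<notin> {a..b}" for x
  proof -
    have "((\<lambda>x. 0) has_real_derivative 0) (at x)" by simp
    then have "(\<eta> has_real_derivative 0) (at x)"
      by (rule has_field_derivative_transform_within_open[of _ _ _ "- {a..b}"])
         (use that ab(3) in auto)
    then show ?thesis by (rule DERIV_imp_deriv)
  qed
  then show ?thesis using ab by (intro test_functionI[of _ a b] smooth_deriv) auto
qed

lemma integral_deriv_test_function:
  assumes "test_function \<eta>" "x \<le> y"
  shows "(LINT t|lborel. deriv \<eta> t * indicator {x..y} t) = \<eta> y - \<eta> x"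
proof -
  have s: "smooth \<eta>" using test_functionE[OF assms(1)] by metis
  show ?thesis
    using smooth_has_deriv[OF s] DERIV_isCont[OF smooth_has_deriv[OF smooth_deriv[OF s]]]
    by (intro integral_FTC_Icc_real assms(2)) blast+
qed

lemma locally_integrable_continuous:
  assumes "continuous_on {0..} F"
  shows "locally_integrable F"
  unfolding locally_integrable_def
proof (intro allI impI)
  fix K :: "real set" assume K: "compact K \<and> K \<subseteq> {0<..}"
  then have "K \<subseteq> {0..}" by force
  then have "integrable lborel (\<lambda>x. indicator K x *\<^sub>R F x)"
    using K continuous_on_subset[OF assms] by (intro borel_integrable_compact) auto
  then have "integrable lebesgue (\<lambda>x. indicator K x *\<^sub>R F x)"
    using integrable_completion borel_measurable_integrable by blast
  then show "integrable (lebesgue_on K) F"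
    using K by (subst integrable_restrict_space) (auto simp: compact_imp_closed)
qed

lemma locally_integrable_set_integrable:
  fixes f :: "real \<Rightarrow> real"
  assumes "\<And>b. set_integrable lborel {0..b} f"
  shows "locally_integrable f"
  unfolding locally_integrable_def
proof (intro allI impI)
  fix K :: "real set" assume K: "compact K \<and> K \<subseteq> {0<..}"
  then obtain B where B: "\<And>x. x \<in> K \<Longrightarrow> \<bar>x\<bar> \<le> B" using compact_imp_bounded bounded_real by metis
  have "K \<subseteq> {0..B}" using K B by fastforce
  then have "set_integrable lborel K f"
    using K by (intro set_integrable_subset[OF assms[of B]]) (auto simp: borel_compact)
  then have "integrable lborel (\<lambda>x. indicator K x *\<^sub>R f x)" by (simp add: set_integrable_def)
  then have "integrable lebesgue (\<lambda>x. indicator K x *\<^sub>R f x)"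
    using integrable_completion borel_measurable_integrable by blast
  then show "integrable (lebesgue_on K) f"
    using K by (subst integrable_restrict_space) (auto simp: compact_imp_closed)
qed

lemma LINT_half_line_lborel:
  fixes f :: "real \<Rightarrow> real"
  assumes "f \<in> borel_measurable borel"
  shows "(LINT x|lebesgue_on \<real>\<^sub>+. f x) = (LINT x:{0..}|lborel. f x)"
  unfolding LINT_half_line set_lebesgue_integral_def real_scaleR_def
  by (rule integral_completion) (use assms in simp)

text \<open>Integration by parts, as Fubini's theorem for \<open>f t * \<eta>' x\<close> on the triangle \<open>t \<le> x\<close>.\<close>

lemma primitive_by_parts:
  fixes f :: "real \<Rightarrow> real"
  assumes f [measurable]: "f \<in> borel_measurable borel"
    and int: "\<And>b. set_integrable lborel {0..b} f" and \<eta>: "test_function \<eta>"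
    and b: "0 \<le> b" "\<And>x. x \<ge> b \<Longrightarrow> \<eta> x = 0" "\<And>x. x > b \<Longrightarrow> deriv \<eta> x = 0"
  shows "(LINT x:{0..b}|lborel. (LINT t:{0..x}|lborel. f t) * deriv \<eta> x) = - (LINT x:{0..b}|lborel. f x * \<eta> x)"
proof -
  have d [measurable]: "deriv \<eta> \<in> borel_measurable borel"
    using test_function_borel[OF test_function_deriv[OF \<eta>]] .
  obtain C where C: "\<And>x. \<bar>deriv \<eta> x\<bar> \<le> C" using test_function_bounded[OF test_function_deriv[OF \<eta>]] by blast
  have "0 \<le> C" using C[of 0] by linarith
  define G where "G t x = indicator {0..b} t * f t * (indicator {t..b} x * deriv \<eta> x)" for t x
  have G_alt: "G t x = (if 0 \<le> t \<and> t \<le> x \<and> x \<le> b then f t * deriv \<eta> x else 0)" for t x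
    by (auto simp: G_def indicator_def)
  have Gm [measurable]: "case_prod G \<in> borel_measurable (lborel \<Otimes>\<^sub>M lborel)"
    unfolding G_alt[abs_def] by measurable
  have bdd: "integrable lborel (\<lambda>x. C * indicator {0..b} x :: real)"
    by (intro integrable_mult_right integrable_real_indicator) (auto simp: emeasure_lborel_Icc_eq)
  have Gb: "norm (G t x) \<le> \<bar>indicator {0..b} t * f t\<bar> * (C * indicator {0..b} x)" for t x
    using C[of x] \<open>0 \<le> C\<close> by (auto simp: G_def indicator_def abs_mult intro!: mult_left_mono)
  have G1: "integrable lborel (G t)" for t
  proof (rule Bochner_Integration.integrable_bound)
    show "integrable lborel (\<lambda>x. \<bar>indicator {0..b} t * f t\<bar> * (C * indicator {0..b} x))"
      using bdd by simp
    show "G t \<in> borel_measurable lborel" unfolding G_def by measurable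
    show "AE x in lborel. norm (G t x) \<le> norm (\<bar>indicator {0..b} t * f t\<bar> * (C * indicator {0..b} x))"
      using Gb \<open>0 \<le> C\<close> by (auto intro: order_trans[OF _ abs_ge_self])
  qed
  have int_b: "integrable lborel (\<lambda>t. indicator {0..b} t * f t)"
    using int[of b] by (simp add: set_integrable_def)
  have "integrable (lborel \<Otimes>\<^sub>M lborel) (case_prod G)"
  proof (rule lborel_pair.Fubini_integrable[OF Gm])
    show "AE t in lborel. integrable lborel (\<lambda>x. case_prod G (t, x))" using G1 by simp
    show "integrable lborel (\<lambda>t. LINT x|lborel. norm (case_prod G (t, x)))"
    proof (rule Bochner_Integration.integrable_bound)
      show "integrable lborel (\<lambda>t. (C * b) * (indicator {0..b} t * f t))" using int_b by simp
      show "(\<lambda>t. LINT x|lborel. norm (case_prod G (t, x))) \<in> borel_measurable lborel"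
        by measurable
      have "(LINT x|lborel. norm (G t x)) \<le> norm ((C * b) * (indicator {0..b} t * f t))" for t
      proof -
        have "(LINT x|lborel. norm (G t x)) \<le> (LINT x|lborel. \<bar>indicator {0..b} t * f t\<bar> * (C * indicator {0..b} x))"
          using G1 bdd Gb by (intro integral_mono) auto
        also have "\<dots> = norm ((C * b) * (indicator {0..b} t * f t))"
          using b(1) \<open>0 \<le> C\<close> by (simp add: abs_mult)
        finally show ?thesis .
      qed
      then show "AE t in lborel. norm (LINT x|lborel. norm (case_prod G (t, x)))
          \<le> norm ((C * b) * (indicator {0..b} t * f t))" by simp
    qed
  qed
  then have "(LINT x|lborel. LINT t|lborel. G t x) = (LINT t|lborel. LINT x|lborel. G t x)"
    by (rule lborel_pair.Fubini_integral)
  moreover have "(LINT x|lborel. G t x) = - (indicator {0..b} t * (f t * \<eta> t))" for t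
  proof (cases "t \<in> {0..b}")
    case True
    then have "(LINT x|lborel. G t x) = f t * (LINT x|lborel. deriv \<eta> x * indicator {t..b} x)"
      by (simp add: G_def mult.commute)
    also have "\<dots> = f t * (\<eta> b - \<eta> t)" using integral_deriv_test_function[OF \<eta>, of t b] True by simp
    finally show ?thesis using True b by simp
  qed (simp add: G_def)
  moreover have "(LINT t|lborel. G t x) = indicator {0..b} x * ((LINT t:{0..x}|lborel. f t) * deriv \<eta> x)" for x
  proof -
    have "G t x = (indicator {0..b} x * deriv \<eta> x) * (indicator {0..x} t * f t)" for t
      by (auto simp: G_alt indicator_def)
    then show ?thesis by (simp add: set_lebesgue_integral_def)
  qed
  ultimately show ?thesis by (simp add: set_lebesgue_integral_def)
qed

text \<open>The constant contributes \<open>c * (\<eta> e - \<eta> 0) = 0\<close>, since a test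
  function vanishes at both ends; the rest is integration by parts.\<close>

theorem weak_derivative_primitive:
  fixes f F :: "real \<Rightarrow> real"
  assumes f [measurable]: "f \<in> borel_measurable borel"
    and int: "\<And>b. set_integrable lborel {0..b} f"
    and F: "\<And>x. 0 \<le> x \<Longrightarrow> F x = c + (LINT t:{0..x}|lborel. f t)"
  shows "has_weak_derivative F f"
proof -
  have cont: "continuous_on {0..} F"
    using continuous_on_add[OF continuous_on_const[of _ c] continuous_on_primitive[OF int]] F
    by (subst continuous_on_cong[OF refl F]) auto
  have "(LINT x|lebesgue_on \<real>\<^sub>+. F x * deriv \<eta> x) = - (LINT x|lebesgue_on \<real>\<^sub>+. f x * \<eta> x)"
    if \<eta>: "test_function \<eta>" for \<eta>
  proof -
    obtain a b where ab: "0 < a" "a < b" "\<And>x. x \<notin> {a..b} \<Longrightarrow> \<eta> x = 0"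
      using test_functionE[OF \<eta>] by metis
    obtain a' b' where ab': "\<And>x. x \<notin> {a'..b'} \<Longrightarrow> deriv \<eta> x = 0"
      using test_functionE[OF test_function_deriv[OF \<eta>]] by metis
    \<comment> \<open>The support intervals of \<open>\<eta>\<close> and of its derivative are
      obtained separately, hence the maximum; the added 1 makes \<open>\<eta>\<close> vanish at
      \<open>e\<close> itself.\<close>
    define e where "e = max b b' + 1"
    have e: "0 \<le> e" "\<And>x. x \<ge> e \<Longrightarrow> \<eta> x = 0" "\<And>x. x > e \<Longrightarrow> deriv \<eta> x = 0" "\<eta> 0 = 0"
      using ab(1,2) by (auto simp: e_def intro!: ab(3) ab')
    have d [measurable]: "deriv \<eta> \<in> borel_measurable borel" "\<eta> \<in> borel_measurable borel"
      using test_function_borel test_function_deriv \<eta> by auto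
    have P: "continuous_on {0..} (\<lambda>x. LINT t:{0..x}|lborel. f t)" by (rule continuous_on_primitive[OF int])
    have sm: "smooth \<eta>" using test_functionE[OF \<eta>] by metis
    have cd: "continuous_on S (deriv \<eta>)" for S
      using smooth_has_deriv[OF smooth_deriv[OF sm]]
      by (intro continuous_at_imp_continuous_on ballI DERIV_isCont) blast
    have i1: "set_integrable lborel {0..e} (\<lambda>x. (LINT t:{0..x}|lborel. f t) * deriv \<eta> x)"
      unfolding set_integrable_def
      by (intro borel_integrable_compact continuous_intros continuous_on_subset[OF P] cd) auto
    have i2: "set_integrable lborel {0..e} (\<lambda>x. c * deriv \<eta> x)"
      unfolding set_integrable_def
      by (intro borel_integrable_compact continuous_intros cd) auto
    have "(LINT x|lebesgue_on \<real>\<^sub>+. F x * deriv \<eta> x) 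
        = (LINT x|lebesgue. indicator {0..e} x * (c * deriv \<eta> x) + indicator {0..e} x * ((LINT t:{0..x}|lborel. f t) * deriv \<eta> x))"
      unfolding LINT_half_line
      using F e(1,3) by (intro Bochner_Integration.integral_cong) (auto simp: indicator_def ring_distribs not_le)
    also have "\<dots> = (LINT x|lborel. indicator {0..e} x * (c * deriv \<eta> x) + indicator {0..e} x * ((LINT t:{0..x}|lborel. f t) * deriv \<eta> x))"
      by (rule integral_completion) (use i1 i2 in \<open>auto simp: set_integrable_def\<close>)
    also have "\<dots> = (LINT x|lborel. indicator {0..e} x * (c * deriv \<eta> x)) + (LINT x:{0..e}|lborel. (LINT t:{0..x}|lborel. f t) * deriv \<eta> x)"
      using i1 i2 unfolding set_integrable_def set_lebesgue_integral_def by simp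
    also have "(LINT x|lborel. indicator {0..e} x * (c * deriv \<eta> x)) = c * (\<eta> e - \<eta> 0)"
      by (subst integral_deriv_test_function[OF \<eta> e(1), symmetric]) (simp add: ac_simps flip: integral_mult_right_zero)
    also have "(LINT x:{0..e}|lborel. (LINT t:{0..x}|lborel. f t) * deriv \<eta> x) = - (LINT x:{0..e}|lborel. f x * \<eta> x)"
      by (rule primitive_by_parts[OF f int \<eta> e(1-3)])
    also have "(LINT x:{0..e}|lborel. f x * \<eta> x) = (LINT x:{0..}|lborel. f x * \<eta> x)"
      unfolding set_lebesgue_integral_def using e(1,2)
      by (intro Bochner_Integration.integral_cong) (auto simp: indicator_def not_le)
    also have "\<dots> = (LINT x|lebesgue_on \<real>\<^sub>+. f x * \<eta> x)"
      by (rule LINT_half_line_lborel[symmetric]) simp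
    finally show ?thesis using e by simp
  qed
  then show ?thesis
    unfolding has_weak_derivative_def
    using locally_integrable_continuous[OF cont] locally_integrable_set_integrable[OF int] by blast
qed

section \<open>Functions with weak derivative 0\<close>

lemma test_function_primitive:
  assumes "test_function \<psi>" "(LINT x|lebesgue_on \<real>\<^sub>+. \<psi> x) = 0"
  obtains \<eta> where "test_function \<eta>" "deriv \<eta> = \<psi>"
proof -
  obtain a b where ab: "0 < a" "a < b" "\<And>x. x \<notin> {a..b} \<Longrightarrow> \<psi> x = 0" "smooth \<psi>"
    using test_functionE[OF assms(1)] by metis
  have cont: "isCont \<psi> x" for x using DERIV_isCont[OF smooth_has_deriv[OF ab(4)]] .
  then obtain F where F: "\<And>x. (F has_real_derivative \<psi> x) (at x)"
    using einterval_antiderivative[of "-\<infinity>" "\<infinity>" \<psi>]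
    by (auto simp: has_real_derivative_iff_has_vector_derivative)
  have const: "F x = F y" if "x \<le> y" "\<And>z. x < z \<Longrightarrow> z < y \<Longrightarrow> \<psi> z = 0" for x y
  proof (cases "x = y")
    case False
    then show ?thesis using that F DERIV_isCont[OF F]
      by (intro DERIV_isconst_end[of x y F, symmetric]) (auto intro!: continuous_at_imp_continuous_on, metis)
  qed simp
  have lo: "F x = F a" if "x < a" for x
    using that ab(3) by (intro const) auto
  have hi: "F x = F b" if "x > b" for x
    using that ab(3) by (intro const[symmetric]) auto
  have "F b - F a = (LINT x|lborel. \<psi> x * indicator {a..b} x)"
    using F cont ab by (intro integral_FTC_Icc_real[symmetric]) auto
  also have "\<dots> = (LINT x:{0..}|lborel. \<psi> x)"
    unfolding set_lebesgue_integral_def using ab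
    by (intro Bochner_Integration.integral_cong) (auto simp: indicator_def)
  also have "\<dots> = 0"
    using assms(2) LINT_half_line_lborel[OF test_function_borel[OF assms(1)]] by simp
  \<comment> \<open>The vanishing integral makes the constant values of \<open>F\<close> before
    \<open>a\<close> and after \<open>b\<close> agree, so subtracting this value gives compact
    support.\<close>
  finally have Fab: "F b = F a" by simp
  have D: "((\<lambda>x. F x - F a) has_real_derivative \<psi> x) (at x)" for x
    using F by (auto intro!: derivative_eq_intros)
  have "test_function (\<lambda>x. F x - F a)"
  proof (rule test_functionI[of _ a b])
    show "smooth (\<lambda>x. F x - F a)" by (rule smooth_primitive[OF ab(4) D])
    show "F x - F a = 0" if "x \<notin> {a..b}" for x using lo[of x] hi[of x] Fab that by auto
  qed fact
  moreover have "deriv (\<lambda>x. F x - F a) = \<psi>" using D by (intro ext DERIV_imp_deriv)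
  ultimately show ?thesis using that by blast
qed

text \<open>A multiple of one fixed bump \<open>\<theta>\<close> corrects any test function
  \<open>\<psi>\<close> to integral 0, hence to the derivative of a test function. So
  \<open>w\<close> and its weighted mean \<open>c\<close> with weight \<open>\<theta>\<close> act
  alike on every \<open>\<psi>\<close>.\<close>

theorem du_Bois_Reymond:
  assumes loc: "locally_integrable w"
    and zero: "\<And>\<eta>. test_function \<eta> \<Longrightarrow> (LINT x|lebesgue_on \<real>\<^sub>+. w x * deriv \<eta> x) = 0"
  obtains c where "AE x in lebesgue. 0 < x \<longrightarrow> w x = c"
proof -
  define \<theta> where "\<theta> = bump 1 2 1"
  have \<theta>: "test_function \<theta>" by (simp add: \<theta>_def test_function_bump)
  have one: "locally_integrable (\<lambda>x. 1)" by (intro locally_integrable_continuous continuous_intros)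
  have int1: "integrable (lebesgue_on \<real>\<^sub>+) \<psi>" if "test_function \<psi>" for \<psi>
    using integrable_times_test_function[OF one that] by simp
  define I where "I = (LINT x|lebesgue_on \<real>\<^sub>+. \<theta> x)"
  have "I \<noteq> 0"
  proof
    assume "I = 0"
    have "AE x in lebesgue_on \<real>\<^sub>+. \<theta> x = 0"
      using \<open>I = 0\<close> int1[OF \<theta>] bump_bounds(1)
      by (subst (asm) I_def, subst (asm) integral_nonneg_eq_0_iff_AE) (auto simp: \<theta>_def)
    then have "AE x in lebesgue. x \<in> {0..} \<longrightarrow> \<theta> x = 0" by (simp add: AE_restrict_space_iff)
    then have "AE x in lebesgue. x \<notin> {1<..<2::real}"
      by eventually_elim (use bump_pos[of 1 _ 1 2] in \<open>force simp: \<theta>_def\<close>)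
    then have "{1<..<2::real} \<in> null_sets lebesgue" by (subst AE_iff_null_sets) auto
    then have "emeasure lborel {1<..<2::real} = 0" by (simp add: null_sets_def)
    then show False by (simp only: emeasure_lborel_Ioo) simp
  qed
  define c where "c = (LINT x|lebesgue_on \<real>\<^sub>+. w x * \<theta> x) / I"
  have "AE x in lebesgue. 0 < x \<longrightarrow> w x - c = 0"
  proof (rule fundamental_lemma)
    show "locally_integrable (\<lambda>x. w x - c)"
      by (intro locally_integrable_diff loc locally_integrable_continuous continuous_intros)
    fix \<psi> assume \<psi>: "test_function \<psi>"
    define k where "k = (LINT x|lebesgue_on \<real>\<^sub>+. \<psi> x) / I"
    have t: "test_function (\<lambda>x. \<psi> x - k * \<theta> x)"
    proof -
      obtain a b where ab: "0 < a" "a < b" "\<And>x. x \<notin> {a..b} \<Longrightarrow> \<psi> x = 0" "smooth \<psi>"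
        using test_functionE[OF \<psi>] by metis
      have "smooth (\<lambda>x. \<psi> x + (- k) * \<theta> (1 * x + 0))"
        by (intro smooth_add ab smooth_affine) (simp add: \<theta>_def smooth_bump)
      then have sm: "smooth (\<lambda>x. \<psi> x - k * \<theta> x)" by simp
      have "\<psi> x - k * \<theta> x = 0" if "x \<notin> {min a 1..max b 2}" for x
      proof -
        have "x \<notin> {a..b}" "x \<notin> {1<..<2}" using that by auto
        from ab(3)[OF this(1)] bump_eq_0[OF this(2), of 1] show ?thesis by (simp add: \<theta>_def)
      qed
      then show ?thesis using ab(1) by (intro test_functionI[OF sm, of "min a 1" "max b 2"]) auto
    qed
    have "(LINT x|lebesgue_on \<real>\<^sub>+. \<psi> x - k * \<theta> x) = 0"
      using int1[OF \<psi>] int1[OF \<theta>] \<open>I \<noteq> 0\<close> by (simp add: k_def I_def)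
    then obtain \<eta> where "test_function \<eta>" "deriv \<eta> = (\<lambda>x. \<psi> x - k * \<theta> x)"
      using test_function_primitive[OF t] by metis
    then have "(LINT x|lebesgue_on \<real>\<^sub>+. w x * (\<psi> x - k * \<theta> x)) = 0" using zero by metis
    moreover have "(LINT x|lebesgue_on \<real>\<^sub>+. w x * (\<psi> x - k * \<theta> x))
        = (LINT x|lebesgue_on \<real>\<^sub>+. w x * \<psi> x) - k * (LINT x|lebesgue_on \<real>\<^sub>+. w x * \<theta> x)"
      using integrable_times_test_function[OF loc \<psi>] integrable_times_test_function[OF loc \<theta>]
      by (simp add: right_diff_distrib mult.left_commute[of _ k])
    ultimately have "(LINT x|lebesgue_on \<real>\<^sub>+. w x * \<psi> x) = c * (LINT x|lebesgue_on \<real>\<^sub>+. \<psi> x)"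
      using \<open>I \<noteq> 0\<close> by (simp add: k_def c_def field_simps)
    then show "(LINT x|lebesgue_on \<real>\<^sub>+. (w x - c) * \<psi> x) = 0"
      using integrable_times_test_function[OF loc \<psi>] int1[OF \<psi>] by (simp add: left_diff_distrib)
  qed
  then show ?thesis using that by simp
qed


section \<open>Filling the hollows\<close>

locale decaying =
  fixes u :: "real \<Rightarrow> real"
  assumes cont: "continuous_on {0..} u"
    and nonneg: "0 \<le> x \<Longrightarrow> 0 \<le> u x"
    and decay: "(u \<longlongrightarrow> 0) at_top"
begin

definition H :: "real set" where
  "H = {x. \<exists>y z. 0 \<le> y \<and> y < x \<and> x < z \<and> u x < u y \<and> u x < u z}"

lemma H_I: "0 \<le> y \<Longrightarrow> y < x \<Longrightarrow> x < z \<Longrightarrow> u x < u y \<Longrightarrow> u x < u z \<Longrightarrow> x \<in> H"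
  unfolding H_def by blast

lemma H_E:
  assumes "x \<in> H"
  obtains y z where "0 \<le> y" "y < x" "x < z" "u x < u y" "u x < u z"
  using assms unfolding H_def by blast

lemma H_pos: "x \<in> H \<Longrightarrow> 0 < x"
  by (elim H_E) linarith

lemma cont_Icc: "0 \<le> a \<Longrightarrow> continuous_on {a..b} u"
  by (rule continuous_on_subset[OF cont]) auto

lemma open_H: "open H"
  unfolding open_subopen[of H]
proof
  fix x assume "x \<in> H"
  then obtain y z where yz: "0 \<le> y" "y < x" "x < z" "u x < u y" "u x < u z" by (rule H_E)
  let ?T = "{y<..<z} \<inter> u -` {..<min (u y) (u z)}"
  have "open ?T"
    by (intro continuous_open_preimage continuous_on_subset[OF cont]) (use yz in auto)
  moreover have "?T \<subseteq> H" using yz(1) by (auto intro: H_I)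
  ultimately show "\<exists>T. open T \<and> x \<in> T \<and> T \<subseteq> H" using yz by (intro exI[of _ ?T]) auto
qed

lemma H_borel [measurable]: "H \<in> sets borel"
  using open_H by simp

lemma eventually_less: "0 < \<nu> \<Longrightarrow> \<exists>N. \<forall>x\<ge>N. u x < \<nu>"
  using order_tendstoD(2)[OF decay] by (simp add: eventually_at_top_linorder)

text \<open>By decay only a compact part of the tail competes with a positive value; if no value is
  positive, \<open>u\<close> vanishes on the tail and \<open>x\<close> itself serves.\<close>

lemma attains_sup_tail:
  assumes "0 \<le> x"
  obtains t where "x \<le> t" "\<And>w. x \<le> w \<Longrightarrow> u w \<le> u t"
proof (cases "\<exists>w\<ge>x. u w > 0")
  case True
  then obtain w0 where w0: "x \<le> w0" "u w0 > 0" by blast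
  obtain N where N: "\<And>w. w \<ge> N \<Longrightarrow> u w < u w0" using eventually_less[OF w0(2)] by blast
  have "{x..max N w0} \<noteq> {}" using w0 by auto
  then obtain t where t: "t \<in> {x..max N w0}" "\<And>w. w \<in> {x..max N w0} \<Longrightarrow> u w \<le> u t"
    using continuous_attains_sup[OF compact_Icc _ cont_Icc[OF assms]] by blast
  have "u w \<le> u t" if "x \<le> w" for w
  proof (cases "w \<le> max N w0")
    case False
    then show ?thesis using N[of w] t(2)[of w0] w0 by (auto simp: not_le)
  qed (use t that in auto)
  then show ?thesis using that t by auto
next
  case False
  then show ?thesis using that[of x] nonneg assms by (force simp: not_less)
qed

lemma last_point:
  assumes "0 < \<nu>" "0 \<le> x" "\<nu> \<le> u x"
  obtains b where "x \<le> b" "u b = \<nu>" "\<And>w. b < w \<Longrightarrow> u w < \<nu>"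
proof -
  obtain N where N: "\<And>w. w \<ge> N \<Longrightarrow> u w < \<nu>" using eventually_less[OF assms(1)] by blast
  have xN: "x < N" using N[of x] assms(3) by (meson linorder_not_le)
  let ?A = "{x..N} \<inter> u -` {\<nu>..}"
  have "closed ?A"
    by (intro continuous_closed_preimage cont_Icc assms closed_atLeast closed_atLeastAtMost)
  then have cA: "compact ?A"
    using bounded_subset[OF bounded_closed_interval[of x N], of ?A] by (auto simp: compact_eq_bounded_closed)
  moreover have "x \<in> ?A" using assms xN by auto
  ultimately obtain b where b: "b \<in> ?A" "\<And>w. w \<in> ?A \<Longrightarrow> w \<le> b"
    using compact_attains_sup[OF cA] by blast
  have lt: "u w < \<nu>" if "b < w" for w
  proof (rule ccontr)
    assume *: "\<not> u w < \<nu>"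
    then have "w \<in> ?A" using N[of w] that b(1) by (auto simp: not_less intro: ccontr)
    then show False using b(2) that by force
  qed
  \<comment> \<open>The intermediate value theorem yields a point of value \<open>\<nu>\<close> at
    or beyond \<open>b\<close>; as all later values are smaller, this point is
    \<open>b\<close>.\<close>
  have "\<exists>c. b \<le> c \<and> c \<le> N \<and> u c = \<nu>"
    by (rule IVT2') (use b N[of N] assms in \<open>auto intro!: cont_Icc\<close>)
  then obtain c where "b \<le> c" "u c = \<nu>" by blast
  with lt[of c] have "u b = \<nu>" by force
  then show ?thesis using that[of b] b lt by auto
qed

text \<open>Points outside \<open>H\<close> exist on both sides of \<open>x\<close>: 0 on the left,
  and on the right a point \<open>t\<close> where \<open>u\<close> is maximal over the tail.
  Compactness picks the nearest ones.\<close>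

lemma component_of_H:
  assumes "x \<in> H"
  obtains \<alpha> \<beta> where "0 \<le> \<alpha>" "\<alpha> < x" "x < \<beta>" "\<alpha> \<notin> H" "\<beta> \<notin> H" "{\<alpha><..<\<beta>} \<subseteq> H"
proof -
  have x: "0 < x" using H_pos assms .
  obtain t where t: "x \<le> t" "\<And>w. x \<le> w \<Longrightarrow> u w \<le> u t" using attains_sup_tail[of x] x by auto
  have tH: "t \<notin> H" using t by (auto elim!: H_E) (meson dual_order.trans leD less_imp_le)
  have H0: "0 \<notin> H" using H_pos by blast
  have cl: "compact ({a..b} - H)" for a b
    using compact_diff[OF compact_Icc open_H] .
  have "0 \<in> {0..x} - H" "t \<in> {x..t} - H" using x t tH H0 by auto
  then obtain \<alpha> \<beta> where \<alpha>: "\<alpha> \<in> {0..x} - H" "\<And>w. w \<in> {0..x} - H \<Longrightarrow> w \<le> \<alpha>"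
    and \<beta>: "\<beta> \<in> {x..t} - H" "\<And>w. w \<in> {x..t} - H \<Longrightarrow> \<beta> \<le> w"
    using compact_attains_sup[OF cl[of 0 x]] compact_attains_inf[OF cl[of x t]] by blast
  have "w \<in> H" if "\<alpha> < w" "w < \<beta>" for w
  proof (rule ccontr)
    assume "w \<notin> H"
    then show False using \<alpha>(1) \<alpha>(2)[of w] \<beta>(1) \<beta>(2)[of w] that by (cases "w \<le> x") auto
  qed
  then have "{\<alpha><..<\<beta>} \<subseteq> H" by auto
  moreover have "\<alpha> \<noteq> x" "\<beta> \<noteq> x" using \<alpha> \<beta> assms by auto
  ultimately show ?thesis using that[of \<alpha> \<beta>] \<alpha>(1) \<beta>(1) by (simp add: order_less_le)
qed

text \<open>If \<open>u \<alpha> < u \<beta>\<close>, then no value left of \<open>\<alpha>\<close>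
  exceeds \<open>u \<alpha>\<close>, for otherwise \<open>\<alpha>\<close> would belong to
  \<open>H\<close>. The first point of the component whose value reaches the mean \<open>c\<close>
  therefore has no higher value to its left, yet it lies in \<open>H\<close>. The other case is the
  mirror image, with the last such point.\<close>

lemma component_ends_equal:
  assumes "0 \<le> \<alpha>" "\<alpha> < \<beta>" "{\<alpha><..<\<beta>} \<subseteq> H" "\<alpha> \<notin> H" "\<beta> \<notin> H"
  shows "u \<alpha> = u \<beta>"
proof (rule ccontr)
  define c where "c = (u \<alpha> + u \<beta>) / 2"
  let ?A = "{\<alpha>..\<beta>} \<inter> u -` {c..}"
  have "closed ?A"
    by (intro continuous_closed_preimage cont_Icc assms closed_atLeast closed_atLeastAtMost)
  then have cA: "compact ?A"
    using bounded_subset[OF bounded_closed_interval[of \<alpha> \<beta>], of ?A] by (auto simp: compact_eq_bounded_closed)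
  assume "u \<alpha> \<noteq> u \<beta>"
  then consider "u \<alpha> < u \<beta>" | "u \<beta> < u \<alpha>" by linarith
  then show False
  proof cases
    case 1
    then have c: "u \<alpha> < c" "c < u \<beta>" by (auto simp: c_def)
    have before: "u y \<le> u \<alpha>" if "0 \<le> y" "y \<le> \<alpha>" for y
      using H_I[of y \<alpha> \<beta>] assms 1 that by (cases "y = \<alpha>") (auto simp: not_less[symmetric])
    have "\<exists>t\<ge>\<alpha>. t \<le> \<beta> \<and> u t = c"
      by (rule IVT') (use c assms in \<open>auto intro!: cont_Icc\<close>)
    then obtain t0 where t0: "t0 \<in> {\<alpha>..\<beta>}" "u t0 = c" by auto
    then have "?A \<noteq> {}" by auto
    then obtain t where t: "t \<in> ?A" "\<And>w. w \<in> ?A \<Longrightarrow> t \<le> w"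
      using compact_attains_inf[OF cA] by blast
    have tt: "t \<in> {\<alpha>..\<beta>}" "c \<le> u t" using t(1) by auto
    have "t \<le> t0" using t(2)[of t0] t0 by simp
    moreover have "t0 \<noteq> \<beta>" "t \<noteq> \<alpha>" using t0(2) c tt(2) by auto
    ultimately have "t \<in> {\<alpha><..<\<beta>}" using tt(1) t0(1) by simp
    then have "t \<in> H" using assms(3) by blast
    then obtain y where y: "0 \<le> y" "y < t" "u t < u y" by (rule H_E)
    show False
    proof (cases "y \<le> \<alpha>")
      case True
      then show False using before[OF y(1)] y(3) tt(2) c by linarith
    next
      case False
      then show False using t(2)[of y] y tt by simp
    qed
  next
    case 2
    then have c: "u \<beta> < c" "c < u \<alpha>" by (auto simp: c_def)
    have after: "u y \<le> u \<beta>" if "\<beta> \<le> y" for y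
      using H_I[of \<alpha> \<beta> y] assms 2 that by (cases "y = \<beta>") (auto simp: not_less[symmetric])
    have "\<exists>t\<ge>\<alpha>. t \<le> \<beta> \<and> u t = c"
      by (rule IVT2') (use c assms in \<open>auto intro!: cont_Icc\<close>)
    then obtain t0 where t0: "t0 \<in> {\<alpha>..\<beta>}" "u t0 = c" by auto
    then have "?A \<noteq> {}" by auto
    then obtain t where t: "t \<in> ?A" "\<And>w. w \<in> ?A \<Longrightarrow> w \<le> t"
      using compact_attains_sup[OF cA] by blast
    have tt: "t \<in> {\<alpha>..\<beta>}" "c \<le> u t" using t(1) by auto
    have "t0 \<le> t" using t(2)[of t0] t0 by simp
    moreover have "t0 \<noteq> \<alpha>" "t \<noteq> \<beta>" using t0(2) c tt(2) by auto
    ultimately have "t \<in> {\<alpha><..<\<beta>}" using tt(1) t0(1) by simp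
    then have "t \<in> H" using assms(3) by blast
    then obtain z where z: "t < z" "u t < u z" by (rule H_E)
    show False
    proof (cases "\<beta> \<le> z")
      case True
      then show False using after[of z] z(2) tt(2) c by linarith
    next
      case False
      then show False using t(2)[of z] z tt by simp
    qed
  qed
qed

text \<open>An interior maximum above the ends would lie in \<open>H\<close> and so have a higher
  value to its left, by maximality even left of \<open>\<alpha>\<close>, and one to its right; then
  \<open>\<alpha>\<close> would lie in \<open>H\<close> as well.\<close>

lemma component_le_ends:
  assumes "0 \<le> \<alpha>" "\<alpha> \<le> \<beta>" "{\<alpha><..<\<beta>} \<subseteq> H" "\<alpha> \<notin> H" "u \<alpha> = u \<beta>" "t \<in> {\<alpha>..\<beta>}"
  shows "u t \<le> u \<alpha>"
proof -
  obtain m where m: "m \<in> {\<alpha>..\<beta>}" "\<And>w. w \<in> {\<alpha>..\<beta>} \<Longrightarrow> u w \<le> u m"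
    using continuous_attains_sup[OF compact_Icc _ cont_Icc[OF assms(1)], of \<beta>] assms by auto
  have "u m \<le> u \<alpha>"
  proof (rule ccontr)
    assume *: "\<not> ?thesis"
    then have "m \<noteq> \<alpha>" "m \<noteq> \<beta>" using assms by auto
    then have "m \<in> {\<alpha><..<\<beta>}" using m(1) by auto
    then have "m \<in> H" using assms(3) by blast
    then obtain y z where yz: "0 \<le> y" "y < m" "m < z" "u m < u y" "u m < u z" by (rule H_E)
    have "y < \<alpha>" using m(2)[of y] yz m(1) by force
    then have "\<alpha> \<in> H" using yz m(1) * by (intro H_I[of y \<alpha> z]) auto
    then show False using assms(4) by simp
  qed
  then show ?thesis using m(2)[OF assms(6)] by simp
qed

text \<open>Outside \<open>H\<close> the degenerate choice \<open>\<alpha> = \<beta> = x\<close>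
  works, which spares later arguments a case distinction.\<close>

lemma plateau:
  assumes "0 \<le> x"
  obtains \<alpha> \<beta> where "0 \<le> \<alpha>" "\<alpha> \<le> x" "x \<le> \<beta>" "\<alpha> \<notin> H" "\<beta> \<notin> H" "{\<alpha><..<\<beta>} \<subseteq> H" "u \<alpha> = u \<beta>"
    "\<And>t. t \<in> {\<alpha>..\<beta>} \<Longrightarrow> u t \<le> u \<alpha>"
proof (cases "x \<in> H")
  case True
  then obtain \<alpha> \<beta> where ab: "0 \<le> \<alpha>" "\<alpha> < x" "x < \<beta>" "\<alpha> \<notin> H" "\<beta> \<notin> H" "{\<alpha><..<\<beta>} \<subseteq> H"
    by (rule component_of_H)
  have e: "u \<alpha> = u \<beta>" by (rule component_ends_equal) (use ab in auto)
  show ?thesis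
  proof (rule that[OF ab(1) _ _ ab(4-6) e])
    show "u t \<le> u \<alpha>" if "t \<in> {\<alpha>..\<beta>}" for t
      using ab that by (intro component_le_ends[OF ab(1) _ ab(6,4) e]) auto
  qed (use ab in auto)
next
  case False
  then show ?thesis using that[of x x] assms by auto
qed

end

section \<open>The function with its hollows filled\<close>

locale decaying_primitive = decaying +
  fixes g :: "real \<Rightarrow> real"
  assumes g_borel [measurable]: "g \<in> borel_measurable borel"
    and g_int: "\<And>b. set_integrable lborel {0..b} g"
    and u_eq: "0 \<le> x \<Longrightarrow> u x = u 0 + (LINT t:{0..x}|lborel. g t)"
begin

text \<open>The least function above \<open>u\<close> without hollows, as a primitive.\<close>

definition W :: "real \<Rightarrow> real" where
  "W x = u 0 + (LINT t:{0..x} - H|lborel. g t)"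

lemma g_int_subset: "A \<subseteq> {0..b} \<Longrightarrow> A \<in> sets borel \<Longrightarrow> set_integrable lborel A g"
  by (rule set_integrable_subset[OF g_int]) auto

lemma u_diff:
  assumes "0 \<le> x" "x \<le> y"
  shows "(LINT t:{x<..<y}|lborel. g t) = u y - u x"
proof -
  have "(LINT t:{x<..<y}|lborel. g t) = (LINT t:{x<..y}|lborel. g t)"
    unfolding set_lebesgue_integral_def
  proof (rule integral_cong_AE)
    show "AE t in lborel. indicator {x<..<y} t *\<^sub>R g t = indicator {x<..y} t *\<^sub>R g t"
      using AE_lborel_singleton[of y] by eventually_elim (simp add: indicator_def less_le)
  qed simp_all
  then show ?thesis using primitive_diff[OF g_int assms] u_eq[of x] u_eq[of y] assms by linarith
qed

text \<open>The open set splits into countably many intervals with ends outside \<open>H\<close>,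
  and by \<open>component_ends_equal\<close> each contributes the difference of two equal values.
  The condition \<open>\<alpha> \<notin> H\<close> ensures that the cut at \<open>\<alpha>\<close>
  goes through no component.\<close>

lemma integral_hollow_eq_0:
  assumes "0 \<le> \<alpha>" "\<alpha> \<notin> H"
  shows "(LINT t:H \<inter> {0<..<\<alpha>}|lborel. g t) = 0"
proof -
  define U where "U = H \<inter> {0<..<\<alpha>}"
  have U: "open U" using open_H by (auto simp: U_def)
  let ?C = "components U"
  have count: "countable ?C" 
    by (rule countable_disjoint_open_subsets)
       (use U pairwise_disjoint_components[of U] in \<open>auto simp: open_components pairwise_def disjnt_def\<close>)
  have comp: "K \<in> sets borel \<and> K \<subseteq> {0..\<alpha>} \<and> (LINT t:K|lborel. g t) = 0" if K: "K \<in> ?C" for K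
  proof -
    have KU: "K \<subseteq> U" "connected K" "K \<noteq> {}" "open K"
      using K U by (auto simp: in_components_subset in_components_connected in_components_nonempty open_components)
    define a b where "a = Inf K" and "b = Sup K"
    have bdd: "bdd_above K" "bdd_below K" using KU(1) by (auto simp: U_def intro!: bdd_aboveI[of _ \<alpha>] bdd_belowI[of _ 0])
    have K_eq: "K = {a<..<b}"
    proof
      have "a \<le> t \<and> t \<le> b" if "t \<in> K" for t
        using that bdd by (auto simp: a_def b_def intro: cInf_lower cSup_upper)
      moreover have "a \<notin> K" "b \<notin> K"
        unfolding a_def b_def using KU(1)
        by (intro Inf_notin_open[OF KU(4), of 0] Sup_notin_open[OF KU(4), of \<alpha>]; force simp: U_def)+
      ultimately show "K \<subseteq> {a<..<b}" by (force simp: less_le)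
      show "{a<..<b} \<subseteq> K"
      proof
        fix t assume "t \<in> {a<..<b}"
        then obtain s r where "s \<in> K" "s < t" "r \<in> K" "t < r"
          using cInf_less_iff[OF KU(3) bdd(2), of t] less_cSup_iff[OF KU(3) bdd(1), of t] by (auto simp: a_def b_def)
        then show "t \<in> K" using KU(2) connected_contains_Icc[of K s r] by force
      qed
    qed
    have ab: "a < b" using KU(3) K_eq by auto
    have sub: "{a<..<b} \<subseteq> {0<..<\<alpha>}" using KU(1) K_eq by (auto simp: U_def)
    then have ab': "0 \<le> a" "b \<le> \<alpha>"
      using ab by (auto simp: greaterThanLessThan_subseteq_greaterThanLessThan)
    have max: "t \<subseteq> K" if "connected t" "t \<subseteq> U" "K \<inter> t \<noteq> {}" for t
      using components_maximal[OF K] that by blast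
    \<comment> \<open>An end point in \<open>H\<close> could be adjoined to the component, against
      its maximality.\<close>
    have "a \<notin> H"
    proof
      assume "a \<in> H"
      then have "a \<in> U" using H_pos ab ab' by (auto simp: U_def)
      then have "{a..<b} \<subseteq> U" using KU(1) K_eq by (auto simp: less_le)
      then have "{a..<b} \<subseteq> K" using ab dense[OF ab] by (intro max) (auto simp: K_eq connected_Ico)
      then show False using ab K_eq by auto
    qed
    moreover have "b \<notin> H"
    proof
      assume "b \<in> H"
      then have "b \<in> U" using H_pos ab ab' assms(2) by (auto simp: U_def less_le)
      then have "{a<..b} \<subseteq> U" using KU(1) K_eq by (auto simp: less_le)
      then have "{a<..b} \<subseteq> K" using ab dense[OF ab] by (intro max) (auto simp: K_eq connected_Ioc)
      then show False using ab K_eq by auto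
    qed
    ultimately have "u a = u b"
      using KU(1) K_eq ab ab' by (intro component_ends_equal) (auto simp: U_def)
    then show ?thesis using u_diff[of a b] ab ab' K_eq by auto
  qed
  \<comment> \<open>Enumerates the components by natural numbers, with the empty set at idle
    indices, so that finite and infinite families are treated alike.\<close>
  define A where "A n = \<Union>{K \<in> ?C. to_nat_on ?C K = n}" for n
  have A: "A n = {} \<or> (A n \<in> ?C \<and> to_nat_on ?C (A n) = n)" for n
  proof (cases "\<exists>K\<in>?C. to_nat_on ?C K = n")
    case True
    then obtain K where K: "K \<in> ?C" "to_nat_on ?C K = n" by blast
    have "{K \<in> ?C. to_nat_on ?C K = n} = {K}"
      using K inj_onD[OF inj_on_to_nat_on[OF count]] by blast
    then show ?thesis using K by (simp add: A_def)
  next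
    case False
    then show ?thesis by (auto simp: A_def)
  qed
  have disj: "A n \<inter> A m = {}" if "n \<noteq> m" for n m
    using A[of n] A[of m] that components_nonoverlap[of "A n" U "A m"] by auto
  have "(\<Union>n. A n) = \<Union>?C" by (auto simp only: A_def)
  then have un: "(\<Union>n. A n) = U" by simp
  have "(LINT t:(\<Union>n. A n)|lborel. g t) = (\<Sum>n. LINT t:A n|lborel. g t)"
  proof (rule lebesgue_integral_countable_add)
    show "A n \<in> sets lborel" for n using A[of n] comp by auto
    show "set_integrable lborel (\<Union>n. A n) g"
      unfolding un using U by (intro g_int_subset[of _ \<alpha>]) (auto simp: U_def)
  qed (use disj in auto)
  also have "\<dots> = (\<Sum>n. 0)"
  proof (rule arg_cong[of _ _ suminf], rule ext)
    show "(LINT t:A n|lborel. g t) = 0" for n using A[of n] comp by (auto simp: set_lebesgue_integral_def)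
  qed
  finally show ?thesis by (simp add: un U_def)
qed

lemma W_outside_H:
  assumes "0 \<le> x" "x \<notin> H"
  shows "W x = u x"
proof -
  have "{0..x} = ({0..x} - H) \<union> (H \<inter> {0<..<x})" using assms H_pos by (auto simp: less_le)
  then have "(LINT t:{0..x}|lborel. g t) = (LINT t:({0..x} - H) \<union> (H \<inter> {0<..<x})|lborel. g t)" by simp
  also have "\<dots> = (LINT t:{0..x} - H|lborel. g t) + (LINT t:H \<inter> {0<..<x}|lborel. g t)"
    by (intro set_integral_Un g_int_subset[of _ x]) auto
  finally show ?thesis using integral_hollow_eq_0[OF assms] u_eq[OF assms(1)] by (simp add: W_def)
qed

text \<open>\<open>W\<close> does not change across a component of \<open>H\<close> and keeps the
  common value of \<open>u\<close> at the two ends. Sign, lower bounds and decay of \<open>W\<close>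
  are read off from \<open>u\<close> there.\<close>

lemma W_plateau:
  assumes "0 \<le> x"
  obtains \<alpha> \<beta> where "0 \<le> \<alpha>" "\<alpha> \<le> x" "x \<le> \<beta>" "\<alpha> \<notin> H" "W x = u \<alpha>" "W x = u \<beta>"
    "\<forall>t\<in>{\<alpha>..\<beta>}. u t \<le> W x"
proof -
  obtain \<alpha> \<beta> where ab: "0 \<le> \<alpha>" "\<alpha> \<le> x" "x \<le> \<beta>" "\<alpha> \<notin> H" "\<beta> \<notin> H" "{\<alpha><..<\<beta>} \<subseteq> H" "u \<alpha> = u \<beta>"
    "\<And>t. t \<in> {\<alpha>..\<beta>} \<Longrightarrow> u t \<le> u \<alpha>" using plateau[OF assms] by metis
  have "W x = u \<alpha>"
  proof (cases "x = \<beta>")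
    case True
    then show ?thesis using ab W_outside_H[of x] assms by simp
  next
    case False
    then have "{0..x} - H = {0..\<alpha>} - H" using ab(1-6) by (force simp: subset_iff)
    then have "W x = W \<alpha>" by (simp add: W_def)
    then show ?thesis using W_outside_H[of \<alpha>] ab by simp
  qed
  then show ?thesis using that[of \<alpha> \<beta>] ab by simp
qed

lemma W_nonneg: "0 \<le> x \<Longrightarrow> 0 \<le> W x"
proof -
  assume "0 \<le> x"
  then obtain \<alpha> \<beta> where "0 \<le> \<alpha>" "W x = u \<alpha>" by (rule W_plateau)
  then show ?thesis using nonneg by simp
qed

text \<open>Expresses that \<open>W\<close> has no hollows. If the left end \<open>\<alpha>\<close>
  of the plateau lies between \<open>a\<close> and \<open>b\<close> with a value below
  \<open>\<nu>\<close>, it belongs to \<open>H\<close>; otherwise \<open>a\<close> lies on the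
  plateau, where \<open>u\<close> does not exceed \<open>W x\<close>.\<close>

lemma W_ge:
  assumes "0 \<le> a" "a \<le> x" "x \<le> b" "\<nu> \<le> u a" "\<nu> \<le> u b"
  shows "\<nu> \<le> W x"
proof -
  have "0 \<le> x" using assms by simp
  obtain \<alpha> \<beta> where ab: "0 \<le> \<alpha>" "\<alpha> \<le> x" "x \<le> \<beta>" "\<alpha> \<notin> H" "W x = u \<alpha>" "W x = u \<beta>"
    "\<forall>t\<in>{\<alpha>..\<beta>}. u t \<le> W x" by (rule W_plateau[OF \<open>0 \<le> x\<close>])
  show ?thesis
  proof (cases "a \<le> \<alpha>")
    case True
    show ?thesis
    proof (rule ccontr)
      assume *: "\<not> \<nu> \<le> W x"
      then have "a \<noteq> \<alpha>" "\<alpha> \<noteq> b" using ab assms by auto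
      then have "\<alpha> \<in> H" using * ab assms True by (intro H_I[of a \<alpha> b]) auto
      then show False using ab by simp
    qed
  next
    case False
    then have "u a \<le> W x" using ab(3) assms(2) by (intro ab(7)[rule_format]) simp
    then show ?thesis using assms(4) by simp
  qed
qed

lemma W_tendsto_0: "(W \<longlongrightarrow> 0) at_top"
proof (rule tendstoI)
  fix e :: real assume "0 < e"
  then obtain N where N: "\<And>x. x \<ge> N \<Longrightarrow> u x < e" using eventually_less by blast
  have "dist (W x) 0 < e" if "x \<ge> max N 0" for x
  proof -
    have "0 \<le> x" using that by simp
    obtain \<alpha> \<beta> where "x \<le> \<beta>" "W x = u \<beta>" by (rule W_plateau[OF \<open>0 \<le> x\<close>])
    then show ?thesis using N[of \<beta>] W_nonneg[OF \<open>0 \<le> x\<close>] that by simp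
  qed
  then show "\<forall>\<^sub>F x in at_top. dist (W x) 0 < e" unfolding eventually_at_top_linorder by blast
qed

end


section \<open>The change of variables behind the tamping\<close>

context decaying
begin

definition S :: "real \<Rightarrow> real set" where
  "S \<nu> = {x. 0 \<le> x \<and> \<nu> \<le> u x}"

lemma closed_S: "closed (S \<nu>)"
proof -
  have "S \<nu> = {0..} \<inter> u -` {\<nu>..}" by (auto simp: S_def)
  then show ?thesis by (simp only:) (intro continuous_closed_preimage cont closed_atLeast)
qed

lemma S_borel [measurable]: "S \<nu> \<in> sets borel"
  using closed_S by (rule borel_closed)

lemma S_bounded:
  assumes "0 < \<nu>"
  obtains N where "0 \<le> N" "S \<nu> \<subseteq> {0..N}"
proof -
  obtain N where "\<And>x. x \<ge> N \<Longrightarrow> u x < \<nu>" using eventually_less[OF assms] by blast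
  then have "S \<nu> \<subseteq> {0..max N 0}"
    unfolding S_def by (auto simp: le_max_iff_disj) (meson linorder_not_le nle_le)
  then show ?thesis using that[of "max N 0"] by simp
qed

lemma fmeasurable_Icc_subset:
  fixes A :: "real set"
  assumes "A \<in> sets borel" "A \<subseteq> {a..b}"
  shows "A \<in> fmeasurable lborel"
proof (rule fmeasurableI2)
  show "{a..b} \<in> fmeasurable lborel" by (intro fmeasurableI) (auto simp: emeasure_lborel_Icc_eq)
qed (use assms in auto)

lemma S_fmeasurable: "0 < \<nu> \<Longrightarrow> S \<nu> \<in> fmeasurable lborel"
  using S_bounded fmeasurable_Icc_subset[OF S_borel] by metis

lemma near_greater:
  assumes "0 \<le> x" "\<nu> < u x"
  obtains d where "0 < d" "\<And>y. 0 \<le> y \<Longrightarrow> \<bar>y - x\<bar> < d \<Longrightarrow> \<nu> < u y"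
proof -
  have "0 < u x - \<nu>" using assms by simp
  then obtain d where "0 < d" "\<And>y. 0 \<le> y \<Longrightarrow> dist y x < d \<Longrightarrow> dist (u y) (u x) < u x - \<nu>"
    using cont assms(1) unfolding continuous_on_iff by (metis atLeast_iff)
  then show ?thesis using that[of d] by (fastforce simp: dist_real_def)
qed

lemma near_less:
  assumes "0 \<le> x" "u x < \<nu>"
  obtains d where "0 < d" "\<And>y. 0 \<le> y \<Longrightarrow> \<bar>y - x\<bar> < d \<Longrightarrow> u y < \<nu>"
proof -
  have "0 < \<nu> - u x" using assms by simp
  then obtain d where "0 < d" "\<And>y. 0 \<le> y \<Longrightarrow> dist y x < d \<Longrightarrow> dist (u y) (u x) < \<nu> - u x"
    using cont assms(1) unfolding continuous_on_iff by (metis atLeast_iff)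
  then show ?thesis using that[of d] by (fastforce simp: dist_real_def)
qed

text \<open>Continuity turns a strict inequality at one point into positive measure, which links
  pointwise values with essential notions. At equality this fails, for instance at a strict
  maximum.\<close>

lemma S_positive:
  assumes "0 \<le> x" "\<nu> < u x" "x < e"
  shows "emeasure lborel (S \<nu> \<inter> {x..e}) \<noteq> 0"
proof -
  obtain d where d: "0 < d" "\<And>y. 0 \<le> y \<Longrightarrow> \<bar>y - x\<bar> < d \<Longrightarrow> \<nu> < u y"
    using near_greater[OF assms(1,2)] by blast
  let ?e = "min e (x + d / 2)"
  have lt: "x < ?e" using d(1) assms(3) by simp
  have "{x..?e} \<subseteq> S \<nu> \<inter> {x..e}"
  proof
    fix y assume "y \<in> {x..?e}"
    then have "x \<le> y" "y \<le> e" "\<bar>y - x\<bar> < d" using d(1) by auto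
    then show "y \<in> S \<nu> \<inter> {x..e}" using d(2)[of y] assms(1) by (simp add: S_def)
  qed
  then have "emeasure lborel {x..?e} \<le> emeasure lborel (S \<nu> \<inter> {x..e})"
    by (intro emeasure_mono) simp_all
  moreover have "emeasure lborel {x..?e} = ennreal (?e - x)" using lt by (intro emeasure_lborel_Icc) simp
  ultimately show ?thesis using lt by auto
qed

definition first_point :: "real \<Rightarrow> real" where
  "first_point \<nu> = Sup {a. 0 \<le> a \<and> emeasure lborel (S \<nu> \<inter> {0..a}) = 0}"

text \<open>Points of value exactly \<open>\<nu>\<close> may precede the essential left end as long
  as they form a null set, so to its left only \<open>u x \<le> \<nu>\<close> is available. At the
  end itself a value below \<open>\<nu>\<close> would allow the supremum to be enlarged.\<close>

lemma first_point:
  assumes "0 < \<nu>" "emeasure lborel (S \<nu>) \<noteq> 0"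
  shows first_point_nonneg: "0 \<le> first_point \<nu>"
    and first_point_le: "\<And>x. 0 \<le> x \<Longrightarrow> x < first_point \<nu> \<Longrightarrow> u x \<le> \<nu>"
    and first_point_ge: "\<nu> \<le> u (first_point \<nu>)"
    and first_point_null: "emeasure lborel (S \<nu> \<inter> {0..first_point \<nu>}) = 0"
    and first_point_lower: "\<And>x. 0 \<le> x \<Longrightarrow> \<nu> < u x \<Longrightarrow> first_point \<nu> \<le> x"
proof -
  define A where "A = {a. 0 \<le> a \<and> emeasure lborel (S \<nu> \<inter> {0..a}) = 0}"
  define a where "a = Sup A"
  have fp: "first_point \<nu> = a" by (simp add: first_point_def a_def A_def)
  have "emeasure lborel (S \<nu> \<inter> {0..0}) \<le> emeasure lborel {0::real}"
    by (intro emeasure_mono) auto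
  then have A0: "0 \<in> A" by (simp add: A_def)
  obtain N where N: "0 \<le> N" "S \<nu> \<subseteq> {0..N}" using S_bounded[OF assms(1)] .
  have "x \<le> N" if "x \<in> A" for x
  proof (rule ccontr)
    assume "\<not> x \<le> N"
    then have "S \<nu> \<inter> {0..x} = S \<nu>" using N by force
    then show False using that assms(2) by (simp add: A_def)
  qed
  then have bdd: "bdd_above A" by (rule bdd_aboveI)
  have le_a: "x \<le> a" if "x \<in> A" for x unfolding a_def by (rule cSup_upper[OF that bdd])
  have gt: "\<exists>a'\<in>A. x < a'" if "x < a" for x
    using that less_cSup_iff[OF _ bdd, of x] A0 by (auto simp: a_def)
  show nn: "0 \<le> first_point \<nu>" using le_a[OF A0] fp by simp
  show "u x \<le> \<nu>" if x: "0 \<le> x" "x < first_point \<nu>" for x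
  proof (rule ccontr)
    assume "\<not> u x \<le> \<nu>"
    moreover obtain a' where a': "a' \<in> A" "x < a'" using gt[of x] x(2) unfolding fp by blast
    ultimately have "emeasure lborel (S \<nu> \<inter> {x..a'}) \<noteq> 0" using S_positive[of x \<nu> a'] that by simp
    moreover have "emeasure lborel (S \<nu> \<inter> {x..a'}) \<le> emeasure lborel (S \<nu> \<inter> {0..a'})"
      using that by (intro emeasure_mono) auto
    ultimately show False using a' by (simp add: A_def)
  qed
  show "\<nu> \<le> u (first_point \<nu>)"
  proof (rule ccontr)
    assume "\<not> \<nu> \<le> u (first_point \<nu>)"
    then have "u a < \<nu>" "0 \<le> a" using nn fp by auto
    then obtain d where d: "0 < d" "\<And>y. 0 \<le> y \<Longrightarrow> \<bar>y - a\<bar> < d \<Longrightarrow> u y < \<nu>"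
      using near_less[of a \<nu>] by blast
    obtain a' where a': "a' \<in> A" "a - d < a'" using gt[of "a - d"] d(1) by auto
    have "S \<nu> \<inter> {0..a + d / 2} \<subseteq> S \<nu> \<inter> {0..a'}"
    proof
      fix y assume y: "y \<in> S \<nu> \<inter> {0..a + d / 2}"
      then have "\<not> u y < \<nu>" "0 \<le> y" by (auto simp: S_def)
      then have "\<not> \<bar>y - a\<bar> < d" using d(2) by blast
      then show "y \<in> S \<nu> \<inter> {0..a'}" using y a' d(1) by (auto simp: abs_less_iff)
    qed
    then have "emeasure lborel (S \<nu> \<inter> {0..a + d / 2}) \<le> emeasure lborel (S \<nu> \<inter> {0..a'})"
      by (intro emeasure_mono) auto
    then have "a + d / 2 \<in> A" using a' d(1) \<open>0 \<le> a\<close> by (simp add: A_def)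
    then show False using le_a d(1) by force
  qed
  show "emeasure lborel (S \<nu> \<inter> {0..first_point \<nu>}) = 0"
  proof -
    \<comment> \<open>The supremum is itself admissible: up to the single point \<open>a\<close>,
      the interval is a countable union of admissible ones.\<close>
    have "\<exists>a'\<in>A. a - 1 / Suc n < a'" for n by (intro gt) simp
    then obtain f where f: "\<And>n. f n \<in> A" "\<And>n. a - 1 / Suc n < f n" by metis
    have "(\<Union>n. S \<nu> \<inter> {0..f n}) \<in> null_sets lborel"
      by (intro null_sets_UN) (use f in \<open>auto simp: A_def null_sets_def\<close>)
    moreover have "{a} \<in> null_sets lborel" by (simp add: null_sets_def)
    moreover have "S \<nu> \<inter> {0..a} \<subseteq> (\<Union>n. S \<nu> \<inter> {0..f n}) \<union> {a}"
    proof
      fix y assume y: "y \<in> S \<nu> \<inter> {0..a}"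
      show "y \<in> (\<Union>n. S \<nu> \<inter> {0..f n}) \<union> {a}"
      proof (cases "y = a")
        case False
        then have "0 < a - y" using y by simp
        then obtain n where "1 / Suc n < a - y" using nat_approx_posE by blast
        then have "y \<le> f n" using f(2)[of n] by simp
        then show ?thesis using y by auto
      qed simp
    qed
    moreover have "S \<nu> \<inter> {0..a} \<in> sets lborel" by simp
    ultimately have "S \<nu> \<inter> {0..a} \<in> null_sets lborel"
      using null_sets_subset[OF null_sets.Un] by blast
    then show ?thesis by (simp add: fp null_sets_def)
  qed
  show "first_point \<nu> \<le> x" if "0 \<le> x" "\<nu> < u x" for x
  proof (rule ccontr)
    assume "\<not> first_point \<nu> \<le> x"
    then obtain a' where a': "a' \<in> A" "x < a'" using gt[of x] fp by auto
    have "emeasure lborel (S \<nu> \<inter> {x..a'}) \<le> emeasure lborel (S \<nu> \<inter> {0..a'})"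
      using that by (intro emeasure_mono) auto
    then show False using S_positive[OF that a'(2)] a'(1) by (simp add: A_def)
  qed
qed

text \<open>Collapsing the hollows moves \<open>x\<close> to \<open>T x\<close>; beyond the maximum, \<open>\<rho> x\<close> is where the tamping
  puts the value at a point \<open>x\<close> outside \<open>H\<close>, after adding the hollow mass above this value.\<close>

definition T :: "real \<Rightarrow> real" where
  "T x = measure lborel ({0..x} - H)"

definition \<rho>_set :: "real \<Rightarrow> real set" where
  "\<rho>_set x = ({0..x} - H) \<union> {z \<in> H. \<forall>w\<ge>x. u w \<le> u z}"

definition \<rho> :: "real \<Rightarrow> real" where
  "\<rho> x = measure lborel (\<rho>_set x)"

section \<open>Growth of \<open>T\<close> and \<open>\<rho>\<close>\<close>

lemma measure_Un_null:
  assumes "A \<in> fmeasurable lborel" "B \<in> fmeasurable lborel" "emeasure lborel (A \<inter> B) = 0"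
  shows "measure lborel (A \<union> B) = measure lborel A + measure lborel B"
  using measure_Un3[OF assms(1,2)] assms(3) by (simp add: measure_def)

lemma T_diff:
  assumes "0 \<le> x" "x \<le> y"
  shows "T y = T x + measure lborel ({x<..y} - H)"
proof -
  have e: "{0..y} - H = ({0..x} - H) \<union> ({x<..y} - H)" using assms by auto
  have d: "({0..x} - H) \<inter> ({x<..y} - H) = {}" by auto
  show ?thesis unfolding T_def e
    by (intro measure_Un_null fmeasurable_Icc_subset[of _ 0 y]) (use assms d in auto)
qed

lemma T_0: "T 0 = 0"
proof -
  have "measure lborel ({0..0} - H) \<le> measure lborel {0::real}"
    by (intro measure_mono_fmeasurable) (auto intro: fmeasurableI)
  then show ?thesis by (simp add: T_def measure_le_0_iff)
qed

lemma T_mono: "0 \<le> x \<Longrightarrow> x \<le> y \<Longrightarrow> T x \<le> T y"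
  using T_diff[of x y] by simp

lemma T_lipschitz:
  assumes "0 \<le> x" "x \<le> y"
  shows "T y \<le> T x + (y - x)"
proof -
  have "measure lborel ({x<..y} - H) \<le> measure lborel {x..y}"
    by (intro measure_mono_fmeasurable fmeasurable_Icc_subset[of _ x y]) auto
  then show ?thesis using T_diff[OF assms] assms by simp
qed

text \<open>Prepares the finiteness of the measure, since \<open>measure\<close> is 0 on sets of
  infinite measure. If the tail supremum \<open>u t\<close> is positive, its superlevel set is
  bounded; if it is 0, no point beyond \<open>x\<close> has a higher value to its right, so
  \<open>H\<close> stops at \<open>x\<close>.\<close>

lemma \<rho>_set_eq:
  assumes "0 \<le> x"
  obtains t where "x \<le> t" "\<rho>_set x = ({0..x} - H) \<union> (H \<inter> S (u t))" "u t = 0 \<Longrightarrow> H \<subseteq> {0..x}"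
proof -
  obtain t where t: "x \<le> t" "\<And>w. x \<le> w \<Longrightarrow> u w \<le> u t" using attains_sup_tail[OF assms] by blast
  have "(\<forall>w\<ge>x. u w \<le> u z) \<longleftrightarrow> u t \<le> u z" for z using t order_trans by blast
  then have "\<rho>_set x = ({0..x} - H) \<union> (H \<inter> S (u t))"
    by (auto simp: \<rho>_set_def S_def dest: H_pos)
  moreover have "H \<subseteq> {0..x}" if "u t = 0"
  proof
    fix z assume z: "z \<in> H"
    then obtain z' where z': "z < z'" "u z < u z'" by (rule H_E)
    have "0 < z" using H_pos[OF z] .
    then have "0 \<le> u z" by (intro nonneg) simp
    then have "\<not> x \<le> z'" using t(2)[of z'] that z' by auto
    then show "z \<in> {0..x}" using z' \<open>0 < z\<close> by simp
  qed
  ultimately show ?thesis using that[OF t(1)] by blast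
qed

lemma \<rho>_set_fmeasurable:
  assumes "0 \<le> x"
  shows "\<rho>_set x \<in> fmeasurable lborel"
proof -
  obtain t where t: "x \<le> t" "\<rho>_set x = ({0..x} - H) \<union> (H \<inter> S (u t))" "u t = 0 \<Longrightarrow> H \<subseteq> {0..x}"
    using \<rho>_set_eq[OF assms] by blast
  have "({0..x} - H) \<in> fmeasurable lborel" by (intro fmeasurable_Icc_subset[of _ 0 x]) auto
  moreover have "H \<inter> S (u t) \<in> fmeasurable lborel"
  proof (cases "u t = 0")
    case True
    then show ?thesis using t(3) by (intro fmeasurable_Icc_subset[of _ 0 x]) auto
  next
    case False
    then have "0 < u t" using nonneg[of t] t(1) assms by simp
    from fmeasurableI2[OF S_fmeasurable[OF this]] show ?thesis by simp
  qed
  ultimately show ?thesis unfolding t(2) by (rule fmeasurable.Un)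
qed

text \<open>As the tail supremum falls, the contribution of \<open>H\<close> can only grow, while
  the part outside \<open>H\<close> grows by exactly the increment of \<open>T\<close>. This is the
  source of the Lipschitz bound for \<open>T \<circ> \<xi>\<close>.\<close>

lemma \<rho>_increment:
  assumes "0 \<le> x" "x \<le> y"
  shows "\<rho> x + (T y - T x) \<le> \<rho> y"
proof -
  have f: "{x<..y} - H \<in> fmeasurable lborel" by (intro fmeasurable_Icc_subset[of _ x y]) auto
  have "\<rho>_set x \<inter> ({x<..y} - H) = {}" by (auto simp: \<rho>_set_def)
  then have "measure lborel (\<rho>_set x \<union> ({x<..y} - H)) = \<rho> x + (T y - T x)"
    unfolding \<rho>_def using measure_Un_null[OF \<rho>_set_fmeasurable[OF assms(1)] f] T_diff[OF assms] by simp
  moreover have "\<rho>_set x \<union> ({x<..y} - H) \<subseteq> \<rho>_set y"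
    using assms by (auto simp: \<rho>_set_def)
  then have "measure lborel (\<rho>_set x \<union> ({x<..y} - H)) \<le> \<rho> y"
    unfolding \<rho>_def using \<rho>_set_fmeasurable[of x] \<rho>_set_fmeasurable[of y] assms f
    by (intro measure_mono_fmeasurable[OF _ fmeasurableD[OF fmeasurable.Un]]) auto
  ultimately show ?thesis by simp
qed

lemma \<rho>_mono: "0 \<le> x \<Longrightarrow> x \<le> y \<Longrightarrow> \<rho> x \<le> \<rho> y"
  using \<rho>_increment[of x y] T_mono[of x y] by simp

text \<open>For \<open>y \<ge> 0\<close> outside \<open>D\<close> below, the set is empty and the value junk; the tamping vanishes there.\<close>

definition \<xi> :: "real \<Rightarrow> real" where
  "\<xi> y = Inf {x. 0 \<le> x \<and> y \<le> \<rho> x}"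

definition D :: "real set" where
  "D = {y. 0 \<le> y \<and> (\<exists>x\<ge>0. y \<le> \<rho> x)}"

section \<open>The generalized inverse of \<open>\<rho>\<close>\<close>

lemma D_I: "0 \<le> y \<Longrightarrow> 0 \<le> x \<Longrightarrow> y \<le> \<rho> x \<Longrightarrow> y \<in> D"
  by (auto simp: D_def)

lemma D_down: "y \<in> D \<Longrightarrow> 0 \<le> y' \<Longrightarrow> y' \<le> y \<Longrightarrow> y' \<in> D"
  by (auto simp: D_def intro: order_trans)

lemma \<rho>_nonneg: "0 \<le> \<rho> x"
  by (simp add: \<rho>_def)

lemma \<xi>_le: "0 \<le> x \<Longrightarrow> y \<le> \<rho> x \<Longrightarrow> \<xi> y \<le> x"
  unfolding \<xi>_def by (rule cInf_lower) (auto intro: bdd_belowI)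

lemma \<xi>_less: "0 \<le> x \<Longrightarrow> x < \<xi> y \<Longrightarrow> \<rho> x < y"
  using \<xi>_le[of x y] by linarith

lemma \<xi>_nonneg: "y \<in> D \<Longrightarrow> 0 \<le> \<xi> y"
  unfolding \<xi>_def D_def by (rule cInf_greatest) auto

text \<open>\<open>\<rho>\<close> may jump at \<open>\<xi> y\<close>, so its value there is left
  open; the estimates below step aside by a small amount and use that \<open>T\<close> is
  1-Lipschitz.\<close>

lemma \<xi>_greater:
  assumes "y \<in> D" "\<xi> y < x"
  shows "y \<le> \<rho> x"
proof -
  have ne: "{x. 0 \<le> x \<and> y \<le> \<rho> x} \<noteq> {}" using assms(1) by (auto simp: D_def)
  have bdd: "bdd_below {x. 0 \<le> x \<and> y \<le> \<rho> x}" by (rule bdd_belowI[of _ 0]) simp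
  have "\<exists>z\<in>{x. 0 \<le> x \<and> y \<le> \<rho> x}. z < x"
    using cInf_less_iff[OF ne bdd, of x] assms(2) by (simp only: \<xi>_def)
  then obtain z where "0 \<le> z" "y \<le> \<rho> z" "z < x" by blast
  then show ?thesis using \<rho>_mono[of z x] by simp
qed

lemma \<xi>_mono:
  assumes "y' \<in> D" "y \<le> y'"
  shows "\<xi> y \<le> \<xi> y'"
  unfolding \<xi>_def using assms by (intro cInf_superset_mono) (auto simp: D_def intro: bdd_belowI)

lemma \<xi>_0: "\<xi> 0 = 0"
  using \<xi>_le[of 0 0] \<xi>_nonneg[of 0] \<rho>_nonneg D_I[of 0 0] by force

lemma T_\<xi>_lipschitz:
  assumes "y \<in> D" "y' \<in> D" "y \<le> y'"
  shows "T (\<xi> y') \<le> T (\<xi> y) + (y' - y)"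
proof (rule field_le_epsilon)
  fix e :: real assume e: "0 < e"
  have n: "0 \<le> \<xi> y" "\<xi> y \<le> \<xi> y'" using \<xi>_nonneg \<xi>_mono assms by auto
  show "T (\<xi> y') \<le> T (\<xi> y) + (y' - y) + e"
  proof (cases "\<xi> y = \<xi> y'")
    case False
    \<comment> \<open>A third of the gap keeps the two shifted points in order, and
      \<open>e / 2\<close> pays for the two shifts.\<close>
    define d where "d = min (e / 2) ((\<xi> y' - \<xi> y) / 3)"
    have d: "0 < d" "2 * d \<le> e" "\<xi> y + d < \<xi> y' - d" using e n False by (auto simp: d_def min_def field_simps)
    have "y \<le> \<rho> (\<xi> y + d)" using \<xi>_greater[OF assms(1)] d by simp
    moreover have "\<rho> (\<xi> y' - d) < y'" using \<xi>_less d n by simp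
    moreover have "T (\<xi> y' - d) - T (\<xi> y + d) \<le> \<rho> (\<xi> y' - d) - \<rho> (\<xi> y + d)"
      using \<rho>_increment[of "\<xi> y + d" "\<xi> y' - d"] d n by simp
    moreover have "T (\<xi> y') \<le> T (\<xi> y' - d) + d" using T_lipschitz[of "\<xi> y' - d" "\<xi> y'"] d n by simp
    moreover have "T (\<xi> y + d) \<le> T (\<xi> y) + d" using T_lipschitz[of "\<xi> y" "\<xi> y + d"] d n by simp
    ultimately show ?thesis using d by linarith
  qed (use assms e in auto)
qed

lemma T_\<xi>_le: "y \<in> D \<Longrightarrow> T (\<xi> y) \<le> y"
  using T_\<xi>_lipschitz[of 0 y] D_down[of y 0] by (auto simp: \<xi>_0 T_0 D_def)

text \<open>\<open>\<xi> (\<rho> x)\<close> may lie strictly before \<open>x\<close>, but then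
  \<open>\<rho>\<close> is constant in between, and by \<open>\<rho>_increment\<close> so is
  \<open>T\<close>.\<close>

lemma T_\<xi>_\<rho>:
  assumes "0 \<le> x"
  shows "T (\<xi> (\<rho> x)) = T x"
proof -
  have D: "\<rho> x \<in> D" using assms \<rho>_nonneg by (auto intro: D_I)
  have le: "0 \<le> \<xi> (\<rho> x)" "\<xi> (\<rho> x) \<le> x" using \<xi>_nonneg[OF D] \<xi>_le assms by auto
  have "T x \<le> T (\<xi> (\<rho> x))"
  proof (rule field_le_epsilon)
    fix e :: real assume e: "0 < e"
    define z where "z = min x (\<xi> (\<rho> x) + e)"
    show "T x \<le> T (\<xi> (\<rho> x)) + e"
    proof (cases "x \<le> \<xi> (\<rho> x) + e")
      case True
      then show ?thesis using T_lipschitz[of "\<xi> (\<rho> x)" x] le by simp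
    next
      case False
      have "\<rho> x \<le> \<rho> (\<xi> (\<rho> x) + e)" using \<xi>_greater[OF D] e by simp
      then have "T x \<le> T (\<xi> (\<rho> x) + e)" using \<rho>_increment[of "\<xi> (\<rho> x) + e" x] False le e by simp
      then show ?thesis using T_lipschitz[of "\<xi> (\<rho> x)" "\<xi> (\<rho> x) + e"] le e by simp
    qed
  qed
  then show ?thesis using T_mono[OF le] by simp
qed

text \<open>A point of \<open>H\<close> counted by \<open>\<rho>\<close> has a higher value to its
  right, which must occur before \<open>x\<close>, where values are at most \<open>\<nu>\<close>;
  but the point itself already reaches the value at \<open>first_point \<nu>\<close>.\<close>

lemma \<rho>_before_first_point:
  assumes "0 < \<nu>" "emeasure lborel (S \<nu>) \<noteq> 0" "0 \<le> x" "x < first_point \<nu>"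
  shows "\<rho> x = T x"
proof -
  note fp = first_point_nonneg[OF assms(1,2)] first_point_le[OF assms(1,2)] first_point_ge[OF assms(1,2)]
  have "{z \<in> H. \<forall>w\<ge>x. u w \<le> u z} = {}"
  proof (safe, simp)
    fix z assume z: "z \<in> H" "\<forall>w\<ge>x. u w \<le> u z"
    obtain z' where z': "z < z'" "u z < u z'" using z(1) by (rule H_E)
    have "\<not> x \<le> z'" using z(2) z'(2) by auto
    moreover have "0 < z" using H_pos[OF z(1)] .
    ultimately have "u z' \<le> \<nu>" using z' assms by (intro fp(2)) auto
    moreover have "u (first_point \<nu>) \<le> u z" using z(2) assms by simp
    ultimately show False using fp(3) z' by simp
  qed
  then show ?thesis unfolding \<rho>_def \<rho>_set_def T_def by (simp only: Un_empty_right)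
qed

text \<open>After the first point everything up to \<open>b\<close> outside \<open>H\<close> has
  value at least \<open>\<nu>\<close>, and the supremum from \<open>b\<close> on is
  \<open>\<nu>\<close>, so the pieces of \<open>\<rho>_set b\<close> recombine to the superlevel
  set. The overlap with the initial piece is null because the first point is an essential
  infimum.\<close>

lemma \<rho>_last_point:
  assumes "0 < \<nu>" "emeasure lborel (S \<nu>) \<noteq> 0" "0 \<le> b" "u b = \<nu>" "\<And>w. b < w \<Longrightarrow> u w < \<nu>"
  shows "\<rho> b = T (first_point \<nu>) + measure lborel (S \<nu>)"
proof -
  define a where "a = first_point \<nu>"
  note fp = first_point_nonneg[OF assms(1,2), folded a_def] first_point_ge[OF assms(1,2), folded a_def]
    first_point_null[OF assms(1,2), folded a_def]
  have ab: "a \<le> b" using assms(5)[of a] fp(2) by (auto simp: not_le[symmetric] intro: ccontr)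
  have tail: "(\<forall>w\<ge>b. u w \<le> u z) \<longleftrightarrow> \<nu> \<le> u z" for z
  proof
    assume "\<nu> \<le> u z"
    then show "\<forall>w\<ge>b. u w \<le> u z" using assms(4) assms(5) by (metis order_le_less order_trans)
  qed (use assms(4) in auto)
  have "\<rho>_set b = ({0..a} - H) \<union> S \<nu>"
  proof (intro set_eqI iffI)
    fix t assume "t \<in> \<rho>_set b"
    then consider "0 \<le> t" "t \<le> b" "t \<notin> H" | "t \<in> H" "\<nu> \<le> u t" by (auto simp: \<rho>_set_def tail)
    then show "t \<in> ({0..a} - H) \<union> S \<nu>"
    proof cases
      case 1
      have "\<nu> \<le> u t" if "a < t"
      proof (rule ccontr)
        assume *: "\<not> \<nu> \<le> u t"
        then have "t \<noteq> b" using assms(4) by auto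
        then have "t \<in> H" using * 1 that fp assms(4) by (intro H_I[of a t b]) auto
        then show False using 1 by simp
      qed
      then show ?thesis using 1 by (cases "a < t") (auto simp: S_def)
    next
      case 2
      then show ?thesis using H_pos[of t] by (simp add: S_def)
    qed
  next
    fix t assume "t \<in> ({0..a} - H) \<union> S \<nu>"
    then consider "t \<in> {0..a} - H" | "0 \<le> t" "\<nu> \<le> u t" by (auto simp: S_def)
    then show "t \<in> \<rho>_set b"
    proof cases
      case 1
      then show ?thesis using ab by (auto simp: \<rho>_set_def)
    next
      case 2
      then have "t \<le> b" using assms(5)[of t] by (auto simp: not_le[symmetric] intro: ccontr)
      then show ?thesis using 2 by (auto simp: \<rho>_set_def tail)
    qed
  qed
  moreover have "emeasure lborel (({0..a} - H) \<inter> S \<nu>) \<le> emeasure lborel (S \<nu> \<inter> {0..a})"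
    by (intro emeasure_mono) auto
  then have "measure lborel (({0..a} - H) \<union> S \<nu>) = measure lborel ({0..a} - H) + measure lborel (S \<nu>)"
    using fp(3) S_fmeasurable[OF assms(1)]
    by (intro measure_Un_null fmeasurable_Icc_subset[of "{0..a} - H" 0 a]) auto
  ultimately show ?thesis by (simp add: \<rho>_def T_def a_def)
qed

end

section \<open>Levels of \<open>W \<circ> \<xi>\<close>\<close>

context decaying_primitive
begin

text \<open>The points outside \<open>H\<close> between \<open>x\<close> and \<open>y\<close> form a
  null set, which the primitive does not see. Thus \<open>W\<close> is a function of
  \<open>T\<close>, and jumps of \<open>\<xi>\<close> over hollows do no harm.\<close>

lemma W_eq_if_T_eq:
  assumes "0 \<le> x" "x \<le> y" "T x = T y"
  shows "W x = W y"
proof -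
  have "measure lborel ({x<..y} - H) = 0" using T_diff[OF assms(1,2)] assms(3) by simp
  moreover have "{x<..y} - H \<in> fmeasurable lborel" by (intro fmeasurable_Icc_subset[of _ x y]) auto
  ultimately have "emeasure lborel ({x<..y} - H) = 0" by (simp add: emeasure_eq_measure2)
  then have null: "{x<..y} - H \<in> null_sets lborel" by (rule null_setsI) simp
  have e: "{0..y} - H = ({0..x} - H) \<union> ({x<..y} - H)" using assms by auto
  have "(LINT t:{0..y} - H|lborel. g t) = (LINT t:{0..x} - H|lborel. g t) + (LINT t:{x<..y} - H|lborel. g t)"
    unfolding e using assms by (intro set_integral_Un g_int_subset[of _ y]) auto
  moreover have "(LINT t:{x<..y} - H|lborel. g t) = 0"
    unfolding set_lebesgue_integral_def
    by (rule integral_eq_zero_AE) (use AE_not_in[OF null] in eventually_elim, simp)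
  ultimately show ?thesis by (simp add: W_def)
qed

text \<open>If \<open>\<xi> y\<close> lies between the first and the last point of the level,
  \<open>W_ge\<close> applies. If it lies before the first point \<open>a\<close>, then
  \<open>\<rho>\<close> equals \<open>T\<close> just to its right, which forces
  \<open>T (\<xi> y) = T a\<close> and so the same value of \<open>W\<close>.\<close>

lemma W_\<xi>_ge:
  assumes "0 < \<nu>" "emeasure lborel (S \<nu>) \<noteq> 0"
    and y: "T (first_point \<nu>) \<le> y" "y \<le> T (first_point \<nu>) + measure lborel (S \<nu>)"
  shows "y \<in> D \<and> \<nu> \<le> W (\<xi> y)"
proof -
  define a where "a = first_point \<nu>"
  note fp = first_point_nonneg[OF assms(1,2), folded a_def] first_point_ge[OF assms(1,2), folded a_def]
  obtain b where b: "a \<le> b" "u b = \<nu>" "\<And>w. b < w \<Longrightarrow> u w < \<nu>"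
    using last_point[OF assms(1) fp] by blast
  have "0 \<le> T a" by (simp add: T_def)
  then have y0: "0 \<le> y" using y by (simp add: a_def)
  have yb: "y \<le> \<rho> b" using \<rho>_last_point[OF assms(1,2) _ b(2,3)] b(1) fp(1) y by simp
  have b0: "0 \<le> b" using b fp by simp
  have D: "y \<in> D" using D_I[OF y0 b0 yb] .
  have \<xi>: "0 \<le> \<xi> y" "\<xi> y \<le> b" using \<xi>_nonneg[OF D] \<xi>_le[OF b0 yb] by auto
  have "\<nu> \<le> W (\<xi> y)"
  proof (cases "a \<le> \<xi> y")
    case True
    then show ?thesis using W_ge[of a "\<xi> y" b \<nu>] fp b \<xi> by simp
  next
    case False
    have "T a \<le> T (\<xi> y)"
    proof (rule field_le_epsilon)
      fix e :: real assume e: "0 < e"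
      \<comment> \<open>Right of \<open>\<xi> y\<close>, so that \<open>y \<le> \<rho> x\<close>,
        and left of \<open>a\<close>, so that \<open>\<rho> x = T x\<close>.\<close>
      define x where "x = \<xi> y + min e ((a - \<xi> y) / 2)"
      have x: "\<xi> y < x" "x \<le> \<xi> y + e" "x < a" using e False by (auto simp: x_def min_def field_simps)
      have "y \<le> \<rho> x" using \<xi>_greater[OF D x(1)] .
      also have "\<rho> x = T x"
        using \<rho>_before_first_point[OF assms(1,2), of x] x \<xi> by (simp add: a_def)
      finally have "T a \<le> T x" using y by (simp add: a_def)
      then show "T a \<le> T (\<xi> y) + e" using T_lipschitz[of "\<xi> y" x] \<xi> x by simp
    qed
    then have "W (\<xi> y) = W a"
      using W_eq_if_T_eq[of "\<xi> y" a] T_mono[of "\<xi> y" a] \<xi> False by simp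
    then show ?thesis using W_ge[of a a b \<nu>] fp b by simp
  qed
  then show ?thesis using D by simp
qed

text \<open>The strict inequality passes to the plateau ends, where it gives positive measure and
  puts the first point at or before \<open>\<alpha>\<close> and the last point strictly after
  \<open>\<xi> y\<close>. Strictness costs nothing, as the tamping is a supremum over
  levels.\<close>

lemma W_\<xi>_greater:
  assumes "0 < \<nu>" "y \<in> D" "\<nu> < W (\<xi> y)"
  shows "emeasure lborel (S \<nu>) \<noteq> 0" "T (first_point \<nu>) \<le> y"
    "y \<le> T (first_point \<nu>) + measure lborel (S \<nu>)"
proof -
  have \<xi>: "0 \<le> \<xi> y" using \<xi>_nonneg assms by simp
  obtain \<alpha> \<beta> where ab: "0 \<le> \<alpha>" "\<alpha> \<le> \<xi> y" "\<xi> y \<le> \<beta>" "W (\<xi> y) = u \<alpha>" "W (\<xi> y) = u \<beta>"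
    by (rule W_plateau[OF \<xi>])
  have gt: "\<nu> < u \<alpha>" "\<nu> < u \<beta>" using assms ab by auto
  have "emeasure lborel (S \<nu> \<inter> {\<alpha>..\<alpha> + 1}) \<le> emeasure lborel (S \<nu>)" by (intro emeasure_mono) auto
  then show S: "emeasure lborel (S \<nu>) \<noteq> 0" using S_positive[OF ab(1) gt(1), of "\<alpha> + 1"] by auto
  have "first_point \<nu> \<le> \<xi> y" using first_point_lower[OF assms(1) S ab(1) gt(1)] ab(2) by simp
  then have "T (first_point \<nu>) \<le> T (\<xi> y)" using first_point_nonneg[OF assms(1) S] by (intro T_mono)
  then show "T (first_point \<nu>) \<le> y" using T_\<xi>_le[OF assms(2)] by simp
  have \<beta>: "0 \<le> \<beta>" "\<nu> \<le> u \<beta>" using ab gt by auto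
  obtain b where b: "\<beta> \<le> b" "u b = \<nu>" "\<And>w. b < w \<Longrightarrow> u w < \<nu>"
    using last_point[OF assms(1) \<beta>] by blast
  have "\<xi> y < b" using b(1,2) gt(2) ab(3) by (cases "\<beta> = b") auto
  then have "y \<le> \<rho> b" by (rule \<xi>_greater[OF assms(2)])
  then show "y \<le> T (first_point \<nu>) + measure lborel (S \<nu>)"
    using \<rho>_last_point[OF assms(1) S _ b(2,3)] b(1) \<beta>(1) by simp
qed

end


section \<open>The weak derivative of the tamping\<close>

lemma emeasure_interval_measure_Ioo:
  assumes mono: "\<And>x y. x \<le> y \<Longrightarrow> F x \<le> F y" and cont: "continuous_on UNIV F" and "a \<le> b"
  shows "emeasure (interval_measure F) {a<..<b} = ennreal (F b - F a)"
proof -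
  have rc: "continuous (at_right x) F" for x
    using cont by (auto simp: continuous_on_eq_continuous_at intro: continuous_at_imp_continuous_within)
  have "{b} \<in> null_sets (interval_measure F)"
    using emeasure_interval_measure_Icc[OF order_refl mono cont, of b] by (simp add: null_sets_def)
  then have "emeasure (interval_measure F) ({a<..b} - {b}) = emeasure (interval_measure F) {a<..b}"
    by (intro emeasure_Diff_null_set) auto
  moreover have "{a<..b} - {b} = {a<..<b}" by auto
  ultimately show ?thesis using emeasure_interval_measure_Ioc[OF \<open>a \<le> b\<close> mono rc] by simp
qed

text \<open>The density of the Stieltjes measure of \<open>F\<close>. This measure and the one of \<open>x - F x\<close> add up to the
  Lebesgue measure, so both are absolutely continuous and the two densities add up to 1.\<close>

lemma lipschitz_density:
  fixes F :: "real \<Rightarrow> real"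
  assumes mono: "\<And>x y. x \<le> y \<Longrightarrow> F x \<le> F y" and lip: "\<And>x y. x \<le> y \<Longrightarrow> F y \<le> F x + (y - x)"
  obtains s where "s \<in> borel_measurable borel" "\<And>x. 0 \<le> s x" "\<And>x. s x \<le> 1"
    "\<And>x y. x \<le> y \<Longrightarrow> (\<integral>\<^sup>+ t. ennreal (s t) * indicator {x<..y} t \<partial>lborel) = ennreal (F y - F x)"
proof -
  have cont: "continuous_on UNIV F"
    unfolding continuous_on_iff
  proof (intro ballI allI impI)
    fix x e :: real assume "0 < e"
    have "dist (F x') (F x) < e" if "dist x' x < e" for x'
      using that mono[of x x'] mono[of x' x] lip[of x x'] lip[of x' x]
      by (cases "x \<le> x'") (auto simp: dist_real_def abs_less_iff)
    then show "\<exists>d>0. \<forall>x'\<in>UNIV. dist x' x < d \<longrightarrow> dist (F x') (F x) < e" using \<open>0 < e\<close> by blast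
  qed
  define G where "G x = x - F x" for x
  have monoG: "x \<le> y \<Longrightarrow> G x \<le> G y" for x y using lip[of x y] by (simp add: G_def)
  have contG: "continuous_on UNIV G" unfolding G_def by (intro continuous_intros cont)
  define M1 where "M1 = interval_measure F"
  define M2 where "M2 = interval_measure G"
  have sets [simp, measurable_cong]: "sets M1 = sets borel" "sets M2 = sets borel"
    by (auto simp: M1_def M2_def)
  define N where "N = measure_of UNIV (sets borel) (\<lambda>A. emeasure M1 A + emeasure M2 A)"
  have N: "emeasure N A = emeasure M1 A + emeasure M2 A" if "A \<in> sets borel" for A
    unfolding N_def
  proof (rule emeasure_measure_of_sigma)
    show "sigma_algebra UNIV (sets borel :: real set set)"
      using sets.sigma_algebra_axioms[of "borel :: real measure"] by simp
    show "positive (sets borel) (\<lambda>A. emeasure M1 A + emeasure M2 A)" by (simp add: positive_def)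
    show "countably_additive (sets borel) (\<lambda>A. emeasure M1 A + emeasure M2 A)"
      unfolding countably_additive_def
    proof (intro allI impI)
      fix A :: "nat \<Rightarrow> real set" assume A: "range A \<subseteq> sets borel" "disjoint_family A"
      have "(\<Sum>i. emeasure M1 (A i) + emeasure M2 (A i)) = (\<Sum>i. emeasure M1 (A i)) + (\<Sum>i. emeasure M2 (A i))"
        by (rule suminf_add[symmetric]) auto
      then show "(\<Sum>i. emeasure M1 (A i) + emeasure M2 (A i)) = emeasure M1 (\<Union> (range A)) + emeasure M2 (\<Union> (range A))"
        using A by (simp add: suminf_emeasure)
    qed
  qed fact
  have "lborel = N"
  proof (rule lborel_eqI)
    fix l u :: real assume "\<And>b. b \<in> Basis \<Longrightarrow> l \<bullet> b \<le> u \<bullet> b"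
    then have lu: "l \<le> u" by simp
    have "emeasure N (box l u) = ennreal (F u - F l) + ennreal (G u - G l)"
      using lu by (simp add: N M1_def M2_def box_real emeasure_interval_measure_Ioo mono cont monoG contG)
    also have "\<dots> = ennreal (u - l)"
      using mono[OF lu] monoG[OF lu] by (simp add: G_def flip: ennreal_plus)
    finally show "emeasure N (box l u) = (\<Prod>b\<in>Basis. (u - l) \<bullet> b)" by simp
  qed (use sets.sigma_sets_eq[of "borel :: real measure"] in \<open>simp add: N_def\<close>)
  then have sum: "emeasure lborel A = emeasure M1 A + emeasure M2 A" if "A \<in> sets borel" for A
    using N[OF that] by simp
  have "absolutely_continuous lborel M1" "absolutely_continuous lborel M2"
    by (auto simp: absolutely_continuous_def null_sets_def sum)
  then obtain f1 f2 where f [measurable]: "f1 \<in> borel_measurable lborel" "f2 \<in> borel_measurable lborel"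
    and d: "density lborel f1 = M1" "density lborel f2 = M2"
    using sigma_finite_measure.Radon_Nikodym[OF sigma_finite_lborel, of M1]
      sigma_finite_measure.Radon_Nikodym[OF sigma_finite_lborel, of M2] by auto
  have "density lborel (\<lambda>x. f1 x + f2 x) = density lborel (\<lambda>_. 1)"
  proof (rule measure_eqI)
    fix A assume "A \<in> sets (density lborel (\<lambda>x. f1 x + f2 x))"
    then have A [measurable]: "A \<in> sets borel" by simp
    have "emeasure (density lborel (\<lambda>x. f1 x + f2 x)) A
        = (\<integral>\<^sup>+ x. f1 x * indicator A x + f2 x * indicator A x \<partial>lborel)"
      by (simp add: emeasure_density distrib_right)
    also have "\<dots> = emeasure M1 A + emeasure M2 A"
      by (simp add: nn_integral_add d[symmetric] emeasure_density)
    finally show "emeasure (density lborel (\<lambda>x. f1 x + f2 x)) A = emeasure (density lborel (\<lambda>_. 1)) A"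
      by (simp add: sum[OF A, symmetric] emeasure_density)
  qed simp
  then have "AE x in lborel. f1 x + f2 x = 1"
    by (intro sigma_finite_measure.density_unique[OF sigma_finite_lborel]) auto
  then have le1: "AE x in lborel. f1 x \<le> 1"
  proof eventually_elim
    case (elim x)
    have "f1 x \<le> f1 x + f2 x" by simp
    then show ?case using elim by simp
  qed
  \<comment> \<open>Capping at 1 alters \<open>f1\<close> only on a null set and makes the bounds
    hold at every point.\<close>
  define s where "s x = enn2real (min 1 (f1 x))" for x
  have s: "ennreal (s x) = min 1 (f1 x)" for x
    unfolding s_def by (intro ennreal_enn2real) (auto simp: min_less_iff_disj)
  have "(\<integral>\<^sup>+ t. ennreal (s t) * indicator {x<..y} t \<partial>lborel) = ennreal (F y - F x)" if "x \<le> y" for x y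
  proof -
    have "(\<integral>\<^sup>+ t. ennreal (s t) * indicator {x<..y} t \<partial>lborel) = (\<integral>\<^sup>+ t. f1 t * indicator {x<..y} t \<partial>lborel)"
      by (intro nn_integral_cong_AE, use le1 in eventually_elim) (simp add: s min_absorb2)
    also have "\<dots> = emeasure M1 {x<..y}" by (simp add: d(1)[symmetric] emeasure_density)
    also have "\<dots> = ennreal (F y - F x)"
      unfolding M1_def using cont that
      by (intro emeasure_interval_measure_Ioc mono)
         (auto simp: continuous_on_eq_continuous_at intro: continuous_at_imp_continuous_within)
    finally show ?thesis .
  qed
  moreover have "s x \<le> 1" for x
  proof -
    have "ennreal (s x) \<le> 1" by (simp add: s)
    then show ?thesis by simp
  qed
  moreover have "s \<in> borel_measurable borel" unfolding s_def[abs_def] by measurable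
  moreover have "0 \<le> s x" for x by (simp add: s_def)
  ultimately show ?thesis using that by blast
qed

section \<open>The Lipschitz function \<open>T \<circ> \<xi>\<close> extended to the line\<close>

context decaying
begin

lemma is_interval_D: "is_interval D"
  unfolding is_interval_1 using D_down by (metis (mono_tags, lifting) D_def mem_Collect_eq order_trans)

lemma D_borel [measurable]: "D \<in> sets borel"
  using is_interval_D by (rule real_interval_borel_measurable)

lemma \<xi>_borel: "(\<lambda>y. indicator D y * \<xi> y) \<in> borel_measurable borel"
proof -
  have "mono_on D \<xi>" using \<xi>_mono by (auto simp: mono_on_def)
  then have "\<xi> \<in> borel_measurable (restrict_space borel D)" by (rule borel_measurable_mono_on_fnc)
  then show ?thesis by (simp add: borel_measurable_restrict_space_iff mult.commute)
qed

text \<open>An extension of \<open>T \<circ> \<xi>\<close> from \<open>D\<close> that stays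
  nondecreasing and 1-Lipschitz: the supremum makes it constant beyond \<open>D\<close>, and
  \<open>max 0 y\<close> makes it constant on the negative axis.\<close>

definition \<sigma> :: "real \<Rightarrow> real" where
  "\<sigma> y = (SUP y'\<in>D \<inter> {..max 0 y}. T (\<xi> y'))"

lemma zero_in_D: "0 \<in> D"
  using D_I[of 0 0] \<rho>_nonneg by simp

lemma D_nonneg: "y \<in> D \<Longrightarrow> 0 \<le> y"
  by (simp add: D_def)

lemma T_\<xi>_mono: "y' \<in> D \<Longrightarrow> 0 \<le> y \<Longrightarrow> y \<le> y' \<Longrightarrow> T (\<xi> y) \<le> T (\<xi> y')"
  using \<xi>_mono[of y' y] \<xi>_nonneg[OF D_down, of y' y] by (intro T_mono) auto

lemma \<sigma>_bdd: "bdd_above ((\<lambda>y'. T (\<xi> y')) ` (D \<inter> {..y}))"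
  using T_\<xi>_le by (intro bdd_aboveI[of _ y]) force

lemma \<sigma>_nonempty: "D \<inter> {..max 0 y} \<noteq> {}"
  using zero_in_D by auto

lemma \<sigma>_eq:
  assumes "y \<in> D"
  shows "\<sigma> y = T (\<xi> y)"
  unfolding \<sigma>_def
proof (rule antisym)
  show "(SUP y'\<in>D \<inter> {..max 0 y}. T (\<xi> y')) \<le> T (\<xi> y)"
    using assms D_nonneg by (intro cSUP_least \<sigma>_nonempty T_\<xi>_mono) auto
  show "T (\<xi> y) \<le> (SUP y'\<in>D \<inter> {..max 0 y}. T (\<xi> y'))"
    using assms by (intro cSUP_upper \<sigma>_bdd) auto
qed

lemma \<sigma>_mono: "x \<le> y \<Longrightarrow> \<sigma> x \<le> \<sigma> y"
  unfolding \<sigma>_def by (intro cSUP_subset_mono \<sigma>_nonempty \<sigma>_bdd) auto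

lemma \<sigma>_lipschitz:
  assumes "x \<le> y"
  shows "\<sigma> y \<le> \<sigma> x + (y - x)"
  unfolding \<sigma>_def[of y]
proof (intro cSUP_least \<sigma>_nonempty)
  fix y' assume y': "y' \<in> D \<inter> {..max 0 y}"
  \<comment> \<open>The point nearest to \<open>y'\<close> among those that enter the supremum for
    \<open>x\<close>.\<close>
  let ?z = "min y' (max 0 x)"
  have z: "?z \<in> D" using D_down[of y' ?z] y' D_nonneg by auto
  have "T (\<xi> y') \<le> T (\<xi> ?z) + (y' - ?z)" using T_\<xi>_lipschitz[OF z, of y'] y' by simp
  also have "T (\<xi> ?z) \<le> \<sigma> x" unfolding \<sigma>_def using z by (intro cSUP_upper \<sigma>_bdd) auto
  also have "y' - ?z \<le> y - x" using y' assms by auto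
  finally show "T (\<xi> y') \<le> \<sigma> x + (y - x)" by simp
qed

end


text \<open>The elementary bound \<open>r \<le> 1 + r powr p\<close> suffices on intervals of finite
  length.\<close>

lemma set_integrable_if_powr:
  fixes f :: "real \<Rightarrow> real"
  assumes "1 \<le> p" and f [measurable]: "f \<in> borel_measurable borel"
    and fin: "(\<integral>\<^sup>+ x. ennreal (\<bar>f x\<bar> powr p) * indicator {0..} x \<partial>lborel) < \<infinity>"
  shows "set_integrable lborel {0..b} f"
  unfolding set_integrable_def
proof (rule integrableI_bounded)
  have le: "r \<le> 1 + r powr p" if "0 \<le> r" for r :: real
  proof (cases "r \<le> 1")
    case False
    then have "r powr 1 \<le> r powr p" using assms(1) by (intro powr_mono) auto
    then show ?thesis using False by simp
  qed (use powr_ge_zero[of r p] in linarith)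
  have "(\<integral>\<^sup>+ x. ennreal (norm (indicator {0..b} x *\<^sub>R f x)) \<partial>lborel)
      \<le> (\<integral>\<^sup>+ x. indicator {0..b} x + ennreal (\<bar>f x\<bar> powr p) * indicator {0..} x \<partial>lborel)"
  proof (rule nn_integral_mono)
    fix x :: real
    show "ennreal (norm (indicator {0..b} x *\<^sub>R f x)) \<le> indicator {0..b} x + ennreal (\<bar>f x\<bar> powr p) * indicator {0..} x"
    proof (cases "x \<in> {0..b}")
      case True
      have "ennreal \<bar>f x\<bar> \<le> ennreal (1 + \<bar>f x\<bar> powr p)" using le[of "\<bar>f x\<bar>"] by (intro ennreal_leI) simp
      then show ?thesis using True by (simp add: ennreal_plus)
    qed simp
  qed
  also have "\<dots> = emeasure lborel {0..b} + (\<integral>\<^sup>+ x. ennreal (\<bar>f x\<bar> powr p) * indicator {0..} x \<partial>lborel)"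
    by (subst nn_integral_add) auto
  also have "\<dots> < \<infinity>" using fin by (simp add: emeasure_lborel_Icc_eq)
  finally show "(\<integral>\<^sup>+ x. ennreal (norm (indicator {0..b} x *\<^sub>R f x)) \<partial>lborel) < \<infinity>" .
qed simp

section \<open>Transport of measure by \<open>\<xi>\<close>\<close>

context decaying
begin

lemma density_exists:
  "\<exists>s. s \<in> borel_measurable borel \<and> (\<forall>x. 0 \<le> s x) \<and> (\<forall>x. s x \<le> 1) \<and>
    (\<forall>x y. x \<le> y \<longrightarrow> (\<integral>\<^sup>+ t. ennreal (s t) * indicator {x<..y} t \<partial>lborel) = ennreal (\<sigma> y - \<sigma> x))"
  using lipschitz_density[of \<sigma>, OF \<sigma>_mono \<sigma>_lipschitz] by metis

definition s :: "real \<Rightarrow> real" where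
  "s = (SOME s. s \<in> borel_measurable borel \<and> (\<forall>x. 0 \<le> s x) \<and> (\<forall>x. s x \<le> 1) \<and>
    (\<forall>x y. x \<le> y \<longrightarrow> (\<integral>\<^sup>+ t. ennreal (s t) * indicator {x<..y} t \<partial>lborel) = ennreal (\<sigma> y - \<sigma> x)))"

lemma s_borel [measurable]: "s \<in> borel_measurable borel"
  and s_nonneg: "0 \<le> s x"
  and s_le_1: "s x \<le> 1"
  and s_integral: "x \<le> y \<Longrightarrow> (\<integral>\<^sup>+ t. ennreal (s t) * indicator {x<..y} t \<partial>lborel) = ennreal (\<sigma> y - \<sigma> x)"
  using someI_ex[OF density_exists, folded s_def] by blast+

text \<open>\<open>\<xi>\<close> is known to be monotone, hence Borel, on \<open>D\<close> only; the
  factor extends it by 0 to a Borel function on the line.\<close>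

definition \<Xi> :: "real \<Rightarrow> real" where
  "\<Xi> y = indicator D y * \<xi> y"

lemma \<Xi>_borel [measurable]: "\<Xi> \<in> borel_measurable borel"
  unfolding \<Xi>_def[abs_def] by (rule \<xi>_borel)

lemma emeasure_outside_H:
  assumes "0 \<le> x" "x \<le> z"
  shows "emeasure lborel (({0..z} - H) \<inter> {x<..}) = ennreal (T z - T x)"
proof -
  have "({0..z} - H) \<inter> {x<..} = {x<..z} - H" using assms by auto
  moreover have "{x<..z} - H \<in> fmeasurable lborel" by (intro fmeasurable_Icc_subset[of _ x z]) auto
  ultimately show ?thesis using T_diff[OF assms] by (simp add: emeasure_eq_measure2)
qed

text \<open>By monotonicity of \<open>\<xi>\<close> the set of \<open>y\<close> is the interval from
  \<open>c\<close> to \<open>y0\<close>, up to the point \<open>c\<close>. Even if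
  \<open>\<xi>\<close> jumps past \<open>x\<close> at \<open>c\<close>, the continuity of
  \<open>T \<circ> \<xi>\<close> gives \<open>T (\<xi> c) = T x\<close>, so the mass is an increment
  of \<open>\<sigma>\<close>.\<close>

lemma push_forward_tail:
  assumes "y0 \<in> D" "0 \<le> x" "x < \<xi> y0"
  shows "(\<integral>\<^sup>+ y. ennreal (s y) * indicator ({0<..y0} \<inter> \<Xi> -` {x<..}) y \<partial>lborel) = ennreal (T (\<xi> y0) - T x)"
proof -
  define A where "A = {y. 0 \<le> y \<and> y \<le> y0 \<and> \<xi> y \<le> x}"
  define c where "c = Sup A"
  have A0: "0 \<in> A" using D_nonneg[OF assms(1)] assms by (simp add: A_def \<xi>_0)
  have bdd: "bdd_above A" by (auto simp: A_def)
  have "0 \<le> c" unfolding c_def by (rule cSup_upper[OF A0 bdd])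
  moreover have "c \<le> y0" unfolding c_def
  proof (rule cSup_least)
    show "A \<noteq> {}" using A0 by blast
  qed (simp add: A_def)
  ultimately have c: "0 \<le> c" "c \<le> y0" .
  have cD: "c \<in> D" using D_down[OF assms(1)] c by simp
  have in_D: "y \<in> D" if "0 \<le> y" "y \<le> y0" for y using D_down[OF assms(1)] that by simp
  have above: "x < \<xi> y" if "c < y" "y \<le> y0" for y
  proof (rule ccontr)
    assume "\<not> x < \<xi> y"
    then have "y \<in> A" using that c by (simp add: A_def)
    then show False using cSup_upper[OF _ bdd, of y] that by (simp add: c_def)
  qed
  have below: "\<xi> y \<le> x" if "0 \<le> y" "y < c" for y
  proof -
    have "\<exists>z\<in>A. y < z" using less_cSup_iff[OF _ bdd, of y] that A0 by (auto simp: c_def)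
    then obtain z where z: "z \<in> A" "y < z" by blast
    then have "z \<in> D" using in_D by (simp add: A_def)
    then show ?thesis using \<xi>_mono[of z y] z by (simp add: A_def)
  qed
  have "T (\<xi> c) = T x"
  proof (rule antisym)
    show "T (\<xi> c) \<le> T x"
    proof (rule field_le_epsilon)
      fix e :: real assume e: "0 < e"
      have "\<exists>z\<in>A. c - e < z" using less_cSup_iff[OF _ bdd, of "c - e"] A0 e by (auto simp: c_def)
      then obtain z where z: "z \<in> A" "c - e < z" by blast
      have zc: "z \<le> c" using cSup_upper[OF z(1) bdd] by (simp add: c_def)
      have zD: "z \<in> D" using z(1) in_D by (simp add: A_def)
      have "T (\<xi> z) \<le> T x" using z(1) \<xi>_nonneg[OF zD] by (intro T_mono) (auto simp: A_def)
      then show "T (\<xi> c) \<le> T x + e" using T_\<xi>_lipschitz[OF zD cD zc] z(2) by simp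
    qed
    show "T x \<le> T (\<xi> c)"
    proof (rule field_le_epsilon)
      fix e :: real assume e: "0 < e"
      show "T x \<le> T (\<xi> c) + e"
      proof (cases "c = y0")
        case True
        then show ?thesis using T_mono[of x "\<xi> y0"] assms e by simp
      next
        case False
        define y where "y = min y0 (c + e)"
        have y: "c < y" "y \<le> y0" "y \<le> c + e" using False c e by (auto simp: y_def)
        have "T x \<le> T (\<xi> y)" using above[OF y(1,2)] assms(2) by (intro T_mono) auto
        also have "\<dots> \<le> T (\<xi> c) + (y - c)"
          using T_\<xi>_lipschitz[OF cD in_D, of y] y c by simp
        finally show ?thesis using y by simp
      qed
    qed
  qed
  moreover have "(\<integral>\<^sup>+ y. ennreal (s y) * indicator ({0<..y0} \<inter> \<Xi> -` {x<..}) y \<partial>lborel)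
      = (\<integral>\<^sup>+ y. ennreal (s y) * indicator {c<..y0} y \<partial>lborel)"
  proof (rule nn_integral_cong_AE)
    show "AE y in lborel. ennreal (s y) * indicator ({0<..y0} \<inter> \<Xi> -` {x<..}) y = ennreal (s y) * indicator {c<..y0} y"
      using AE_lborel_singleton[of c]
    proof eventually_elim
      case (elim y)
      have "y \<in> {0<..y0} \<inter> \<Xi> -` {x<..} \<longleftrightarrow> y \<in> {c<..y0}"
      proof (cases "y \<in> {0<..y0}")
        case True
        then have "\<Xi> y = \<xi> y" using in_D[of y] by (simp add: \<Xi>_def)
        then show ?thesis using True above[of y] below[of y] elim by (cases "c < y") auto
      next
        case False
        then show ?thesis using c by auto
      qed
      then show ?case by (simp add: indicator_def)
    qed
  qed
  ultimately show ?thesis using s_integral[OF c(2)] \<sigma>_eq[OF cD] \<sigma>_eq[OF assms(1)] by simp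
qed

text \<open>Measures that are finite on all half-lines \<open>{x<..}\<close> and agree there are
  equal. For \<open>x < 0\<close> this compares total masses, and from \<open>\<xi> y0\<close> on
  both sides are 0.\<close>

lemma push_forward:
  assumes "y0 \<in> D"
  shows "distr (density lborel (\<lambda>y. ennreal (s y * indicator {0<..y0} y))) borel \<Xi>
    = density lborel (\<lambda>x. ennreal (indicator ({0..\<xi> y0} - H) x))"
    (is "?L = ?R")
proof (rule measure_eqI_lessThan)
  have \<xi>0: "0 \<le> \<xi> y0" using \<xi>_nonneg assms by simp
  have L: "emeasure ?L {x<..} = (\<integral>\<^sup>+ y. ennreal (s y) * indicator ({0<..y0} \<inter> \<Xi> -` {x<..}) y \<partial>lborel)" for x
    by (subst emeasure_distr, simp, simp, subst emeasure_density)
       (auto intro!: nn_integral_cong measurable_sets_borel[OF \<Xi>_borel] simp: indicator_def)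
  have R: "emeasure ?R {x<..} = emeasure lborel (({0..\<xi> y0} - H) \<inter> {x<..})" for x
  proof -
    have "emeasure ?R {x<..} = (\<integral>\<^sup>+ y. indicator (({0..\<xi> y0} - H) \<inter> {x<..}) y \<partial>lborel)"
      by (subst emeasure_density, simp, simp, rule nn_integral_cong) (simp add: indicator_def)
    also have "\<dots> = emeasure lborel (({0..\<xi> y0} - H) \<inter> {x<..})"
      by (rule nn_integral_indicator) simp
    finally show ?thesis .
  qed
  fix x :: real
  consider "x < 0" | "0 \<le> x" "x < \<xi> y0" | "0 \<le> x" "\<xi> y0 \<le> x" by linarith
  then show "emeasure ?L {x<..} = emeasure ?R {x<..}"
  proof cases
    case 1
    have "x < \<Xi> y" for y
      using 1 \<xi>_nonneg[of y] by (cases "y \<in> D") (auto simp: \<Xi>_def)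
    then have "({0<..y0} \<inter> \<Xi> -` {x<..}) = {0<..y0}" by auto
    then have "emeasure ?L {x<..} = ennreal (T (\<xi> y0))"
      using s_integral[OF D_nonneg[OF assms]] \<sigma>_eq[OF assms] \<sigma>_eq[OF zero_in_D]
      by (simp add: L \<xi>_0 T_0)
    moreover have "({0..\<xi> y0} - H) \<inter> {x<..} = {0..\<xi> y0} - H" using 1 by auto
    moreover have "{0..\<xi> y0} - H \<in> fmeasurable lborel" by (intro fmeasurable_Icc_subset[of _ 0 "\<xi> y0"]) auto
    ultimately show ?thesis by (simp add: R T_def emeasure_eq_measure2)
  next
    case 2
    then show ?thesis using push_forward_tail[OF assms 2] emeasure_outside_H[of x "\<xi> y0"] by (simp add: L R)
  next
    case 3
    have "\<Xi> y \<le> x" if "y \<in> {0<..y0}" for y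
      using \<xi>_mono[OF assms, of y] 3 that by (cases "y \<in> D") (auto simp: \<Xi>_def)
    then have "{0<..y0} \<inter> \<Xi> -` {x<..} = {}" by (auto simp: not_less[symmetric])
    moreover have "({0..\<xi> y0} - H) \<inter> {x<..} = {}" using 3 by auto
    ultimately show ?thesis by (simp only: L R) simp
  qed
next
  fix x :: real
  have "emeasure ?L {x<..} \<le> (\<integral>\<^sup>+ y. ennreal (s y * indicator {0<..y0} y) \<partial>lborel)"
    by (subst emeasure_distr, simp, simp, subst emeasure_density)
       (auto intro!: nn_integral_mono measurable_sets_borel[OF \<Xi>_borel] simp: indicator_def)
  also have "\<dots> = (\<integral>\<^sup>+ y. ennreal (s y) * indicator {0<..y0} y \<partial>lborel)"
    by (intro nn_integral_cong) (simp add: indicator_def)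
  also have "\<dots> < \<infinity>" by (simp add: s_integral[OF D_nonneg[OF assms]])
  finally show "emeasure ?L {x<..} < \<infinity>" .
qed auto

lemma transport_nn_integral:
  assumes "y0 \<in> D" and k [measurable]: "k \<in> borel_measurable borel"
  shows "(\<integral>\<^sup>+ y. ennreal (s y * indicator {0<..y0} y) * k (\<Xi> y) \<partial>lborel)
    = (\<integral>\<^sup>+ x. ennreal (indicator ({0..\<xi> y0} - H) x) * k x \<partial>lborel)"
proof -
  have "(\<integral>\<^sup>+ y. ennreal (s y * indicator {0<..y0} y) * k (\<Xi> y) \<partial>lborel)
      = (\<integral>\<^sup>+ x. k x \<partial>distr (density lborel (\<lambda>y. ennreal (s y * indicator {0<..y0} y))) borel \<Xi>)"
    by (subst nn_integral_distr) (auto simp: nn_integral_density)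
  also have "\<dots> = (\<integral>\<^sup>+ x. ennreal (indicator ({0..\<xi> y0} - H) x) * k x \<partial>lborel)"
    unfolding push_forward[OF assms(1)] by (subst nn_integral_density) auto
  finally show ?thesis .
qed

lemma transport_integral:
  fixes k :: "real \<Rightarrow> real"
  assumes "y0 \<in> D" and k [measurable]: "k \<in> borel_measurable borel"
  shows "(LINT y|lborel. (s y * indicator {0<..y0} y) * k (\<Xi> y)) = (LINT x:{0..\<xi> y0} - H|lborel. k x)"
proof -
  have "(LINT y|lborel. (s y * indicator {0<..y0} y) * k (\<Xi> y))
      = (LINT x|distr (density lborel (\<lambda>y. ennreal (s y * indicator {0<..y0} y))) borel \<Xi>. k x)"
    by (subst integral_distr) (auto simp: integral_density s_nonneg)
  also have "\<dots> = (LINT x:{0..\<xi> y0} - H|lborel. k x)"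
    unfolding push_forward[OF assms(1)] set_lebesgue_integral_def by (subst integral_density) auto
  finally show ?thesis .
qed

text \<open>\<open>D\<close> may be unbounded or lack a largest element, so integrals over it are
  reached along the points \<open>\<rho> (real n)\<close>.\<close>

lemma D_exhaustion: "y \<in> D \<Longrightarrow> \<forall>\<^sub>F n in sequentially. y \<le> \<rho> (real n)"
proof -
  assume "y \<in> D"
  then obtain x where x: "0 \<le> x" "y \<le> \<rho> x" by (auto simp: D_def)
  have "\<forall>\<^sub>F n in sequentially. x \<le> real n" using eventually_ge_at_top[of "nat \<lceil>x\<rceil>"] by eventually_elim linarith
  then show ?thesis by eventually_elim (use x \<rho>_mono order_trans in blast)
qed

lemma \<rho>_in_D: "0 \<le> x \<Longrightarrow> \<rho> x \<in> D"
  using D_I[OF \<rho>_nonneg] by blast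

end

section \<open>The derivative of the tamping and its \<open>L^p\<close> bound\<close>

locale decaying_Lp = decaying_primitive +
  fixes p :: real
  assumes p: "1 \<le> p"
    and g_p: "(\<integral>\<^sup>+ x. ennreal (\<bar>g x\<bar> powr p) * indicator {0..} x \<partial>lborel) < \<infinity>"
begin

definition h :: "real \<Rightarrow> real" where
  "h y = indicator D y * (s y * g (\<Xi> y))"

lemma h_borel [measurable]: "h \<in> borel_measurable borel"
  unfolding h_def[abs_def] by measurable

lemma h_powr_le: "\<bar>h y\<bar> powr p \<le> s y * \<bar>g (\<Xi> y)\<bar> powr p"
proof (cases "y \<in> D")
  case True
  have "s y powr p \<le> s y powr 1" using p s_nonneg s_le_1 by (intro powr_mono') auto
  then have "s y powr p \<le> s y" using s_nonneg[of y] by simp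
  then show ?thesis using True
    by (simp add: h_def abs_mult powr_mult s_nonneg mult_right_mono)
qed (simp add: h_def s_nonneg)

text \<open>Transport is available up to points of \<open>D\<close> only, so it is applied up to
  \<open>\<rho> (real n)\<close> and followed by monotone convergence; outside \<open>D\<close> the
  function \<open>h\<close> vanishes.\<close>

lemma h_Lp_bound:
  "(\<integral>\<^sup>+ y. ennreal (\<bar>h y\<bar> powr p) * indicator {0..} y \<partial>lborel)
    \<le> (\<integral>\<^sup>+ x. ennreal (\<bar>g x\<bar> powr p) * indicator ({0..} - H) x \<partial>lborel)"
proof -
  let ?f = "\<lambda>n y. ennreal (\<bar>h y\<bar> powr p) * indicator {0<..\<rho> (real n)} y"
  have "(\<integral>\<^sup>+ y. ennreal (\<bar>h y\<bar> powr p) * indicator {0..} y \<partial>lborel) = (\<integral>\<^sup>+ y. (SUP n. ?f n y) \<partial>lborel)"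
  proof (rule nn_integral_cong_AE)
    show "AE y in lborel. ennreal (\<bar>h y\<bar> powr p) * indicator {0..} y = (SUP n. ?f n y)"
      using AE_lborel_singleton[of 0]
    proof eventually_elim
      case (elim y)
      show ?case
      proof (rule antisym)
        show "ennreal (\<bar>h y\<bar> powr p) * indicator {0..} y \<le> (SUP n. ?f n y)"
        proof (cases "y \<in> D")
          case True
          then obtain n where "y \<le> \<rho> (real n)" using D_exhaustion by (auto simp: eventually_sequentially)
          then have "ennreal (\<bar>h y\<bar> powr p) * indicator {0..} y = ?f n y"
            using True D_nonneg[OF True] elim by (simp add: indicator_def)
          then show ?thesis by (rule ord_eq_le_trans) (rule SUP_upper, simp)
        next
          case False
          then show ?thesis by (simp add: h_def)
        qed
        show "(SUP n. ?f n y) \<le> ennreal (\<bar>h y\<bar> powr p) * indicator {0..} y"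
          by (intro SUP_least mult_left_mono) (auto simp: indicator_def)
      qed
    qed
  qed
  also have "\<dots> = (SUP n. \<integral>\<^sup>+ y. ?f n y \<partial>lborel)"
  proof (rule nn_integral_monotone_convergence_SUP)
    have "\<rho> (real m) \<le> \<rho> (real n)" if "m \<le> n" for m n using that by (intro \<rho>_mono) auto
    then show "incseq ?f"
      by (intro monoI le_funI mult_left_mono) (auto simp: indicator_def intro: order_trans)
  qed auto
  also have "\<dots> \<le> (\<integral>\<^sup>+ x. ennreal (\<bar>g x\<bar> powr p) * indicator ({0..} - H) x \<partial>lborel)"
  proof (rule SUP_least)
    fix n
    let ?y = "\<rho> (real n)"
    have "(\<integral>\<^sup>+ y. ?f n y \<partial>lborel) \<le> (\<integral>\<^sup>+ y. ennreal (s y * indicator {0<..?y} y) * ennreal (\<bar>g (\<Xi> y)\<bar> powr p) \<partial>lborel)"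
      using h_powr_le s_nonneg
      by (intro nn_integral_mono) (auto simp: indicator_def simp flip: ennreal_mult intro!: ennreal_leI)
    also have "\<dots> = (\<integral>\<^sup>+ x. ennreal (indicator ({0..\<xi> ?y} - H) x) * ennreal (\<bar>g x\<bar> powr p) \<partial>lborel)"
      by (rule transport_nn_integral[OF \<rho>_in_D]) auto
    also have "\<dots> \<le> (\<integral>\<^sup>+ x. ennreal (\<bar>g x\<bar> powr p) * indicator ({0..} - H) x \<partial>lborel)"
      by (intro nn_integral_mono) (auto simp: indicator_def)
    finally show "(\<integral>\<^sup>+ y. ?f n y \<partial>lborel) \<le> (\<integral>\<^sup>+ x. ennreal (\<bar>g x\<bar> powr p) * indicator ({0..} - H) x \<partial>lborel)" .
  qed
  finally show ?thesis .
qed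

lemma h_Lp: "(\<integral>\<^sup>+ y. ennreal (\<bar>h y\<bar> powr p) * indicator {0..} y \<partial>lborel) < \<infinity>"
proof -
  have "(\<integral>\<^sup>+ x. ennreal (\<bar>g x\<bar> powr p) * indicator ({0..} - H) x \<partial>lborel)
      \<le> (\<integral>\<^sup>+ x. ennreal (\<bar>g x\<bar> powr p) * indicator {0..} x \<partial>lborel)"
    by (intro nn_integral_mono) (auto simp: indicator_def)
  then show ?thesis using h_Lp_bound g_p by (meson le_less_trans order_trans)
qed

lemma h_integrable: "set_integrable lborel {0..b} h"
  by (rule set_integrable_if_powr[OF p h_borel h_Lp])

text \<open>The chain rule for \<open>W \<circ> \<xi>\<close> in integrated form, obtained by
  transport instead of differentiation.\<close>

lemma h_integral_in_D:
  assumes "y \<in> D"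
  shows "u 0 + (LINT t:{0..y}|lborel. h t) = W (\<xi> y)"
proof -
  have "(LINT t:{0..y}|lborel. h t) = (LINT t|lborel. (s t * indicator {0<..y} t) * g (\<Xi> t))"
    unfolding set_lebesgue_integral_def
  proof (rule integral_cong_AE)
    show "AE t in lborel. indicator {0..y} t *\<^sub>R h t = (s t * indicator {0<..y} t) * g (\<Xi> t)"
      using AE_lborel_singleton[of 0]
      by eventually_elim (use D_down[OF assms] in \<open>auto simp: h_def indicator_def\<close>)
  qed auto
  then show ?thesis using transport_integral[OF assms g_borel] by (simp add: W_def)
qed

definition V :: "real \<Rightarrow> real" where
  "V y = (if y \<in> D then W (\<xi> y) else 0)"

lemma V_eq:
  assumes "0 \<le> y"
  shows "V y = u 0 + (LINT t:{0..y}|lborel. h t)"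
proof (cases "y \<in> D")
  case True
  then show ?thesis using h_integral_in_D by (simp add: V_def)
next
  case False
  txt \<open>Here \<open>D\<close> is bounded, and the values \<open>W n\<close> at \<open>y = \<rho> n\<close> tend to 0.\<close>
  have below: "\<rho> (real n) \<le> y" for n
    using False D_down[OF \<rho>_in_D[of "real n"], of y] assms by force
  have "(\<lambda>n. LINT t:{0..\<rho> (real n)}|lborel. h t) \<longlonglongrightarrow> (LINT t:{0..y}|lborel. h t)"
    unfolding set_lebesgue_integral_def
  proof (rule integral_dominated_convergence)
    show "integrable lborel (\<lambda>t. norm (indicator {0..y} t *\<^sub>R h t))"
      using h_integrable[of y] by (simp add: set_integrable_def)
    show "AE t in lborel. (\<lambda>n. indicator {0..\<rho> (real n)} t *\<^sub>R h t) \<longlonglongrightarrow> indicator {0..y} t *\<^sub>R h t"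
    proof (intro AE_I2)
      fix t
      show "(\<lambda>n. indicator {0..\<rho> (real n)} t *\<^sub>R h t) \<longlonglongrightarrow> indicator {0..y} t *\<^sub>R h t"
      proof (cases "t \<in> D")
        case True
        have "\<forall>\<^sub>F n in sequentially. indicator {0..y} t *\<^sub>R h t = indicator {0..\<rho> (real n)} t *\<^sub>R h t"
          using D_exhaustion[OF True] by eventually_elim (use below in \<open>auto simp: indicator_def intro: order_trans\<close>)
        then show ?thesis by (rule Lim_transform_eventually[OF tendsto_const])
      qed (simp add: h_def)
    qed
    show "AE t in lborel. norm (indicator {0..\<rho> (real n)} t *\<^sub>R h t) \<le> norm (indicator {0..y} t *\<^sub>R h t)" for n
      using below[of n] by (auto simp: indicator_def)
  qed auto
  then have "(\<lambda>n. u 0 + (LINT t:{0..\<rho> (real n)}|lborel. h t)) \<longlonglongrightarrow> u 0 + (LINT t:{0..y}|lborel. h t)"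
    by (intro tendsto_intros)
  moreover have "u 0 + (LINT t:{0..\<rho> (real n)}|lborel. h t) = W (real n)" for n
  proof -
    have \<xi>: "0 \<le> \<xi> (\<rho> (real n))" "\<xi> (\<rho> (real n)) \<le> real n"
      using \<xi>_nonneg[OF \<rho>_in_D] \<xi>_le by auto
    \<comment> \<open>\<open>\<xi> (\<rho> (real n))\<close> can be smaller than \<open>n\<close>,
      but the values of \<open>T\<close> agree, which is all that \<open>W\<close> sees.\<close>
    have "W (\<xi> (\<rho> (real n))) = W (real n)" by (rule W_eq_if_T_eq[OF \<xi>]) (simp add: T_\<xi>_\<rho>)
    then show ?thesis using h_integral_in_D[OF \<rho>_in_D[of "real n"]] by simp
  qed
  moreover have "(\<lambda>n. W (real n)) \<longlonglongrightarrow> 0"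
    using filterlim_compose[OF W_tendsto_0 filterlim_real_sequentially] .
  ultimately have "u 0 + (LINT t:{0..y}|lborel. h t) = 0" by (simp add: LIMSEQ_unique)
  then show ?thesis using False by (simp add: V_def)
qed

end


section \<open>From Sobolev functions to continuous versions\<close>

lemma borel_measurable_lebesgue_AE_eq:
  fixes f g :: "real \<Rightarrow> real"
  assumes "AE x in lebesgue. f x = g x" "g \<in> borel_measurable lebesgue"
  shows "f \<in> borel_measurable lebesgue"
proof (rule measurableI)
  fix A :: "real set" assume A: "A \<in> sets borel"
  show "f -` A \<inter> space lebesgue \<in> sets lebesgue"
  proof (rule completion.in_sets_AE)
    show "AE x in lebesgue. x \<in> g -` A \<inter> space lebesgue \<longleftrightarrow> x \<in> f -` A \<inter> space lebesgue"
      using assms(1) by eventually_elim simp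
    show "g -` A \<inter> space lebesgue \<in> sets lebesgue" using assms(2) A by (rule measurable_sets)
  qed simp
qed simp

text \<open>\<open>M\<close> and \<open>f\<close> carry no measurability assumption; completeness of
  Lebesgue measure supplies it. This matters for the hollows, which are an uncountable
  union.\<close>

lemma lebesgue_on_transfer:
  fixes f g :: "real \<Rightarrow> real"
  assumes MN: "AE x in lebesgue. x \<in> M \<longleftrightarrow> x \<in> N" and N [measurable]: "N \<in> sets borel"
    and fg: "AE x in lebesgue. x \<in> N \<longrightarrow> f x = g x" and g [measurable]: "g \<in> borel_measurable borel"
  shows "M \<in> sets lebesgue"
    and "(LINT x|lebesgue_on M. f x) = (LINT x:N|lborel. g x)"
    and "integrable (lebesgue_on M) f \<longleftrightarrow> set_integrable lborel N g"
    and "f \<in> borel_measurable (lebesgue_on M)"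
proof -
  show M: "M \<in> sets lebesgue"
    by (rule completion.in_sets_AE[of N]) (use MN in \<open>auto elim!: eventually_mono\<close>)
  have eq: "AE x in lebesgue. indicator M x *\<^sub>R f x = indicator N x *\<^sub>R g x"
    using MN fg by eventually_elim (auto simp: indicator_def)
  have b: "(\<lambda>x. indicator N x *\<^sub>R g x) \<in> borel_measurable lborel" by measurable
  then have gm: "(\<lambda>x. indicator N x *\<^sub>R g x) \<in> borel_measurable lebesgue"
    by (rule measurable_completion)
  have fm: "(\<lambda>x. indicator M x *\<^sub>R f x) \<in> borel_measurable lebesgue"
    by (rule borel_measurable_lebesgue_AE_eq[OF eq gm])
  show "(LINT x|lebesgue_on M. f x) = (LINT x:N|lborel. g x)"
    using integral_cong_AE[OF fm gm eq] integral_completion[OF b] M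
    by (simp add: integral_restrict_space set_lebesgue_integral_def)
  show "integrable (lebesgue_on M) f \<longleftrightarrow> set_integrable lborel N g"
    using integrable_cong_AE[OF fm gm eq] integrable_completion[OF b] M
    by (simp add: integrable_restrict_space set_integrable_def)
  show "f \<in> borel_measurable (lebesgue_on M)"
    using fm M by (simp add: borel_measurable_restrict_space_iff)
qed

section \<open>Decay of Sobolev functions at infinity\<close>

lemma nn_integral_powr_finite:
  fixes f :: "real \<Rightarrow> real"
  assumes "f \<in> borel_measurable borel" "set_integrable lborel {0..} (\<lambda>x. \<bar>f x\<bar> powr p)"
  shows "(\<integral>\<^sup>+ x. ennreal (\<bar>f x\<bar> powr p) * indicator {0..} x \<partial>lborel) < \<infinity>"
proof -
  have "(\<integral>\<^sup>+ x. ennreal (\<bar>f x\<bar> powr p) * indicator {0..} x \<partial>lborel)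
      = (\<integral>\<^sup>+ x. ennreal (norm (indicator {0..} x *\<^sub>R (\<bar>f x\<bar> powr p))) \<partial>lborel)"
    by (intro nn_integral_cong) (auto simp: indicator_def)
  then show ?thesis using assms(2) by (simp add: set_integrable_def integrable_iff_bounded)
qed

text \<open>For \<open>r > \<delta>\<close> the ratio \<open>r / \<delta>\<close> exceeds 1 and is
  at most its \<open>p\<close>-th power. A small additive error is traded for a possibly large
  factor on \<open>r powr p\<close>, whose integrals over distant windows tend to 0.\<close>

lemma le_powr_bound:
  fixes r :: real
  assumes "1 \<le> p" "0 < \<delta>" "0 \<le> r"
  shows "r \<le> \<delta> + \<delta> powr (1 - p) * r powr p"
proof (cases "r \<le> \<delta>")
  case False
  have "\<delta> powr (p - 1) * r \<le> r powr (p - 1) * r powr 1"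
    using False assms by (intro mult_mono powr_mono2) auto
  also have "\<dots> = r powr p" using assms by (simp add: powr_mult_base mult.commute)
  finally have "\<delta> powr (1 - p) * (\<delta> powr (p - 1) * r) \<le> \<delta> powr (1 - p) * r powr p"
    by (intro mult_left_mono) auto
  moreover have "\<delta> powr (1 - p) * (\<delta> powr (p - 1) * r) = r"
    using assms(2) by (simp flip: mult.assoc powr_add)
  ultimately show ?thesis using assms(2) by linarith
qed (simp add: add_increasing2)

lemma integral_unit_window_tendsto_0:
  fixes F :: "real \<Rightarrow> real"
  assumes "set_integrable lborel {0..} F" and [measurable]: "F \<in> borel_measurable borel"
  shows "((\<lambda>x. LINT t:{x..x+1}|lborel. F t) \<longlongrightarrow> 0) at_top"
proof -
  have "((\<lambda>x. LINT t|lborel. indicator {x..x+1} t *\<^sub>R F t) \<longlongrightarrow> integral\<^sup>L lborel (\<lambda>t::real. 0)) at_top"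
  proof (rule integral_dominated_convergence_at_top[where s = "\<lambda>x t. indicator {x..x+1} t *\<^sub>R F t"
        and f = "\<lambda>t. 0" and M = lborel and w = "\<lambda>t. norm (indicator {0..} t *\<^sub>R F t)"])
    show "integrable lborel (\<lambda>t. norm (indicator {0..} t *\<^sub>R F t))"
      using assms(1) by (simp add: set_integrable_def)
    show "\<forall>\<^sub>F x in at_top. AE t in lborel. norm (indicator {x..x+1} t *\<^sub>R F t) \<le> norm (indicator {0..} t *\<^sub>R F t)"
      using eventually_ge_at_top[of 0]
      by eventually_elim (auto simp: indicator_def)
    show "AE t in lborel. ((\<lambda>x. indicator {x..x+1} t *\<^sub>R F t) \<longlongrightarrow> 0) at_top"
    proof (intro AE_I2)
      fix t
      have "\<forall>\<^sub>F x in at_top. 0 = indicator {x..x+1} t *\<^sub>R F t"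
        using eventually_gt_at_top[of t] by eventually_elim (simp add: indicator_def)
      then show "((\<lambda>x. indicator {x..x+1} t *\<^sub>R F t) \<longlongrightarrow> 0) at_top"
        by (rule Lim_transform_eventually[OF tendsto_const])
    qed
  qed auto
  then show ?thesis by (simp add: set_lebesgue_integral_def)
qed

text \<open>Averaging \<open>u x \<le> u y + \<integral>|g|\<close> over \<open>y\<close> in \<open>[x, x + 1]\<close> avoids Hoelder's inequality.\<close>

lemma W1p_decay:
  fixes u g :: "real \<Rightarrow> real"
  assumes p: "1 \<le> p" and g [measurable]: "g \<in> borel_measurable borel"
    and u: "\<And>x. 0 \<le> x \<Longrightarrow> u x = c + (LINT t:{0..x}|lborel. g t)" "\<And>x. 0 \<le> x \<Longrightarrow> 0 \<le> u x"
    and ub [measurable]: "u \<in> borel_measurable borel"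
    and up: "set_integrable lborel {0..} (\<lambda>x. \<bar>u x\<bar> powr p)"
    and gp: "set_integrable lborel {0..} (\<lambda>x. \<bar>g x\<bar> powr p)"
  shows "(u \<longlongrightarrow> 0) at_top"
proof (rule tendstoI)
  fix e :: real assume e: "0 < e"
  \<comment> \<open>The bound below is \<open>2 * \<delta>\<close>, one for \<open>u\<close> and one
    for \<open>g\<close>, plus a window term that falls below \<open>\<delta>\<close>; together less
    than \<open>e\<close>.\<close>
  define \<delta> where "\<delta> = e / 4"
  have \<delta>: "0 < \<delta>" using e by (simp add: \<delta>_def)
  define K where "K = \<delta> powr (1 - p)"
  define F where "F t = \<bar>u t\<bar> powr p + \<bar>g t\<bar> powr p" for t
  have Fb [measurable]: "F \<in> borel_measurable borel" unfolding F_def[abs_def] by measurable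
  have Fi: "set_integrable lborel {0..} F" unfolding F_def[abs_def] using up gp by (rule set_integral_add)
  have gi: "set_integrable lborel {0..b} g" for b
    using set_integrable_if_powr[OF p g nn_integral_powr_finite[OF g gp]] .
  have ui: "set_integrable lborel {0..b} u" for b
    using set_integrable_if_powr[OF p ub nn_integral_powr_finite[OF ub up]] .
  have bound: "u x \<le> 2 * \<delta> + K * (LINT t:{x..x+1}|lborel. F t)" if "0 \<le> x" for x
  proof -
    let ?I = "{x..x+1}"
    have sub: "?I \<subseteq> {0..x+1}" using that by auto
    have gi': "set_integrable lborel ?I (\<lambda>t. \<bar>g t\<bar>)"
      using set_integrable_subset[OF gi _ sub] by (intro set_integrable_abs) simp
    have ui': "set_integrable lborel ?I u" using set_integrable_subset[OF ui _ sub] by simp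
    have Fi': "set_integrable lborel ?I F" by (rule set_integrable_subset[OF Fi]) (use that in auto)
    have ci: "set_integrable lborel ?I (\<lambda>t. d)" for d :: real
      unfolding set_integrable_def by (intro borel_integrable_compact continuous_intros) simp
    let ?A = "LINT t:?I|lborel. \<bar>g t\<bar>"
    have "u x \<le> u y + ?A" if y: "y \<in> ?I" for y
    proof -
      have gy: "set_integrable lborel {x<..y} g"
        by (rule set_integrable_subset[OF gi[of y]]) (use \<open>0 \<le> x\<close> in auto)
      have "u x - u y = - (LINT t:{x<..y}|lborel. g t)"
        using primitive_diff[OF gi, of x y] u(1)[of x] u(1)[of y] \<open>0 \<le> x\<close> y by simp
      also have "\<dots> \<le> (LINT t:{x<..y}|lborel. \<bar>g t\<bar>)"
        using set_integral_norm_bound[OF gy] by simp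
      also have "\<dots> \<le> ?A"
        unfolding set_lebesgue_integral_def
      proof (rule integral_mono)
        show "integrable lborel (\<lambda>t. indicator {x<..y} t *\<^sub>R \<bar>g t\<bar>)"
          using set_integrable_abs[OF gy] by (simp add: set_integrable_def)
        show "integrable lborel (\<lambda>t. indicator ?I t *\<^sub>R \<bar>g t\<bar>)" using gi' by (simp add: set_integrable_def)
        show "indicator {x<..y} t *\<^sub>R \<bar>g t\<bar> \<le> indicator ?I t *\<^sub>R \<bar>g t\<bar>" for t
          using y by (auto simp: indicator_def)
      qed
      finally show ?thesis by simp
    qed
    then have "(LINT y:?I|lborel. u x) \<le> (LINT y:?I|lborel. u y + ?A)"
      by (intro set_integral_mono ci set_integral_add(1) ui') auto
    also have "\<dots> = (LINT y:?I|lborel. u y) + ?A"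
      by (subst set_integral_add(2)[OF ui' ci]) (simp add: set_integral_const)
    also have "\<dots> = (LINT y:?I|lborel. u y + \<bar>g y\<bar>)"
      by (rule set_integral_add(2)[OF ui' gi', symmetric])
    also have "\<dots> \<le> (LINT y:?I|lborel. 2 * \<delta> + K * F y)"
    proof (intro set_integral_mono set_integral_add(1) ui' gi' ci set_integrable_mult_right Fi')
      fix y assume "y \<in> ?I"
      then have "0 \<le> u y" using u(2) that by simp
      then show "u y + \<bar>g y\<bar> \<le> 2 * \<delta> + K * F y"
        using le_powr_bound[OF p \<delta>, of "\<bar>u y\<bar>"] le_powr_bound[OF p \<delta>, of "\<bar>g y\<bar>"]
        by (simp add: F_def K_def distrib_left)
    qed
    also have "\<dots> = 2 * \<delta> + K * (LINT y:?I|lborel. F y)"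
      by (subst set_integral_add(2)[OF ci set_integrable_mult_right[OF Fi']]) (simp add: set_integral_const)
    finally show ?thesis by (simp add: set_integral_const)
  qed
  have "((\<lambda>x. K * (LINT t:{x..x+1}|lborel. F t)) \<longlongrightarrow> K * 0) at_top"
    by (intro tendsto_mult tendsto_const integral_unit_window_tendsto_0 Fi Fb)
  then have "\<forall>\<^sub>F x in at_top. K * (LINT t:{x..x+1}|lborel. F t) < \<delta>"
    using \<delta> by (intro order_tendstoD(2)) auto
  then show "\<forall>\<^sub>F x in at_top. dist (u x) 0 < e"
    using eventually_ge_at_top[of 0]
  proof eventually_elim
    case (elim x)
    then show ?case using bound[of x] u(2)[of x] \<delta> by (simp add: \<delta>_def)
  qed
qed

text \<open>\<open>\<phi>\<close> minus a primitive \<open>P\<close> of its \<open>L^p\<close>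
  derivative has weak derivative 0, hence is a constant \<open>c\<close>, and \<open>c + P\<close>
  is the continuous version. The given \<open>g\<close> is identified with that derivative by
  uniqueness.\<close>

lemma W1p_representative:
  assumes p: "1 \<le> p" and W: "in_W1p p \<phi>" and pos: "AE x in lebesgue_on \<real>\<^sub>+. 0 \<le> \<phi> x"
    and wd: "has_weak_derivative \<phi> g"
  obtains u g' where "decaying_Lp u g' p" "AE x in lebesgue. 0 \<le> x \<longrightarrow> \<phi> x = u x"
    "AE x in lebesgue. 0 \<le> x \<longrightarrow> g x = g' x"
proof -
  have \<phi>p: "\<phi> \<in> borel_measurable (lebesgue_on \<real>\<^sub>+)" "integrable (lebesgue_on \<real>\<^sub>+) (\<lambda>x. \<bar>\<phi> x\<bar> powr p)"
    using W by (auto simp: in_W1p_def in_Lp_def)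
  obtain g1 where g1: "has_weak_derivative \<phi> g1" "in_Lp p g1" using W by (auto simp: in_W1p_def)
  have g1m: "g1 \<in> borel_measurable (lebesgue_on \<real>\<^sub>+)" "integrable (lebesgue_on \<real>\<^sub>+) (\<lambda>x. \<bar>g1 x\<bar> powr p)"
    using g1(2) by (auto simp: in_Lp_def)
  have "(\<lambda>x. if x \<in> \<real>\<^sub>+ then g1 x else 0) \<in> borel_measurable lebesgue"
    using g1m(1) by (subst borel_measurable_if) auto
  then obtain g' where g' [measurable]: "g' \<in> borel_measurable borel"
    and "AE x in lebesgue. (if x \<in> \<real>\<^sub>+ then g1 x else 0) = g' x"
    using lborel_representative by blast
  then have g1g': "AE x in lebesgue. 0 \<le> x \<longrightarrow> g1 x = g' x"
    by (auto elim!: eventually_mono split: if_splits)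
  have triv: "AE x in lebesgue. x \<in> \<real>\<^sub>+ \<longleftrightarrow> x \<in> {0..}" by simp
  have "AE x in lebesgue. x \<in> {0..} \<longrightarrow> \<bar>g1 x\<bar> powr p = \<bar>g' x\<bar> powr p"
    using g1g' by eventually_elim simp
  from lebesgue_on_transfer(3)[OF triv _ this] g1m(2)
  have g'p: "set_integrable lborel {0..} (\<lambda>x. \<bar>g' x\<bar> powr p)" by simp
  have g'i: "set_integrable lborel {0..b} g'" for b
    using set_integrable_if_powr[OF p g' nn_integral_powr_finite[OF g' g'p]] .
  define P where "P x = (LINT t:{0..x}|lborel. g' t)" for x
  have Pw: "has_weak_derivative P g'"
    by (rule weak_derivative_primitive[OF g' g'i, of _ 0]) (simp add: P_def)
  have locs: "locally_integrable \<phi>" "locally_integrable P"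
    using g1 Pw by (auto simp: has_weak_derivative_def)
  obtain c where c: "AE x in lebesgue. 0 < x \<longrightarrow> \<phi> x - P x = c"
  proof (rule du_Bois_Reymond[OF locally_integrable_diff[OF locs]])
    fix \<eta> assume \<eta>: "test_function \<eta>"
    have \<eta>m: "\<eta> \<in> borel_measurable borel" "deriv \<eta> \<in> borel_measurable borel"
      using test_function_borel test_function_deriv \<eta> by auto
    have "AE x in lebesgue. x \<in> {0..} \<longrightarrow> g1 x * \<eta> x = g' x * \<eta> x"
      using g1g' by eventually_elim simp
    from lebesgue_on_transfer(2)[OF triv _ this] \<eta>m
    have "(LINT x|lebesgue_on \<real>\<^sub>+. g1 x * \<eta> x) = (LINT x|lebesgue_on \<real>\<^sub>+. g' x * \<eta> x)"
      by (simp add: LINT_half_line_lborel)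
    then have "(LINT x|lebesgue_on \<real>\<^sub>+. \<phi> x * deriv \<eta> x) = (LINT x|lebesgue_on \<real>\<^sub>+. P x * deriv \<eta> x)"
      using g1(1) Pw \<eta> by (simp add: has_weak_derivative_def)
    then show "(LINT x|lebesgue_on \<real>\<^sub>+. (\<phi> x - P x) * deriv \<eta> x) = 0"
      using integrable_times_test_function[OF locs(1) test_function_deriv[OF \<eta>]]
        integrable_times_test_function[OF locs(2) test_function_deriv[OF \<eta>]]
      by (simp add: left_diff_distrib)
  qed blast
  define u where "u x = c + P x" for x
  have u_eq: "u x = c + (LINT t:{0..x}|lborel. g' t)" for x by (simp add: u_def P_def)
  have P0: "P 0 = 0"
    unfolding P_def set_lebesgue_integral_def
    by (rule integral_eq_zero_AE) (use AE_lborel_singleton[of 0] in \<open>eventually_elim, simp\<close>)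
  have u0: "u x = u 0 + (LINT t:{0..x}|lborel. g' t)" for x by (simp add: u_def P0, simp add: P_def)
  have cont: "continuous_on {0..} u"
    unfolding u_def P_def by (intro continuous_intros continuous_on_primitive g'i)
  have "AE x in lebesgue. x \<noteq> 0" by (rule AE_completion[OF AE_lborel_singleton])
  moreover have "AE x in lebesgue. 0 \<le> x \<longrightarrow> 0 \<le> \<phi> x"
    using pos by (simp add: AE_restrict_space_iff)
  ultimately have "AE x in lebesgue. 0 < x \<longrightarrow> 0 \<le> u x"
    using c by eventually_elim (auto simp: u_def)
  have "AE x in lebesgue. x \<noteq> 0" by (rule AE_completion[OF AE_lborel_singleton])
  then have \<phi>u: "AE x in lebesgue. 0 \<le> x \<longrightarrow> \<phi> x = u x"
    using c by eventually_elim (auto simp: u_def)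
  have "0 \<le> u x" if "x \<in> {0<..}" for x
  proof -
    \<comment> \<open>A closed set of full measure is the whole line; \<open>{..0}\<close> is
      adjoined because the inequality known so far concerns positive \<open>x\<close>.\<close>
    have "x \<in> {..0} \<union> ({0..} \<inter> u -` {0..})"
    proof (rule mem_closed_if_AE_lebesgue)
      show "closed ({..0} \<union> ({0..} \<inter> u -` {0..}))"
        by (intro closed_Un continuous_closed_preimage cont closed_atLeast closed_atMost)
      show "AE x in lebesgue. x \<in> {..0} \<union> ({0..} \<inter> u -` {0..})"
        using \<open>AE x in lebesgue. 0 < x \<longrightarrow> 0 \<le> u x\<close> by eventually_elim auto
    qed
    then show ?thesis using that by auto
  qed
  then have u_nonneg: "0 \<le> u x" if "0 \<le> x" for x
    using continuous_ge_on_closure[of "{0<..}" u x 0] cont that by simp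
  have "u \<in> borel_measurable borel"
  proof -
    have "continuous_on UNIV (\<lambda>x. u (max 0 x))"
      by (intro continuous_on_compose2[OF cont]) (auto intro!: continuous_intros)
    then have "(\<lambda>x. u (max 0 x)) \<in> borel_measurable borel" by (rule borel_measurable_continuous_onI)
    \<comment> \<open>For negative \<open>x\<close> the interval \<open>{0..x}\<close> is empty,
      hence \<open>u x = u 0\<close>.\<close>
    moreover have "u (max 0 x) = u x" for x
      by (cases "0 \<le> x") (auto simp: u_def P0, simp add: P_def set_lebesgue_integral_def)
    ultimately show ?thesis by simp
  qed
  then have [measurable]: "u \<in> borel_measurable borel" .
  have "AE x in lebesgue. x \<in> {0..} \<longrightarrow> \<bar>\<phi> x\<bar> powr p = \<bar>u x\<bar> powr p"
    using \<phi>u by eventually_elim simp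
  from lebesgue_on_transfer(3)[OF triv _ this] \<phi>p(2)
  have up: "set_integrable lborel {0..} (\<lambda>x. \<bar>u x\<bar> powr p)" by simp
  have decay: "(u \<longlongrightarrow> 0) at_top"
    by (rule W1p_decay[OF p g' u_eq u_nonneg _ up g'p]) simp_all
  have "decaying_Lp u g' p"
    by unfold_locales (fact cont u_nonneg decay g' g'i p nn_integral_powr_finite[OF g' g'p] | rule u0)+
  moreover have "AE x in lebesgue. 0 < x \<longrightarrow> g x = g1 x" by (rule weak_derivative_unique[OF wd g1(1)])
  with \<open>AE x in lebesgue. x \<noteq> 0\<close> g1g' have "AE x in lebesgue. 0 \<le> x \<longrightarrow> g x = g' x"
    by eventually_elim auto
  ultimately show ?thesis using that \<phi>u by blast
qed


section \<open>Hollows and tamping in terms of the continuous version\<close>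

lemma mem_conv_ess_iff:
  assumes A: "A \<in> sets lebesgue" "A \<subseteq> {0..}"
  shows "x \<in> conv_ess A \<longleftrightarrow> emeasure lebesgue (A \<inter> {..x}) \<noteq> 0 \<and> emeasure lebesgue (A \<inter> {x..}) \<noteq> 0"
proof
  assume x: "x \<in> conv_ess A"
  \<comment> \<open>If \<open>A\<close> had no mass on a closed half-line \<open>C\<close>
    containing \<open>x\<close>, then \<open>A - C\<close> would be a competitor whose convex hull
    misses \<open>x\<close>.\<close>
  have "emeasure lebesgue (A \<inter> C) \<noteq> 0"
    if C: "C \<in> sets borel" "convex (- C)" "x \<in> C" for C
  proof
    assume "emeasure lebesgue (A \<inter> C) = 0"
    then have null: "A \<inter> C \<in> null_sets lebesgue" using A(1) C(1) by (intro null_setsI) auto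
    have e: "sym_diff A (A - C) = A \<inter> C" by auto
    have "A - C \<subseteq> \<real>\<^sub>+" using A(2) by auto
    moreover have "sym_diff A (A - C) \<in> null_sets lebesgue" unfolding e by (rule null)
    ultimately have "x \<in> convex hull (A - C)" using x unfolding conv_ess_def by blast
    moreover have "convex hull (A - C) \<subseteq> - C" using C(2) by (intro hull_minimal) auto
    ultimately show False using C(3) by auto
  qed
  from this[of "{..x}"] this[of "{x..}"]
  show "emeasure lebesgue (A \<inter> {..x}) \<noteq> 0 \<and> emeasure lebesgue (A \<inter> {x..}) \<noteq> 0"
    by (simp add: Compl_atMost Compl_atLeast)
next
  assume *: "emeasure lebesgue (A \<inter> {..x}) \<noteq> 0 \<and> emeasure lebesgue (A \<inter> {x..}) \<noteq> 0"
  show "x \<in> conv_ess A"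
    unfolding conv_ess_def
  proof (safe)
    fix B assume B: "B \<subseteq> {0..}" "sym_diff A B \<in> null_sets lebesgue"
    \<comment> \<open>Conversely every competitor meets both half-lines ending at \<open>x\<close>,
      and its convex hull is an interval.\<close>
    have "B \<inter> C \<noteq> {}" if "C \<in> sets borel" "emeasure lebesgue (A \<inter> C) \<noteq> 0" for C
    proof
      assume "B \<inter> C = {}"
      then have "A \<inter> C \<subseteq> sym_diff A B" by auto
      then have "A \<inter> C \<in> null_sets lebesgue" by (rule completion.complete2[OF _ B(2)])
      then show False using that(2) by (simp add: null_sets_def)
    qed
    from this[of "{..x}"] this[of "{x..}"] *
    obtain y z where "y \<in> B" "y \<le> x" "z \<in> B" "x \<le> z" by auto
    moreover have "is_interval (convex hull B)" by (simp add: is_interval_convex_1)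
    ultimately show "x \<in> convex hull B" using mem_is_interval_1_I hull_inc by metis
  qed
qed

locale decaying_version = decaying_Lp +
  fixes \<phi> :: "real \<Rightarrow> real"
  assumes version: "AE x in lebesgue. 0 \<le> x \<longrightarrow> \<phi> x = u x"
begin

lemma superlevel_AE: "AE x in lebesgue. x \<in> superlevel \<phi> \<nu> \<longleftrightarrow> x \<in> S \<nu>"
  using version by eventually_elim (auto simp: superlevel_def S_def)

lemma superlevel_sets: "superlevel \<phi> \<nu> \<in> sets lebesgue"
  by (rule completion.in_sets_AE[of "S \<nu>"]) (use superlevel_AE[of \<nu>] in \<open>auto elim!: eventually_mono\<close>)

lemma emeasure_superlevel_Int:
  assumes "B \<in> sets borel"
  shows "emeasure lebesgue (superlevel \<phi> \<nu> \<inter> B) = emeasure lborel (S \<nu> \<inter> B)"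
proof -
  have "emeasure lebesgue (superlevel \<phi> \<nu> \<inter> B) = emeasure lebesgue (S \<nu> \<inter> B)"
  proof (rule emeasure_eq_AE)
    show "AE x in lebesgue. x \<in> superlevel \<phi> \<nu> \<inter> B \<longleftrightarrow> x \<in> S \<nu> \<inter> B"
      using superlevel_AE[of \<nu>] by eventually_elim auto
  qed (use superlevel_sets assms in auto)
  also have "\<dots> = emeasure lborel (S \<nu> \<inter> B)" using assms by simp
  finally show ?thesis .
qed

lemma emeasure_superlevel: "emeasure lebesgue (superlevel \<phi> \<nu>) = emeasure lborel (S \<nu>)"
  using emeasure_superlevel_Int[of UNIV] by simp

lemma mem_hollows_below_iff:
  "x \<in> hollows_below \<infinity> \<phi> \<longleftrightarrow> (\<exists>l. x \<notin> superlevel \<phi> l \<and>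
     emeasure lborel (S l \<inter> {..x}) \<noteq> 0 \<and> emeasure lborel (S l \<inter> {x..}) \<noteq> 0)"
proof -
  have "superlevel \<phi> l \<subseteq> {0..}" for l by (auto simp: superlevel_def)
  then show ?thesis
    by (auto simp: hollows_below_def hollows_def mem_conv_ess_iff superlevel_sets emeasure_superlevel_Int)
qed

text \<open>Wherever \<open>\<phi> x = u x\<close> the two conditions agree for all levels at once,
  so the uncountable union costs a single null set.\<close>

lemma hollows_below_AE: "AE x in lebesgue. x \<in> hollows_below \<infinity> \<phi> \<longleftrightarrow> x \<in> H"
  using version
proof eventually_elim
  case (elim x)
  show ?case
  proof
    assume "x \<in> hollows_below \<infinity> \<phi>"
    then obtain l where l: "x \<notin> superlevel \<phi> l" "emeasure lborel (S l \<inter> {..x}) \<noteq> 0"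
      "emeasure lborel (S l \<inter> {x..}) \<noteq> 0" unfolding mem_hollows_below_iff by blast
    have "S l \<inter> {..x} \<noteq> {}" "S l \<inter> {x..} \<noteq> {}" using l by auto
    then obtain y z where y: "0 \<le> y" "l \<le> u y" "y \<le> x" and z: "l \<le> u z" "x \<le> z"
      by (auto simp: S_def)
    have "u x < l" using l(1) elim y by (auto simp: superlevel_def)
    then have "y \<noteq> x" "z \<noteq> x" using y z by auto
    then show "x \<in> H" using y z \<open>u x < l\<close> by (intro H_I[of y x z]) auto
  next
    assume x: "x \<in> H"
    then obtain y z where yz: "0 \<le> y" "y < x" "x < z" "u x < u y" "u x < u z" by (rule H_E)
    \<comment> \<open>Strictly between \<open>u x\<close> and the two higher values, so that
      \<open>S_positive\<close> gives positive measure on both sides.\<close>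
    define l where "l = (u x + min (u y) (u z)) / 2"
    have l: "u x < l" "l < u y" "l < u z" using yz by (auto simp: l_def min_def)
    have "emeasure lborel (S l \<inter> {y..x}) \<le> emeasure lborel (S l \<inter> {..x})"
      "emeasure lborel (S l \<inter> {z..z+1}) \<le> emeasure lborel (S l \<inter> {x..})"
      using yz by (intro emeasure_mono; force)+
    moreover have "emeasure lborel (S l \<inter> {y..x}) \<noteq> 0" "emeasure lborel (S l \<inter> {z..z+1}) \<noteq> 0"
      using S_positive[of y l x] S_positive[of z l "z + 1"] yz l by auto
    moreover have "x \<notin> superlevel \<phi> l" using elim l(1) by (auto simp: superlevel_def)
    ultimately show "x \<in> hollows_below \<infinity> \<phi>" unfolding mem_hollows_below_iff by (intro exI[of _ l]) auto
  qed
qed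

lemma tamp_x_eq: "tamp_x \<phi> \<nu> = first_point \<nu>"
  by (simp add: tamp_x_def inf_ess_def first_point_def emeasure_superlevel_Int)

lemma tamp_y_eq:
  assumes "0 < \<nu>" "emeasure lborel (S \<nu>) \<noteq> 0"
  shows "tamp_y \<phi> \<nu> = T (first_point \<nu>)"
proof -
  let ?a = "first_point \<nu>"
  have a: "0 \<le> ?a" by (rule first_point_nonneg[OF assms])
  have HB: "hollows_below \<infinity> \<phi> \<in> sets lebesgue"
    by (rule completion.in_sets_AE[of H]) (use hollows_below_AE in \<open>auto elim!: eventually_mono\<close>)
  have "emeasure lebesgue (hollows_below \<infinity> \<phi> \<inter> {0..?a}) = emeasure lebesgue (H \<inter> {0..?a})"
    by (rule emeasure_eq_AE) (use hollows_below_AE HB in \<open>auto elim!: eventually_mono\<close>)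
  then have m: "measure lebesgue (hollows_below \<infinity> \<phi> \<inter> {0..?a}) = measure lborel (H \<inter> {0..?a})"
    by (simp add: measure_def)
  have e: "{0..?a} = ({0..?a} - H) \<union> (H \<inter> {0..?a})" by auto
  have d: "({0..?a} - H) \<inter> (H \<inter> {0..?a}) = {}" by auto
  have "measure lborel (({0..?a} - H) \<union> (H \<inter> {0..?a})) = T ?a + measure lborel (H \<inter> {0..?a})"
    unfolding T_def by (rule measure_Un_null) (use d in \<open>auto intro!: fmeasurable_Icc_subset[of _ 0 ?a]\<close>)
  then show ?thesis using a by (simp add: tamp_y_def tamp_x_eq m flip: e)
qed

lemma mem_tamp_set_iff:
  assumes "0 < \<nu>"
  shows "y \<in> tamp_set \<phi> \<nu> \<longleftrightarrow> emeasure lborel (S \<nu>) \<noteq> 0 \<and> T (first_point \<nu>) \<le> y \<and>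
    y \<le> T (first_point \<nu>) + measure lborel (S \<nu>)"
proof -
  have "emeasure lborel (S \<nu>) \<noteq> \<infinity>" using S_fmeasurable[OF assms] by (simp add: fmeasurable_def)
  moreover have "measure lebesgue (superlevel \<phi> \<nu>) = measure lborel (S \<nu>)"
    by (simp add: measure_def emeasure_superlevel)
  ultimately show ?thesis using tamp_y_eq[OF assms] by (auto simp: tamp_set_def emeasure_superlevel)
qed

text \<open>Each level that enters the supremum is at most \<open>V y\<close> by
  \<open>W_\<xi>_ge\<close>, and by \<open>W_\<xi>_greater\<close> every positive level below
  \<open>V y\<close> enters it.\<close>

lemma tamping_eq:
  assumes "0 \<le> y"
  shows "tamping \<phi> y = ennreal (V y)"
proof (rule antisym)
  have "\<nu> \<le> V y" if "0 < \<nu>" "y \<in> tamp_set \<phi> \<nu>" for \<nu>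
    using W_\<xi>_ge[OF that(1), of y] that by (simp add: mem_tamp_set_iff V_def)
  then show "tamping \<phi> y \<le> ennreal (V y)"
    unfolding tamping_def by (intro SUP_least ennreal_leI) auto
  show "ennreal (V y) \<le> tamping \<phi> y"
  proof (rule dense_le)
    fix r assume r: "r < ennreal (V y)"
    then obtain \<nu> where \<nu>: "r = ennreal \<nu>" "0 \<le> \<nu>" by (cases r) auto
    show "r \<le> tamping \<phi> y"
    \<comment> \<open>The tamping ranges over positive levels; 0 is a trivial lower bound.\<close>
    proof (cases "\<nu> = 0")
      case False
      then have pos: "0 < \<nu>" "\<nu> < V y" using r \<nu> by (auto simp: ennreal_less_iff)
      then have D: "y \<in> D" "\<nu> < W (\<xi> y)" by (auto simp: V_def split: if_splits)
      have "y \<in> tamp_set \<phi> \<nu>"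
        using W_\<xi>_greater[OF pos(1) D] by (simp add: mem_tamp_set_iff[OF pos(1)])
      then show ?thesis unfolding tamping_def \<nu>(1) using pos(1) by (intro SUP_upper) auto
    qed (use \<nu> in auto)
  qed
qed

lemma V_nonneg: "0 \<le> V y"
  by (simp add: V_def W_nonneg \<xi>_nonneg)

lemma tamping_weak_derivative: "has_weak_derivative (\<lambda>x. enn2real (tamping \<phi> x)) h"
  by (rule weak_derivative_primitive[OF h_borel h_integrable, of _ "u 0"])
     (simp add: tamping_eq V_nonneg V_eq[symmetric])

lemma g_powr_integrable: "set_integrable lborel {0..} (\<lambda>x. \<bar>g x\<bar> powr p)"
  unfolding set_integrable_def
proof (rule integrableI_bounded)
  have "(\<integral>\<^sup>+ x. ennreal (norm (indicator {0..} x *\<^sub>R (\<bar>g x\<bar> powr p))) \<partial>lborel)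
      = (\<integral>\<^sup>+ x. ennreal (\<bar>g x\<bar> powr p) * indicator {0..} x \<partial>lborel)"
    by (intro nn_integral_cong) (auto simp: indicator_def)
  then show "(\<integral>\<^sup>+ x. ennreal (norm (indicator {0..} x *\<^sub>R (\<bar>g x\<bar> powr p))) \<partial>lborel) < \<infinity>"
    using g_p by simp
qed measurable

lemma h_powr_integrable: "set_integrable lborel {0..} (\<lambda>x. \<bar>h x\<bar> powr p)"
  unfolding set_integrable_def
proof (rule integrableI_bounded)
  have "(\<integral>\<^sup>+ x. ennreal (norm (indicator {0..} x *\<^sub>R (\<bar>h x\<bar> powr p))) \<partial>lborel)
      = (\<integral>\<^sup>+ x. ennreal (\<bar>h x\<bar> powr p) * indicator {0..} x \<partial>lborel)"
    by (intro nn_integral_cong) (auto simp: indicator_def)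
  then show "(\<integral>\<^sup>+ x. ennreal (norm (indicator {0..} x *\<^sub>R (\<bar>h x\<bar> powr p))) \<partial>lborel) < \<infinity>"
    using h_Lp by simp
qed measurable

lemma h_powr_integral_le:
  "(LINT x:{0..}|lborel. \<bar>h x\<bar> powr p) \<le> (LINT x:{0..} - H|lborel. \<bar>g x\<bar> powr p)"
proof -
  have gi: "set_integrable lborel ({0..} - H) (\<lambda>x. \<bar>g x\<bar> powr p)"
    by (rule set_integrable_subset[OF g_powr_integrable]) auto
  have "ennreal (LINT x:{0..}|lborel. \<bar>h x\<bar> powr p) = (\<integral>\<^sup>+ x. ennreal (\<bar>h x\<bar> powr p) * indicator {0..} x \<partial>lborel)"
    using h_powr_integrable unfolding set_lebesgue_integral_def set_integrable_def
    by (subst nn_integral_eq_integral[symmetric]) (auto intro!: nn_integral_cong simp: indicator_def)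
  also have "\<dots> \<le> (\<integral>\<^sup>+ x. ennreal (\<bar>g x\<bar> powr p) * indicator ({0..} - H) x \<partial>lborel)"
    by (rule h_Lp_bound)
  also have "\<dots> = ennreal (LINT x:{0..} - H|lborel. \<bar>g x\<bar> powr p)"
    using gi unfolding set_lebesgue_integral_def set_integrable_def
    by (subst nn_integral_eq_integral[symmetric]) (auto intro!: nn_integral_cong simp: indicator_def)
  finally show ?thesis
    by (subst (asm) ennreal_le_iff) (auto simp: set_lebesgue_integral_def)
qed

text \<open>With this splitting the two forms of the inequality are equivalent.\<close>

lemma g_powr_integral_split:
  "(LINT x:{0..}|lborel. \<bar>g x\<bar> powr p)
    = (LINT x:{0..} - H|lborel. \<bar>g x\<bar> powr p) + (LINT x:H|lborel. \<bar>g x\<bar> powr p)"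
proof -
  have "{0..} = ({0..} - H) \<union> H" using H_pos by force
  moreover have "({0..} - H) \<inter> H = {}" by auto
  moreover have "set_integrable lborel ({0..} - H) (\<lambda>x. \<bar>g x\<bar> powr p)" "set_integrable lborel H (\<lambda>x. \<bar>g x\<bar> powr p)"
    by (rule set_integrable_subset[OF g_powr_integrable]; use H_pos in force)+
  ultimately show ?thesis using set_integral_Un[of "{0..} - H" H lborel] by metis
qed

end

section \<open>The gradient inequality for Sobolev functions\<close>

theorem theorem3p12:
  fixes p :: real and \<phi> g :: "real \<Rightarrow> real"
  assumes "1 \<le> p"
    and "in_W1p p \<phi>"
    and "AE x in lebesgue_on \<real>\<^sub>+. 0 \<le> \<phi> x"
    and "has_weak_derivative \<phi> g"
  shows "(AE x in lebesgue_on \<real>\<^sub>+. tamping \<phi> x < \<infinity>) \<and>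
    (\<exists>h. has_weak_derivative (\<lambda>x. enn2real (tamping \<phi> x)) h \<and> in_Lp p h \<and>
      (LINT x|lebesgue_on (hollows_below \<infinity> \<phi>). \<bar>g x\<bar> powr p)
        \<le> (LINT x|lebesgue_on \<real>\<^sub>+. \<bar>g x\<bar> powr p - \<bar>h x\<bar> powr p) \<and>
      (LINT x|lebesgue_on \<real>\<^sub>+. \<bar>h x\<bar> powr p)
        \<le> (LINT x|lebesgue_on (\<real>\<^sub>+ - hollows_below \<infinity> \<phi>). \<bar>g x\<bar> powr p))"
proof -
  obtain u g' where rep: "decaying_Lp u g' p" "AE x in lebesgue. 0 \<le> x \<longrightarrow> \<phi> x = u x"
    and gg': "AE x in lebesgue. 0 \<le> x \<longrightarrow> g x = g' x"
    using W1p_representative[OF assms] .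
  interpret decaying_version u g' p \<phi>
    using rep by (simp add: decaying_version_def decaying_version_axioms_def)
  have HB: "AE x in lebesgue. x \<in> hollows_below \<infinity> \<phi> \<longleftrightarrow> x \<in> H" by (rule hollows_below_AE)
  have HB': "AE x in lebesgue. x \<in> \<real>\<^sub>+ - hollows_below \<infinity> \<phi> \<longleftrightarrow> x \<in> {0..} - H"
    using HB by eventually_elim auto
  have triv: "AE x in lebesgue. x \<in> \<real>\<^sub>+ \<longleftrightarrow> x \<in> {0..}" by simp
  have g_eq: "AE x in lebesgue. x \<in> N \<longrightarrow> \<bar>g x\<bar> powr p = \<bar>g' x\<bar> powr p" if "N \<subseteq> {0..}" for N
    using gg' by eventually_elim (use that in auto)
  have h_eq: "AE x in lebesgue. x \<in> {0..} \<longrightarrow> \<bar>h x\<bar> powr p = \<bar>h x\<bar> powr p" by simp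
  have H_sub: "H \<subseteq> {0..}" "{0..} - H \<subseteq> {0..}" using H_pos by force+
  have gpm: "(\<lambda>x. \<bar>g' x\<bar> powr p) \<in> borel_measurable borel" "(\<lambda>x. \<bar>h x\<bar> powr p) \<in> borel_measurable borel"
    by measurable
  \<comment> \<open>Four transfers rewrite the integrals over Borel sets, with \<open>H\<close> in
    place of the hollows.\<close>
  note tg = lebesgue_on_transfer[OF triv _ g_eq[OF order_refl] gpm(1)]
  note th = lebesgue_on_transfer[OF triv _ h_eq gpm(2)]
  note tH = lebesgue_on_transfer[OF HB H_borel g_eq[OF H_sub(1)] gpm(1)]
  note tHc = lebesgue_on_transfer[OF HB' _ g_eq[OF H_sub(2)] gpm(1)]
  have gi: "integrable (lebesgue_on \<real>\<^sub>+) (\<lambda>x. \<bar>g x\<bar> powr p)" using tg(3) g_powr_integrable by simp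
  have hi: "integrable (lebesgue_on \<real>\<^sub>+) (\<lambda>x. \<bar>h x\<bar> powr p)" using th(3) h_powr_integrable by simp
  have "h \<in> borel_measurable (lebesgue_on \<real>\<^sub>+)"
    using lebesgue_on_transfer(4)[OF triv _ _ h_borel, of h] by simp
  then have "in_Lp p h" using hi by (simp add: in_Lp_def)
  moreover have "(LINT x|lebesgue_on (hollows_below \<infinity> \<phi>). \<bar>g x\<bar> powr p)
        \<le> (LINT x|lebesgue_on \<real>\<^sub>+. \<bar>g x\<bar> powr p - \<bar>h x\<bar> powr p)"
    using gi hi tg(2) th(2) tH(2) h_powr_integral_le g_powr_integral_split by simp
  moreover have "(LINT x|lebesgue_on \<real>\<^sub>+. \<bar>h x\<bar> powr p)
        \<le> (LINT x|lebesgue_on (\<real>\<^sub>+ - hollows_below \<infinity> \<phi>). \<bar>g x\<bar> powr p)"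
    using th(2) tHc(2) h_powr_integral_le by simp
  \<comment> \<open>Finiteness holds at every point, where the tamping equals \<open>ennreal\<close>
    of a real number.\<close>
  moreover have "AE x in lebesgue_on \<real>\<^sub>+. tamping \<phi> x < \<infinity>"
    by (intro AE_I2) (simp add: tamping_eq)
  ultimately show ?thesis using tamping_weak_derivative by blast
qed

end
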